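(* Let $\varepsilon=\pm$. There exists $\alpha_0>0$ such that the function $\chi^\varepsilon(\alpha,r,s)$ is real-analytic for $(r,s,\alpha)\in\mathbb R^2\times I$, where $I=(-\alpha_0,\alpha_0)$. Moreover, it admits a convergent power series $$\chi^\varepsilon(\alpha,r,s)=\sum_{l\ge0}f_l^\varepsilon(s,r)\alpha^l,$$ where the $f_l^\varepsilon(s,r)$ are real-analytic functions of $(s,r)\in\mathbb R^2$, $2\pi$-periodic in $s$ (therefore bounded over $\mathbb R\times[0,1]$). As a consequence, the extremal front $\mathcal F(\alpha,k_M\pi)$, which is a continuous closed curve, is piecewise analytic, with the discontinuities of its derivatives of order greater than or equal to one located at $s=0,\pi$.
   Context: Let $$F=\begin{pmatrix}0&-\cos\alpha&0\\ \cos\alpha&0&0\\0&0&0\end{pmatrix},\quad G=\begin{pmatrix}0&0&0\\0&0&-\sin\alpha\\0&\sin\alpha&0\end{pmatrix},\quad X_\pm=F\pm G,\quad N=(0,0,1)^T,$$ $v(s)=\pi+2\arctan\frac{\sin s}{\cos s+\cot^2\alpha}$, and $$Z_{\pm}(t)=\begin{pmatrix}0&-C(t)&\mp B(t)\\ C(t)&0&0\\ \pm B(t)&0&0\end{pmatrix},\quad B(t)=\frac{\sin\alpha\,\sin(t/2)}{\sqrt{\sin^2(t/2)\sin^2\alpha+\cos^2(t/2)}},\quad C(t)=\frac{-\cos(t/2)}{\sqrt{\sin^2(t/2)\sin^2\alpha+\cos^2(t/2)}},$$ $$\Theta(t)=2\arccos\big(\sin^2(t/2)\cos2\alpha-\cos^2(t/2)\big).$$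 (So $e^{tX_+}e^{tX_-}=e^{\Theta(t)Z_-(t)}$ and $e^{tX_-}e^{tX_+}=e^{\Theta(t)Z_+(t)}$.) Treating $\alpha$ and $r$ as independent variables, put $$\psi(\alpha,r,s)=\Big(\frac{\pi}{2\alpha}-r\Big)(\pi-v(s))+v(s)-s,\qquad \theta(\alpha,r,s)=\Big(\frac{\pi}{4\alpha}-\frac{1+r}{2}\Big)\Theta(v(s)),$$ $$\chi^\varepsilon(\alpha,r,s)=e^{\psi(\alpha,r,s)X_{-\varepsilon}}\,e^{\theta(\alpha,r,s)Z_{-\varepsilon}(v(s))}\,e^{sX_\varepsilon}N,$$ extended to $\alpha=0$ by its limit. For $\alpha\in(0,\pi/4)$ let $k_M=[\pi/(2\alpha)]$ (integer part) be assumed odd and $r(\alpha)=\pi/(2\alpha)-k_M$. The extremal front $\mathcal F(\alpha,k_M\pi)$ is the set of points of $S^2$ reached at time $k_M\pi$ by trajectories of $\dot x=(F+uG)x$, $|u|\le1$, starting from $N$ and satisfying the Pontryagin Maximum Principle for the minimum time problem. For $\alpha>0$ small it is the union of the curves $s\mapsto\mathcal E^\pm(\alpha,s)=\chi^\pm(\alpha,r(\alpha),s)$, $s\in(0,\pi]$, where $\mathcal E^\varepsilon(\alpha,0)=\mathcal E^{-\varepsilon}(\alpha,\pi)$; the parameter values $s=0,\pi$ are the junctions of the two arcs. *)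

theory Defs
  imports "HOL-Analysis.Analysis"
begin

section \<open>Real-analytic functions of several variables\<close>

text \<open>
  Around every point of \<open>S\<close> the function is the sum of a multi-index power series in the
  coordinates of the increment \<open>h\<close>. A multi-index assigns an exponent to each basis vector;
  \<open>has_sum\<close> is unconditional convergence. Since \<open>f\<close> is a total function and \<open>x + h\<close> ranges
  over a full ball, analyticity on a non-open \<open>S\<close> means analyticity on a neighbourhood
  of \<open>S\<close>.
\<close>

definition real_analytic_on ::
    "('a::euclidean_space \<Rightarrow> 'b::real_normed_vector) \<Rightarrow> 'a set \<Rightarrow> bool"
    (infixl "real'_analytic'_on" 50) where
  "f real_analytic_on S \<longleftrightarrow>
     (\<forall>x\<in>S. \<exists>(c :: ('a \<Rightarrow> nat) \<Rightarrow> 'b) e. e > 0 \<and>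
        (\<forall>h. norm h < e \<longrightarrow>
           ((\<lambda>m. (\<Prod>b\<in>Basis. (h \<bullet> b) ^ m b) *\<^sub>R c m) has_sum f (x + h))
             (Basis \<rightarrow>\<^sub>E UNIV)))"

text \<open>
  A continuous curve on \<open>[a,b]\<close> is piecewise analytic with break points \<open>K\<close> if on every closed
  subinterval whose interior misses \<open>K\<close> it coincides with a function that is analytic up to
  (and across) the end points.
\<close>

definition piecewise_analytic_on ::
    "(real \<Rightarrow> 'b::real_normed_vector) \<Rightarrow> real \<Rightarrow> real \<Rightarrow> real set \<Rightarrow> bool" where
  "piecewise_analytic_on \<gamma> a b K \<longleftrightarrow>
     finite K \<and> continuous_on {a..b} \<gamma> \<and>
     (\<forall>c d. a \<le> c \<and> c < d \<and> d \<le> b \<and> {c<..<d} \<inter> K = {} \<longrightarrow>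
        (\<exists>g. g real_analytic_on {c..d} \<and> (\<forall>t\<in>{c..d}. \<gamma> t = g t)))"


section \<open>The control system\<close>

definition mat_exp :: "real^'n^'n \<Rightarrow> real^'n^'n" where
  "mat_exp A = (\<Sum>k. (1 / fact k) *\<^sub>R (((**) A) ^^ k) (mat 1))"

definition F_mat :: "real \<Rightarrow> real^3^3" where
  "F_mat \<alpha> = vector [vector [0, - cos \<alpha>, 0],
                     vector [cos \<alpha>, 0, 0],
                     vector [0, 0, 0]]"

definition G_mat :: "real \<Rightarrow> real^3^3" where
  "G_mat \<alpha> = vector [vector [0, 0, 0],
                     vector [0, 0, - sin \<alpha>],
                     vector [0, sin \<alpha>, 0]]"

text \<open>Here and below a sign \<open>\<epsilon> = \<plusminus>\<close> is a real number in \<open>{1, -1}\<close>.\<close>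

definition X_mat :: "real \<Rightarrow> real \<Rightarrow> real^3^3" where
  "X_mat \<epsilon> \<alpha> = F_mat \<alpha> + \<epsilon> *\<^sub>R G_mat \<alpha>"

definition north :: "real^3" where
  "north = vector [0, 0, 1]"

text \<open>
  Admissible controls are measurable with values in \<open>[-1,1]\<close>. The state equation is meant in the
  Caratheodory (absolutely continuous) sense, i.e. as an integral equation. All matrices are
  skew-symmetric, so trajectories starting at \<open>north\<close> stay on the unit sphere.
\<close>

definition control_matrix :: "real \<Rightarrow> real \<Rightarrow> real^3^3" where
  "control_matrix \<alpha> w = F_mat \<alpha> + w *\<^sub>R G_mat \<alpha>"

definition admissible_control :: "real \<Rightarrow> (real \<Rightarrow> real) \<Rightarrow> bool" where
  "admissible_control T u \<longleftrightarrow>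
     u \<in> borel_measurable (lebesgue_on {0..T}) \<and> (\<forall>t\<in>{0..T}. \<bar>u t\<bar> \<le> 1)"

definition trajectory ::
    "real \<Rightarrow> real \<Rightarrow> (real \<Rightarrow> real) \<Rightarrow> (real \<Rightarrow> real^3) \<Rightarrow> bool" where
  "trajectory \<alpha> T u x \<longleftrightarrow>
     x 0 = north \<and>
     (\<forall>t\<in>{0..T}. ((\<lambda>\<tau>. control_matrix \<alpha> (u \<tau>) *v x \<tau>) has_integral (x t - x 0)) {0..t})"

definition hamiltonian :: "real \<Rightarrow> real^3 \<Rightarrow> real^3 \<Rightarrow> real \<Rightarrow> real" where
  "hamiltonian \<alpha> p x w = p \<bullet> (control_matrix \<alpha> w *v x)"

text \<open>
  Pontryagin Maximum Principle for minimum time on the sphere. A covector at \<open>x\<close> is identified,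
  through the Euclidean inner product, with a vector \<open>p\<close> orthogonal to \<open>x\<close>. The conditions are:
  \<open>p\<close> never vanishes, the adjoint equation holds, the control maximizes the Hamiltonian almost
  everywhere, and the maximized Hamiltonian is a nonnegative constant (zero in the abnormal
  case).
\<close>

definition satisfies_PMP ::
    "real \<Rightarrow> real \<Rightarrow> (real \<Rightarrow> real) \<Rightarrow> (real \<Rightarrow> real^3) \<Rightarrow> bool" where
  "satisfies_PMP \<alpha> T u x \<longleftrightarrow>
     (\<exists>(p :: real \<Rightarrow> real^3) \<mu> :: real.
        (\<forall>t\<in>{0..T}. p t \<noteq> 0 \<and> p t \<bullet> x t = 0) \<and>
        (\<forall>t\<in>{0..T}. ((\<lambda>\<tau>. - (transpose (control_matrix \<alpha> (u \<tau>)) *v p \<tau>))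
                        has_integral (p t - p 0)) {0..t}) \<and>
        (AE t in lebesgue_on {0..T}.
           \<forall>w\<in>{-1..1}. hamiltonian \<alpha> (p t) (x t) w \<le> hamiltonian \<alpha> (p t) (x t) (u t)) \<and>
        \<mu> \<ge> 0 \<and>
        (AE t in lebesgue_on {0..T}. hamiltonian \<alpha> (p t) (x t) (u t) = \<mu>))"

definition extremal_front :: "real \<Rightarrow> real \<Rightarrow> (real^3) set" where
  "extremal_front \<alpha> T =
     {x T | x u. admissible_control T u \<and> trajectory \<alpha> T u x \<and> satisfies_PMP \<alpha> T u x}"


section \<open>The parametrization of the extremal front\<close>

definition v_fun :: "real \<Rightarrow> real \<Rightarrow> real" where
  "v_fun \<alpha> s = pi + 2 * arctan (sin s / (cos s + (cot \<alpha>)\<^sup>2))"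

definition B_fun :: "real \<Rightarrow> real \<Rightarrow> real" where
  "B_fun \<alpha> t =
     sin \<alpha> * sin (t / 2) / sqrt ((sin (t / 2))\<^sup>2 * (sin \<alpha>)\<^sup>2 + (cos (t / 2))\<^sup>2)"

definition C_fun :: "real \<Rightarrow> real \<Rightarrow> real" where
  "C_fun \<alpha> t =
     - cos (t / 2) / sqrt ((sin (t / 2))\<^sup>2 * (sin \<alpha>)\<^sup>2 + (cos (t / 2))\<^sup>2)"

definition Z_mat :: "real \<Rightarrow> real \<Rightarrow> real \<Rightarrow> real^3^3" where
  "Z_mat \<epsilon> \<alpha> t = vector [vector [0, - C_fun \<alpha> t, - \<epsilon> * B_fun \<alpha> t],
                         vector [C_fun \<alpha> t, 0, 0],
                         vector [\<epsilon> * B_fun \<alpha> t, 0, 0]]"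

definition Theta_fun :: "real \<Rightarrow> real \<Rightarrow> real" where
  "Theta_fun \<alpha> t = 2 * arccos ((sin (t / 2))\<^sup>2 * cos (2 * \<alpha>) - (cos (t / 2))\<^sup>2)"

definition psi_fun :: "real \<Rightarrow> real \<Rightarrow> real \<Rightarrow> real" where
  "psi_fun \<alpha> r s = (pi / (2 * \<alpha>) - r) * (pi - v_fun \<alpha> s) + v_fun \<alpha> s - s"

definition theta_fun :: "real \<Rightarrow> real \<Rightarrow> real \<Rightarrow> real" where
  "theta_fun \<alpha> r s = (pi / (4 * \<alpha>) - (1 + r) / 2) * Theta_fun \<alpha> (v_fun \<alpha> s)"

definition chi_formula :: "real \<Rightarrow> real \<Rightarrow> real \<Rightarrow> real \<Rightarrow> real^3" where
  "chi_formula \<epsilon> \<alpha> r s =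
     mat_exp (psi_fun \<alpha> r s *\<^sub>R X_mat (- \<epsilon>) \<alpha>) *v
       (mat_exp (theta_fun \<alpha> r s *\<^sub>R Z_mat (- \<epsilon>) \<alpha> (v_fun \<alpha> s)) *v
         (mat_exp (s *\<^sub>R X_mat \<epsilon> \<alpha>) *v north))"

text \<open>
  The formula is meaningless at \<open>\<alpha> = 0\<close>, where division by zero would yield a junk value;
  there the value is the (two-sided) limit as \<open>\<alpha>\<close> tends to \<open>0\<close> with \<open>r\<close> and \<open>s\<close> fixed.
\<close>

definition chi :: "real \<Rightarrow> real \<Rightarrow> real \<Rightarrow> real \<Rightarrow> real^3" where
  "chi \<epsilon> \<alpha> r s =
     (if \<alpha> = 0 then Lim (at 0) (\<lambda>a. chi_formula \<epsilon> a r s) else chi_formula \<epsilon> \<alpha> r s)"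

definition k_M :: "real \<Rightarrow> int" where
  "k_M \<alpha> = \<lfloor>pi / (2 * \<alpha>)\<rfloor>"

definition r_M :: "real \<Rightarrow> real" where
  "r_M \<alpha> = pi / (2 * \<alpha>) - of_int (k_M \<alpha>)"

definition front_arc :: "real \<Rightarrow> real \<Rightarrow> real \<Rightarrow> real^3" where
  "front_arc \<epsilon> \<alpha> s = chi \<epsilon> \<alpha> (r_M \<alpha>) s"

text \<open>
  The two arcs, each with parameter \<open>s\<close> in \<open>[0,pi]\<close>, joined into one curve on \<open>[0, 2 pi]\<close>. The
  junctions \<open>s = 0, pi\<close> of the arcs become the parameters \<open>0\<close>, \<open>pi\<close>, \<open>2 pi\<close>.
\<close>

definition front_curve :: "real \<Rightarrow> real \<Rightarrow> real^3" where
  "front_curve \<alpha> t = (if t \<le> pi then front_arc 1 \<alpha> t else front_arc (-1) \<alpha> (t - pi))"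

end

theory Submission
  imports Defs "HOL-Complex_Analysis.Complex_Analysis"
begin

text \<open>
  Since \<open>X\<^sub>\<plusminus>\<close> and \<open>Z\<^sub>\<plusminus>\<close> generate rotations about unit axes, \<open>\<chi>\<close> is a polynomial in the sines and cosines
  of the angles and the components of the axes. The functions \<open>\<Theta>\<close>, \<open>B\<close>, \<open>C\<close> are not analytic at \<open>\<alpha> = 0\<close>,
  but the sign of \<open>\<alpha>\<close> responsible for this occurs in the angle \<open>\<theta>\<close> and in the axis of \<open>Z\<close> and cancels;
  the poles \<open>1 / \<alpha>\<close> cancel because \<open>\<pi> - v = O(\<alpha>\<^sup>2)\<close> and \<open>\<Theta> = O(\<alpha>)\<close>. What remains extends
  holomorphically to complex \<open>\<alpha>\<close> in a disc independent of the real parameters \<open>r\<close>, \<open>s\<close>, which gives the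
  uniform radius of convergence.

  For the front, the angular momentum \<open>m = x \<times> p\<close> of an extremal obeys the same rotation equation as \<open>x\<close>
  and \<open>p\<close>, the optimal control is the sign of \<open>m\<^sub>1\<close>, and \<open>m\<^sub>1' = - cos \<alpha> m\<^sub>2\<close> does not
  involve the control. As \<open>m\<^sub>3 = 0\<close> at the north pole and \<open>\<alpha> < \<pi> / 4\<close>, the component \<open>m\<^sub>2\<close> never
  vanishes together with \<open>m\<^sub>1\<close>, so every extremal is bang-bang; solving for the zeros of \<open>m\<^sub>1\<close> shows that
  all arcs but the first and the last have length \<open>v(s)\<close>, where \<open>s\<close> is the length of the first.
\<close>

section \<open>Multi-index power series\<close>

text \<open>Analyticity is demanded as an unconditionally convergent multi-index expansion, jointly
  in all variables, whereas holomorphy serves one complex variable at a time. Hence a small calculus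
  of absolutely convergent multi-index series, whose one substantial rule is composition with a
  holomorphic function of one variable: \<open>chi\<close> is assembled from coordinates by ring
  operations and such compositions. The coefficients in the expansion of \<open>chi\<close> are
  complex Taylor coefficients in \<alpha>; their analyticity in (s, r) comes from comparing that
  Taylor series with the joint expansion.

  For the front, the formula for \<open>chi\<close> fixes the number of interior arcs in advance: it
  is 2i when \<open>k_M\<close> is 2i + 1. This must be the right number for every s in (0, pi],
  although v may exceed pi. The excess v - pi is at most of order (pi - s) \<alpha>^2 and i at most
  of order 1/\<alpha>, so the accumulated delay stays within pi - s once \<alpha> < 1/4. This
  comparison is what makes the front equal to the two arcs.\<close>

definition multi_indices :: "('a::euclidean_space \<Rightarrow> nat) set" where
  "multi_indices = Basis \<rightarrow>\<^sub>E UNIV"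

definition mpow :: "'a::euclidean_space \<Rightarrow> ('a \<Rightarrow> nat) \<Rightarrow> real" where
  "mpow h m = (\<Prod>b\<in>Basis. (h \<bullet> b) ^ m b)"

definition mdeg :: "('a::euclidean_space \<Rightarrow> nat) \<Rightarrow> nat" where
  "mdeg m = (\<Sum>b\<in>Basis. m b)"

text \<open>The restriction to \<open>Basis\<close> keeps the sum extensional, so that each exponent
  vector is represented by exactly one function.\<close>

definition madd :: "('a::euclidean_space \<Rightarrow> nat) \<Rightarrow> ('a \<Rightarrow> nat) \<Rightarrow> 'a \<Rightarrow> nat" where
  "madd m n = (\<lambda>b\<in>Basis. m b + n b)"

text \<open>A closed cube rather than a ball: on it every monomial is bounded by
  \<open>\<rho>\<close> to its degree, so one weighted coefficient sum majorizes the series at all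
  points simultaneously.\<close>

definition mcube :: "real \<Rightarrow> ('a::euclidean_space) set" where
  "mcube \<rho> = {h. \<forall>b\<in>Basis. \<bar>h \<bullet> b\<bar> \<le> \<rho>}"

text \<open>The bound \<open>K\<close> on the weighted coefficient sum is submultiplicative, which makes the series of
  powers in a composition converge.\<close>

definition has_mseries :: "real \<Rightarrow> real \<Rightarrow> ('a::euclidean_space \<Rightarrow> 'b::banach) \<Rightarrow> bool" where
  "has_mseries \<rho> K f \<longleftrightarrow> \<rho> > 0 \<and> (\<exists>c S. S \<le> K \<and>
     ((\<lambda>m. norm (c m) * \<rho> ^ mdeg m) has_sum S) multi_indices \<and>
     (\<forall>h\<in>mcube \<rho>. ((\<lambda>m. mpow h m *\<^sub>R c m) has_sum f h) multi_indices))"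

definition mseries_at :: "('a::euclidean_space \<Rightarrow> 'b::banach) \<Rightarrow> 'a \<Rightarrow> bool" where
  "mseries_at f x \<longleftrightarrow> (\<exists>\<rho> K. has_mseries \<rho> K (\<lambda>h. f (x + h)))"

lemma madd_in [simp]: "madd m n \<in> multi_indices"
  by (auto simp: madd_def multi_indices_def)

lemma mpow_madd: "mpow h (madd m n) = mpow h m * mpow h n"
  by (simp add: mpow_def madd_def power_add prod.distrib)

lemma mdeg_madd: "mdeg (madd m n) = mdeg m + mdeg n"
  by (simp add: mdeg_def madd_def sum.distrib)

lemma abs_mpow_le: "h \<in> mcube \<rho> \<Longrightarrow> \<bar>mpow h m\<bar> \<le> \<rho> ^ mdeg m"
  unfolding mpow_def mdeg_def abs_prod power_sum
  by (rule prod_mono) (auto simp: mcube_def power_abs intro: power_mono)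

lemma mcube_mono: "\<sigma> \<le> \<rho> \<Longrightarrow> mcube \<sigma> \<subseteq> mcube \<rho>"
  by (force simp: mcube_def)

lemma ball_subset_mcube: "norm h < \<rho> \<Longrightarrow> h \<in> mcube \<rho>"
  by (auto simp: mcube_def intro: order.trans[OF Basis_le_norm])

text \<open>Any series of monomials may be regrouped by exponents; closure properties follow by
  choosing a convenient index set.\<close>

lemma has_mseries_regroup:
  fixes a :: "'i \<Rightarrow> 'b::banach" and f :: "'a::euclidean_space \<Rightarrow> 'b"
  assumes \<mu>: "\<And>i. i \<in> I \<Longrightarrow> \<mu> i \<in> multi_indices" and \<rho>: "\<rho> > 0"
    and K: "((\<lambda>i. norm (a i) * \<rho> ^ mdeg (\<mu> i)) has_sum K) I"
    and f: "\<And>h. h \<in> mcube \<rho> \<Longrightarrow> ((\<lambda>i. mpow h (\<mu> i) *\<^sub>R a i) has_sum f h) I"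
  shows "has_mseries \<rho> K f"
proof -
  define B where "B m = {i \<in> I. \<mu> i = m}" for m
  define c where "c m = infsum a (B m)" for m
  \<comment> \<open>The index set is split into the fibres of \<open>\<mu>\<close>; summing first
    over each fibre yields the coefficient \<open>c m\<close>.\<close>
  have I: "I = snd ` Sigma multi_indices B"
    using \<mu> by (force simp: B_def)
  have inj: "inj_on snd (Sigma multi_indices B)"
    by (auto simp: inj_on_def B_def)
  have Kn: "((\<lambda>p. norm (a (snd p)) * \<rho> ^ mdeg (fst p)) has_sum K) (Sigma multi_indices B)"
    using K unfolding I has_sum_reindex[OF inj]
    by (rule has_sum_cong[THEN iffD1, rotated]) (auto simp: B_def)
  have Bn: "(\<lambda>i. norm (a i) * \<rho> ^ mdeg m) summable_on B m" if "m \<in> multi_indices" for m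
    using has_sum_imp_summable[OF K]
    by (rule summable_on_subset_banach[THEN summable_on_cong[THEN iffD1, rotated]]) (auto simp: B_def)
  have Ba: "(\<lambda>i. norm (a i)) summable_on B m" if "m \<in> multi_indices" for m
    using summable_on_cmult_left[OF Bn[OF that], of "1 / \<rho> ^ mdeg m"] \<rho> by simp
  have Bc: "(a has_sum c m) (B m)" if "m \<in> multi_indices" for m
    unfolding c_def using Ba[OF that] abs_summable_summable has_sum_infsum by blast
  have out: "((\<lambda>m. infsum (\<lambda>i. norm (a i)) (B m) * \<rho> ^ mdeg m) has_sum K) multi_indices"
    using Kn
  proof (rule has_sum_SigmaD)
    fix m :: "'a \<Rightarrow> nat" assume "m \<in> multi_indices"
    from has_sum_cmult_left[OF has_sum_infsum[OF Ba[OF this]], of "\<rho> ^ mdeg m"]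
    show "((\<lambda>y. norm (a (snd (m, y))) * \<rho> ^ mdeg (fst (m, y))) has_sum
         infsum (\<lambda>i. norm (a i)) (B m) * \<rho> ^ mdeg m) (B m)" by simp
  qed
  have le: "norm (c m) * \<rho> ^ mdeg m \<le> infsum (\<lambda>i. norm (a i)) (B m) * \<rho> ^ mdeg m"
    if "m \<in> multi_indices" for m
    using norm_infsum_bound[OF Ba[OF that]] \<rho> unfolding c_def by (simp add: mult_right_mono)
  have "(\<lambda>m. norm (c m) * \<rho> ^ mdeg m) summable_on multi_indices"
    using has_sum_imp_summable[OF out] by (rule summable_on_comparison_test) (use le \<rho> in auto)
  then obtain S where S: "((\<lambda>m. norm (c m) * \<rho> ^ mdeg m) has_sum S) multi_indices"
    using has_sum_infsum by blast
  have "S \<le> K" using S out by (rule has_sum_mono) (use le in auto)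
  moreover have "((\<lambda>m. mpow h m *\<^sub>R c m) has_sum f h) multi_indices" if h: "h \<in> mcube \<rho>" for h
  proof -
    have "((\<lambda>p. mpow h (fst p) *\<^sub>R a (snd p)) has_sum f h) (Sigma multi_indices B)"
      using f[OF h] unfolding I has_sum_reindex[OF inj]
      by (rule has_sum_cong[THEN iffD1, rotated]) (auto simp: B_def)
    then show ?thesis
    proof (rule has_sum_SigmaD)
      fix m :: "'a \<Rightarrow> nat" assume "m \<in> multi_indices"
      from has_sum_scaleR[OF Bc[OF this], of "mpow h m"]
      show "((\<lambda>y. mpow h (fst (m, y)) *\<^sub>R a (snd (m, y))) has_sum mpow h m *\<^sub>R c m) (B m)" by simp
    qed
  qed
  ultimately show ?thesis using \<rho> S unfolding has_mseries_def by blast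
qed

section \<open>Arithmetic of multi-index series on a fixed cube\<close>

lemma has_mseries_summable:
  fixes a :: "'i \<Rightarrow> 'b::banach"
  assumes "((\<lambda>i. norm (a i) * \<rho> ^ mdeg (\<mu> i)) has_sum K) I" "h \<in> mcube \<rho>"
  shows "(\<lambda>i. norm (mpow h (\<mu> i) *\<^sub>R a i)) summable_on I"
  using has_sum_imp_summable[OF assms(1)]
proof (rule summable_on_comparison_test)
  fix i
  show "norm (mpow h (\<mu> i) *\<^sub>R a i) \<le> norm (a i) * \<rho> ^ mdeg (\<mu> i)"
    using mult_left_mono[OF abs_mpow_le[OF assms(2), of "\<mu> i"], of "norm (a i)"] by (simp add: mult.commute)
qed auto

lemma has_mseries_cong:
  "has_mseries \<rho> K f \<Longrightarrow> (\<And>h. h \<in> mcube \<rho> \<Longrightarrow> f h = g h) \<Longrightarrow> has_mseries \<rho> K g"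
  unfolding has_mseries_def by (simp cong: ball_cong)

lemma has_mseries_norm_le:
  assumes "has_mseries \<rho> K f" "h \<in> mcube \<rho>"
  shows "norm (f h) \<le> K"
proof -
  obtain c S where c: "S \<le> K" "((\<lambda>m. norm (c m) * \<rho> ^ mdeg m) has_sum S) multi_indices"
    "((\<lambda>m. mpow h m *\<^sub>R c m) has_sum f h) multi_indices"
    using assms unfolding has_mseries_def by blast
  note s = has_mseries_summable[OF c(2) assms(2)]
  have "norm (f h) = norm (infsum (\<lambda>m. mpow h m *\<^sub>R c m) multi_indices)"
    using infsumI[OF c(3)] by simp
  also have "\<dots> \<le> infsum (\<lambda>m. norm (mpow h m *\<^sub>R c m)) multi_indices"
    by (rule norm_infsum_bound[OF s])
  also have "\<dots> \<le> S"
    using has_sum_infsum[OF s] c(2)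
  proof (rule has_sum_mono)
    fix m :: "'a \<Rightarrow> nat"
    show "norm (mpow h m *\<^sub>R c m) \<le> norm (c m) * \<rho> ^ mdeg m"
      using mult_left_mono[OF abs_mpow_le[OF assms(2), of m], of "norm (c m)"] by (simp add: mult.commute)
  qed
  finally show ?thesis using c(1) by simp
qed

lemma has_mseries_weaken:
  assumes f: "has_mseries \<rho> K f" and "0 < \<sigma>" "\<sigma> \<le> \<rho>" "K \<le> L"
  shows "has_mseries \<sigma> L f"
proof -
  obtain c S where c: "S \<le> K" "((\<lambda>m. norm (c m) * \<rho> ^ mdeg m) has_sum S) multi_indices"
    "\<And>h. h\<in>mcube \<rho> \<Longrightarrow> ((\<lambda>m. mpow h m *\<^sub>R c m) has_sum f h) multi_indices"
    using f unfolding has_mseries_def by blast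
  have le: "norm (c m) * \<sigma> ^ mdeg m \<le> norm (c m) * \<rho> ^ mdeg m" for m
    using assms by (intro mult_left_mono power_mono) auto
  have "(\<lambda>m. norm (c m) * \<sigma> ^ mdeg m) summable_on multi_indices"
    using has_sum_imp_summable[OF c(2)] by (rule summable_on_comparison_test) (use le assms in auto)
  then obtain S' where S': "((\<lambda>m. norm (c m) * \<sigma> ^ mdeg m) has_sum S') multi_indices"
    using has_sum_infsum by blast
  have "S' \<le> S" using S' c(2) by (rule has_sum_mono) (use le in auto)
  with c assms S' mcube_mono[OF assms(3)] show ?thesis
    unfolding has_mseries_def by (intro conjI exI[of _ c] exI[of _ S']) auto
qed

lemma has_sum_Times_mult:
  fixes f :: "'i \<Rightarrow> 'c::{banach,real_normed_algebra}"
  assumes f: "(f has_sum a) A" "(\<lambda>i. norm (f i)) summable_on A" and g: "(g has_sum b) B" "(\<lambda>i. norm (g i)) summable_on B"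
  shows "((\<lambda>(i, j). f i * g j) has_sum (a * b)) (A \<times> B)"
    and "(\<lambda>(i, j). norm (f i) * norm (g j)) summable_on A \<times> B"
proof -
  show s: "(\<lambda>(i, j). norm (f i) * norm (g j)) summable_on A \<times> B"
  proof -
    have "((\<lambda>(i, j). norm (f i) * norm (g j)) has_sum (infsum (\<lambda>i. norm (f i)) A * infsum (\<lambda>i. norm (g i)) B)) (A \<times> B)"
    proof (rule has_sum_SigmaI)
      show "((\<lambda>y. case (x, y) of (i, j) \<Rightarrow> norm (f i) * norm (g j)) has_sum norm (f x) * infsum (\<lambda>i. norm (g i)) B) B" for x
        using has_sum_cmult_right[OF has_sum_infsum[OF g(2)]] by simp
      show "((\<lambda>x. norm (f x) * infsum (\<lambda>i. norm (g i)) B) has_sum infsum (\<lambda>i. norm (f i)) A * infsum (\<lambda>i. norm (g i)) B) A"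
        using has_sum_cmult_left[OF has_sum_infsum[OF f(2)]] by simp
      show "(\<lambda>(i, j). norm (f i) * norm (g j)) summable_on A \<times> B"
      proof (rule summable_on_SigmaI)
        show "((\<lambda>y. case (x, y) of (i, j) \<Rightarrow> norm (f i) * norm (g j)) has_sum norm (f x) * infsum (\<lambda>i. norm (g i)) B) B" for x
          using has_sum_cmult_right[OF has_sum_infsum[OF g(2)]] by simp
        show "(\<lambda>x. norm (f x) * infsum (\<lambda>i. norm (g i)) B) summable_on A"
          using summable_on_cmult_left[OF f(2)] by simp
      qed auto
    qed
    then show ?thesis by (rule has_sum_imp_summable)
  qed
  have "(\<lambda>p. norm (f (fst p) * g (snd p))) summable_on A \<times> B"
    using s by (rule summable_on_comparison_test) (auto simp: norm_mult_ineq)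
  then have s': "(\<lambda>(i, j). f i * g j) summable_on A \<times> B"
    using abs_summable_summable by (simp add: case_prod_unfold)
  show "((\<lambda>(i, j). f i * g j) has_sum (a * b)) (A \<times> B)"
  proof (rule has_sum_SigmaI)
    show "((\<lambda>y. case (x, y) of (i, j) \<Rightarrow> f i * g j) has_sum f x * b) B" for x
      using has_sum_cmult_right[OF g(1)] by simp
    show "((\<lambda>x. f x * b) has_sum a * b) A"
      using has_sum_cmult_left[OF f(1)] by simp
  qed (rule s')
qed

text \<open>Cauchy product: the family of products is indexed by pairs of exponents, and regrouping
  collects the pairs with equal \<open>madd\<close>. Submultiplicativity of the norm gives the bound
  \<open>K * L\<close>.\<close>

lemma has_mseries_mult:
  fixes f g :: "'a::euclidean_space \<Rightarrow> 'b::{banach,real_normed_algebra}"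
  assumes "has_mseries \<rho> K f" "has_mseries \<rho> L g"
  shows "has_mseries \<rho> (K * L) (\<lambda>h. f h * g h)"
proof -
  obtain c S where c: "S \<le> K" "((\<lambda>m. norm (c m) * \<rho> ^ mdeg m) has_sum S) multi_indices"
    "\<And>h. h\<in>mcube \<rho> \<Longrightarrow> ((\<lambda>m. mpow h m *\<^sub>R c m) has_sum f h) multi_indices" and \<rho>: "\<rho> > 0"
    using assms(1) unfolding has_mseries_def by blast
  obtain d T where d: "T \<le> L" "((\<lambda>m. norm (d m) * \<rho> ^ mdeg m) has_sum T) multi_indices"
    "\<And>h. h\<in>mcube \<rho> \<Longrightarrow> ((\<lambda>m. mpow h m *\<^sub>R d m) has_sum g h) multi_indices"
    using assms(2) unfolding has_mseries_def by blast
  have nn: "S \<ge> 0" "T \<ge> 0"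
    using c(2) d(2) \<rho> by (auto intro: has_sum_nonneg)
  let ?I = "multi_indices \<times> multi_indices :: (('a \<Rightarrow> nat) \<times> ('a \<Rightarrow> nat)) set"
  let ?a = "\<lambda>(m, n). c m * d n" and ?\<mu> = "\<lambda>(m, n). madd m n"
  have ab: "(\<lambda>m. norm (norm (c m) * \<rho> ^ mdeg m)) summable_on multi_indices"
     "(\<lambda>m. norm (norm (d m) * \<rho> ^ mdeg m)) summable_on multi_indices"
    using c(2) d(2) \<rho> by (auto intro: has_sum_imp_summable)
  have p: "((\<lambda>(m, n). (norm (c m) * \<rho> ^ mdeg m) * (norm (d n) * \<rho> ^ mdeg n)) has_sum S * T) ?I"
    by (rule has_sum_Times_mult(1)[OF c(2) ab(1) d(2) ab(2)])
  have le: "norm (?a i) * \<rho> ^ mdeg (?\<mu> i) \<le> (case i of (m, n) \<Rightarrow> (norm (c m) * \<rho> ^ mdeg m) * (norm (d n) * \<rho> ^ mdeg n))" for i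
  proof (cases i)
    case (Pair m n)
    have "norm (c m * d n) * \<rho> ^ mdeg (madd m n) \<le> (norm (c m) * norm (d n)) * \<rho> ^ mdeg (madd m n)"
      using \<rho> by (intro mult_right_mono norm_mult_ineq) auto
    then show ?thesis by (simp add: Pair mdeg_madd power_add algebra_simps)
  qed
  have "(\<lambda>i. norm (?a i) * \<rho> ^ mdeg (?\<mu> i)) summable_on ?I"
    using has_sum_imp_summable[OF p] by (rule summable_on_comparison_test) (use le \<rho> in auto)
  then obtain U where U: "((\<lambda>i. norm (?a i) * \<rho> ^ mdeg (?\<mu> i)) has_sum U) ?I"
    using has_sum_infsum by blast
  have "U \<le> S * T" using U p by (rule has_sum_mono) (use le in auto)
  also have "\<dots> \<le> K * L" using c(1) d(1) nn by (intro mult_mono) auto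
  finally have UK: "U \<le> K * L" .
  have "has_mseries \<rho> U (\<lambda>h. f h * g h)"
  proof (rule has_mseries_regroup[OF _ \<rho> U])
    fix h :: 'a assume h: "h \<in> mcube \<rho>"
    have "((\<lambda>(m, n). (mpow h m *\<^sub>R c m) * (mpow h n *\<^sub>R d n)) has_sum f h * g h) ?I"
      by (rule has_sum_Times_mult(1)[OF c(3)[OF h] has_mseries_summable[OF c(2) h] d(3)[OF h] has_mseries_summable[OF d(2) h]])
    then show "((\<lambda>i. mpow h (?\<mu> i) *\<^sub>R ?a i) has_sum f h * g h) ?I"
      by (rule has_sum_cong[THEN iffD1, rotated]) (auto simp: mpow_madd)
  qed auto
  then show ?thesis using has_mseries_weaken[OF _ \<rho> order.refl UK] by blast
qed

lemma has_mseries_add: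
  assumes "has_mseries \<rho> K f" "has_mseries \<rho> L g"
  shows "has_mseries \<rho> (K + L) (\<lambda>h. f h + g h)"
proof -
  obtain c S where c: "S \<le> K" "((\<lambda>m. norm (c m) * \<rho> ^ mdeg m) has_sum S) multi_indices"
    "\<And>h. h\<in>mcube \<rho> \<Longrightarrow> ((\<lambda>m. mpow h m *\<^sub>R c m) has_sum f h) multi_indices" and \<rho>: "\<rho> > 0"
    using assms(1) unfolding has_mseries_def by blast
  obtain d T where d: "T \<le> L" "((\<lambda>m. norm (d m) * \<rho> ^ mdeg m) has_sum T) multi_indices"
    "\<And>h. h\<in>mcube \<rho> \<Longrightarrow> ((\<lambda>m. mpow h m *\<^sub>R d m) has_sum g h) multi_indices"
    using assms(2) unfolding has_mseries_def by blast
  have le: "norm (c m + d m) * \<rho> ^ mdeg m \<le> norm (c m) * \<rho> ^ mdeg m + norm (d m) * \<rho> ^ mdeg m" for m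
    using mult_right_mono[OF norm_triangle_ineq[of "c m" "d m"], of "\<rho> ^ mdeg m"] \<rho> by (simp add: algebra_simps)
  have "(\<lambda>m. norm (c m + d m) * \<rho> ^ mdeg m) summable_on multi_indices"
    using has_sum_imp_summable[OF has_sum_add[OF c(2) d(2)]]
    by (rule summable_on_comparison_test) (use le \<rho> in auto)
  then obtain U where U: "((\<lambda>m. norm (c m + d m) * \<rho> ^ mdeg m) has_sum U) multi_indices"
    using has_sum_infsum by blast
  have "U \<le> S + T" using U has_sum_add[OF c(2) d(2)] by (rule has_sum_mono) (use le in auto)
  then show ?thesis unfolding has_mseries_def using \<rho> U c d
    by (intro conjI exI[of _ "\<lambda>m. c m + d m"] exI[of _ U])
       (auto simp: scaleR_add_right intro!: has_sum_add)
qed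

lemma has_mseries_bounded_linear:
  assumes f: "has_mseries \<rho> K f" and T: "bounded_linear T"
  shows "\<exists>L. has_mseries \<rho> L (\<lambda>h. T (f h))"
proof -
  obtain c S where c: "S \<le> K" "((\<lambda>m. norm (c m) * \<rho> ^ mdeg m) has_sum S) multi_indices"
    "\<And>h. h\<in>mcube \<rho> \<Longrightarrow> ((\<lambda>m. mpow h m *\<^sub>R c m) has_sum f h) multi_indices" and \<rho>: "\<rho> > 0"
    using f unfolding has_mseries_def by blast
  obtain M where M: "\<And>x. norm (T x) \<le> norm x * M" "M \<ge> 0"
    using bounded_linear.nonneg_bounded[OF T] by blast
  have le: "norm (T (c m)) * \<rho> ^ mdeg m \<le> (norm (c m) * \<rho> ^ mdeg m) * M" for m
    using mult_right_mono[OF M(1)[of "c m"], of "\<rho> ^ mdeg m"] \<rho> by (simp add: algebra_simps)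
  have "(\<lambda>m. norm (T (c m)) * \<rho> ^ mdeg m) summable_on multi_indices"
    using has_sum_imp_summable[OF has_sum_cmult_left[OF c(2), of M]]
    by (rule summable_on_comparison_test) (use le \<rho> in auto)
  then obtain U where U: "((\<lambda>m. norm (T (c m)) * \<rho> ^ mdeg m) has_sum U) multi_indices"
    using has_sum_infsum by blast
  have "((\<lambda>m. mpow h m *\<^sub>R T (c m)) has_sum T (f h)) multi_indices" if "h \<in> mcube \<rho>" for h
    using has_sum_bounded_linear[OF T c(3)[OF that]] by (simp add: linear_simps(5)[OF T])
  then have "has_mseries \<rho> U (\<lambda>h. T (f h))" unfolding has_mseries_def using \<rho> U
    by (intro conjI exI[of _ "\<lambda>m. T (c m)"] exI[of _ U]) auto
  then show ?thesis by blast
qed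

lemma has_mseries_const: 
  assumes "\<rho> > 0" shows "has_mseries \<rho> (norm k) (\<lambda>h. k :: 'b::banach)"
proof (rule has_mseries_regroup[where I="{()}" and \<mu>="\<lambda>_. \<lambda>b\<in>Basis. 0" and a="\<lambda>_. k"])
  have d: "mdeg (\<lambda>b\<in>Basis. 0) = 0" and p: "mpow h (\<lambda>b\<in>Basis. 0) = 1" for h :: 'a
    by (auto simp: mdeg_def mpow_def)
  show "((\<lambda>i. norm k * \<rho> ^ mdeg (\<lambda>b\<in>(Basis :: 'a set). 0)) has_sum norm k) {()}"
    unfolding d by (rule has_sum_finiteI) auto
  show "((\<lambda>i. mpow h (\<lambda>b\<in>Basis. 0) *\<^sub>R k) has_sum k) {()}" for h :: 'a
    unfolding p by (rule has_sum_finiteI) auto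
qed (use assms in \<open>auto simp: multi_indices_def\<close>)

lemma has_mseries_inner:
  assumes "\<rho> > 0" "b \<in> Basis" 
  shows "has_mseries \<rho> (norm k * \<rho>) (\<lambda>h. (h \<bullet> b) *\<^sub>R (k :: 'b::banach))"
proof (rule has_mseries_regroup[where I="{()}" and \<mu>="\<lambda>_. \<lambda>b'\<in>Basis. if b' = b then 1 else 0" and a="\<lambda>_. k"])
  have d: "mdeg (\<lambda>b'\<in>Basis. if b' = b then 1 else 0) = 1"
    using assms by (simp add: mdeg_def sum.delta)
  have p: "mpow h (\<lambda>b'\<in>Basis. if b' = b then 1 else 0) = h \<bullet> b" for h
    proof -
    have "mpow h (\<lambda>b'\<in>Basis. if b' = b then 1 else 0) = (\<Prod>b'\<in>Basis. if b' = b then h \<bullet> b else 1)"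
      unfolding mpow_def by (rule prod.cong) auto
    then show ?thesis using assms by (simp add: prod.delta)
  qed
  show "((\<lambda>i. norm k * \<rho> ^ mdeg (\<lambda>b'\<in>Basis. if b' = b then 1 else 0)) has_sum norm k * \<rho>) {()}"
    unfolding d by (rule has_sum_finiteI) auto
  show "((\<lambda>i. mpow h (\<lambda>b'\<in>Basis. if b' = b then 1 else 0) *\<^sub>R k) has_sum (h \<bullet> b) *\<^sub>R k) {()}" for h
    unfolding p by (rule has_sum_finiteI) auto
qed (use assms in \<open>auto simp: multi_indices_def\<close>)

lemma has_mseries_power:
  fixes f :: "'a::euclidean_space \<Rightarrow> 'b::{banach,real_normed_algebra_1}"
  assumes "has_mseries \<rho> K f"
  shows "has_mseries \<rho> (K ^ n) (\<lambda>h. f h ^ n)"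
proof (induction n)
  case 0
  have "\<rho> > 0" using assms by (simp add: has_mseries_def)
  from has_mseries_const[OF this, of "1 :: 'b"] show ?case by simp
next
  case (Suc n)
  from has_mseries_mult[OF assms Suc] show ?case by simp
qed

text \<open>The constant coefficient vanishes, so scaling the radius by \<open>t \<le> 1\<close>
  multiplies each remaining weighted term by at most \<open>t\<close>. This brings the range of an
  inner function inside the disc of convergence of an outer one.\<close>

lemma has_mseries_shrink:
  assumes f: "has_mseries \<rho> K f" and f0: "f 0 = 0" and e: "e > 0"
  shows "\<exists>\<sigma>. 0 < \<sigma> \<and> has_mseries \<sigma> e f"
proof -
  obtain c S where c: "S \<le> K" "((\<lambda>m. norm (c m) * \<rho> ^ mdeg m) has_sum S) multi_indices"
    "\<And>h. h\<in>mcube \<rho> \<Longrightarrow> ((\<lambda>m. mpow h m *\<^sub>R c m) has_sum f h) multi_indices" and \<rho>: "\<rho> > 0"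
    using f unfolding has_mseries_def by blast
  have S: "S \<ge> 0" using c(2) \<rho> by (auto intro: has_sum_nonneg)
  define z :: "'a \<Rightarrow> nat" where "z = (\<lambda>b\<in>Basis. 0)"
  have zI: "z \<in> multi_indices" by (simp add: z_def multi_indices_def)
  have z: "m = z" if "m \<in> multi_indices" "mdeg m = 0" for m
  proof (rule PiE_ext[where k=Basis and s="\<lambda>_. UNIV"])
    show "m \<in> Basis \<rightarrow>\<^sub>E UNIV" "z \<in> Basis \<rightarrow>\<^sub>E UNIV" using that(1) zI by (auto simp: multi_indices_def)
    show "m b = z b" if "b \<in> Basis" for b
      using \<open>mdeg m = 0\<close> that unfolding z_def mdeg_def by (simp add: sum_eq_0_iff)
  qed
  have cz: "c z = 0"
  proof -
    \<comment> \<open>At \<open>h = 0\<close> only the exponent zero survives, so the value there is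
      the constant coefficient.\<close>
    have "((\<lambda>m. mpow (0::'a) m *\<^sub>R c m) has_sum 0) multi_indices"
      using c(3)[of 0] \<rho> f0 by (simp add: mcube_def)
    moreover have "((\<lambda>m. mpow (0::'a) m *\<^sub>R c m) has_sum (mpow (0::'a) z *\<^sub>R c z)) multi_indices"
    proof (rule has_sum_finite_neutralI)
      fix m :: "'a \<Rightarrow> nat" assume m: "m \<in> multi_indices - {z}"
      then have "mdeg m \<noteq> 0" using z[of m] by auto
      then obtain b where "b \<in> Basis" "m b \<noteq> 0" by (auto simp: mdeg_def)
      then have "mpow (0::'a) m = 0" unfolding mpow_def by (intro prod_zero) (auto intro!: bexI[of _ b])
      then show "mpow (0::'a) m *\<^sub>R c m = 0" by simp
    qed (use zI in auto)
    ultimately have "mpow (0::'a) z *\<^sub>R c z = 0" by (rule has_sum_unique[rotated])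
    then show ?thesis by (simp add: mpow_def z_def)
  qed
  \<comment> \<open>The summand 1 avoids division by zero when \<open>S = 0\<close>, and still gives
    \<open>t * S \<le> e\<close>.\<close>
  define t where "t = min 1 (e / (S + 1))"
  have t: "0 < t" "t \<le> 1" "t * S \<le> e"
  proof -
    show "0 < t" "t \<le> 1" using e S by (auto simp: t_def)
    have "t * S \<le> e / (S + 1) * (S + 1)" using S e by (intro mult_mono) (auto simp: t_def)
    then show "t * S \<le> e" using S by simp
  qed
  have le: "norm (c m) * (t * \<rho>) ^ mdeg m \<le> t * (norm (c m) * \<rho> ^ mdeg m)" if "m \<in> multi_indices" for m
  proof (cases "mdeg m = 0")
    case True then show ?thesis using z[OF that] cz by simp
  next
    case False
    then have "t ^ mdeg m \<le> t" using t power_decreasing[of 1 "mdeg m" t] by simp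
    then have "norm (c m) * \<rho> ^ mdeg m * t ^ mdeg m \<le> norm (c m) * \<rho> ^ mdeg m * t"
      using \<rho> by (intro mult_left_mono) auto
    then show ?thesis by (simp add: power_mult_distrib algebra_simps)
  qed
  have "(\<lambda>m. norm (c m) * (t * \<rho>) ^ mdeg m) summable_on multi_indices"
    using has_sum_imp_summable[OF has_sum_cmult_right[OF c(2), of t]]
    by (rule summable_on_comparison_test) (use le \<rho> t in auto)
  then obtain U where U: "((\<lambda>m. norm (c m) * (t * \<rho>) ^ mdeg m) has_sum U) multi_indices"
    using has_sum_infsum by blast
  have "U \<le> t * S" using U has_sum_cmult_right[OF c(2), of t] by (rule has_sum_mono) (use le in auto)
  with t have "U \<le> e" by simp
  moreover have "mcube (t * \<rho>) \<subseteq> mcube \<rho>" using t \<rho> by (intro mcube_mono) (simp add: mult_le_cancel_right2)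
  ultimately have "has_mseries (t * \<rho>) e f"
    unfolding has_mseries_def using U c t \<rho> by (intro conjI exI[of _ c] exI[of _ U]) auto
  then show ?thesis using t \<rho> by (intro exI[of _ "t * \<rho>"]) auto
qed

section \<open>Expansion near a point and the operations preserving it\<close>

lemma mseries_at_D2:
  assumes "mseries_at f x" "mseries_at g x"
  obtains \<rho> K L where "has_mseries \<rho> K (\<lambda>h. f (x + h))" "has_mseries \<rho> L (\<lambda>h. g (x + h))"
proof -
  obtain r1 K r2 L where *: "has_mseries r1 K (\<lambda>h. f (x + h))" "has_mseries r2 L (\<lambda>h. g (x + h))"
    using assms unfolding mseries_at_def by blast
  then have "r1 > 0" "r2 > 0" by (auto simp: has_mseries_def)
  then have "has_mseries (min r1 r2) K (\<lambda>h. f (x + h))" "has_mseries (min r1 r2) L (\<lambda>h. g (x + h))"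
    using has_mseries_weaken[OF *(1), of "min r1 r2" K] has_mseries_weaken[OF *(2), of "min r1 r2" L] by auto
  then show ?thesis by (rule that)
qed

lemma mseries_at_add:
  assumes "mseries_at f x" "mseries_at g x" shows "mseries_at (\<lambda>y. f y + g y) x"
proof -
  obtain \<rho> K L where "has_mseries \<rho> K (\<lambda>h. f (x + h))" "has_mseries \<rho> L (\<lambda>h. g (x + h))"
    using assms by (rule mseries_at_D2)
  from has_mseries_add[OF this] show ?thesis unfolding mseries_at_def by blast
qed

lemma mseries_at_mult:
  fixes f g :: "'a::euclidean_space \<Rightarrow> 'b::{banach,real_normed_algebra}"
  assumes "mseries_at f x" "mseries_at g x" shows "mseries_at (\<lambda>y. f y * g y) x"
proof -
  obtain \<rho> K L where "has_mseries \<rho> K (\<lambda>h. f (x + h))" "has_mseries \<rho> L (\<lambda>h. g (x + h))"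
    using assms by (rule mseries_at_D2)
  from has_mseries_mult[OF this] show ?thesis unfolding mseries_at_def by blast
qed

lemma mseries_at_const: "mseries_at (\<lambda>_. k) x"
  unfolding mseries_at_def by (rule exI, rule exI, rule has_mseries_const[of 1]) simp

lemma mseries_at_bounded_linear:
  "mseries_at f x \<Longrightarrow> bounded_linear T \<Longrightarrow> mseries_at (\<lambda>y. T (f y)) x"
  unfolding mseries_at_def by (elim exE, drule (1) has_mseries_bounded_linear) blast

lemma mseries_at_sum:
  "finite A \<Longrightarrow> (\<And>i. i \<in> A \<Longrightarrow> mseries_at (f i) x) \<Longrightarrow> mseries_at (\<lambda>y. \<Sum>i\<in>A. f i y) x"
  by (induction A rule: finite_induct) (simp_all add: mseries_at_const mseries_at_add)

lemma mseries_at_linear: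
  fixes l :: "'a::euclidean_space \<Rightarrow> 'b::banach"
  assumes "linear l" shows "mseries_at l x"
proof -
  interpret linear l by fact
  have c: "mseries_at (\<lambda>y. (y \<bullet> b) *\<^sub>R l b) x" if "b \<in> Basis" for b
  proof -
    have "has_mseries 1 (norm ((x \<bullet> b) *\<^sub>R l b) + norm (l b) * 1) (\<lambda>h. (x \<bullet> b) *\<^sub>R l b + (h \<bullet> b) *\<^sub>R l b)"
      using that by (intro has_mseries_add has_mseries_const has_mseries_inner) auto
    then show ?thesis unfolding mseries_at_def inner_add_left scaleR_add_left by blast
  qed
  have "l y = (\<Sum>b\<in>Basis. (y \<bullet> b) *\<^sub>R l b)" for y
    by (subst euclidean_representation[symmetric, of y]) (simp only: sum scale)
  then have "(\<lambda>y. \<Sum>b\<in>Basis. (y \<bullet> b) *\<^sub>R l b) = l" by (intro ext) (rule sym)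
  moreover have "mseries_at (\<lambda>y. \<Sum>b\<in>Basis. (y \<bullet> b) *\<^sub>R l b) x"
    by (rule mseries_at_sum) (simp_all add: c)
  ultimately show ?thesis by simp
qed

text \<open>The Taylor series of \<open>g\<close> at \<open>f x\<close> is taken in powers of
  \<open>f - f x\<close>, each of which has its own multi-index series. The resulting family is
  indexed by a power and an exponent vector; it is absolutely summable because the n-th power has
  weighted sum at most \<open>K ^ n\<close> with \<open>K\<close> below the radius of convergence of
  the outer series.\<close>

lemma mseries_at_compose_holomorphic:
  fixes f :: "'a::euclidean_space \<Rightarrow> complex"
  assumes f: "mseries_at f x" and g: "g holomorphic_on U" "open U" "f x \<in> U"
  shows "mseries_at (\<lambda>y. g (f y)) x"
proof -
  obtain R where R: "R > 0" "ball (f x) R \<subseteq> U" using g openE by blast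
  define a where "a n = (deriv ^^ n) g (f x) / fact n" for n
  have ser: "(\<lambda>n. a n * (w - f x) ^ n) sums g w" if "w \<in> ball (f x) R" for w
    unfolding a_def using holomorphic_power_series[OF holomorphic_on_subset[OF g(1) R(2)] that] .
  have "mseries_at (\<lambda>y. f y - f x) x"
    using mseries_at_add[OF f mseries_at_const[of "- f x"]] by simp
  then obtain \<rho> K where "has_mseries \<rho> K (\<lambda>h. f (x + h) - f x)" unfolding mseries_at_def by blast
  from has_mseries_shrink[OF this, of "R / 2"] R obtain \<sigma> where
    s: "\<sigma> > 0" "has_mseries \<sigma> (R / 2) (\<lambda>h. f (x + h) - f x)" by auto
  define K where "K = R / 2"
  have K: "0 < K" "K < R" using R by (auto simp: K_def)
  \<comment> \<open>Packaging the three properties in one predicate allows coefficients and sums to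
    be chosen for all powers at once.\<close>
  define P where "P n c S \<longleftrightarrow> S \<le> K ^ n \<and>
     ((\<lambda>m. norm (c m) * \<sigma> ^ mdeg m) has_sum S) multi_indices \<and>
     (\<forall>h\<in>mcube \<sigma>. ((\<lambda>m. mpow h m *\<^sub>R c m) has_sum (f (x + h) - f x) ^ n) multi_indices)" for n c S
  have "\<exists>c S. P n c S" for n
    using has_mseries_power[OF s(2), of n] unfolding has_mseries_def K_def P_def by blast
  then obtain c S where "\<And>n. P n (c n) (S n)"
    by metis
  then have c: "\<And>n. S n \<le> K ^ n"
     "\<And>n. ((\<lambda>m. norm (c n m) * \<sigma> ^ mdeg m) has_sum S n) multi_indices"
     "\<And>n h. h \<in> mcube \<sigma> \<Longrightarrow> ((\<lambda>m. mpow h m *\<^sub>R c n m) has_sum (f (x + h) - f x) ^ n) multi_indices"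
    by (auto simp: P_def)
  have S0: "S n \<ge> 0" for n using c(2)[of n] s by (auto intro: has_sum_nonneg)
  let ?I = "UNIV \<times> multi_indices :: (nat \<times> ('a \<Rightarrow> nat)) set"
  have an: "summable (\<lambda>n. norm (a n) * K ^ n)"
  proof -
    \<comment> \<open>Convergence at a point strictly between \<open>K\<close> and \<open>R\<close>
      gives absolute convergence at \<open>K\<close>.\<close>
    define q where "q = (K + R) / 2"
    have q: "K < q" "q < R" "q > 0" using K by (auto simp: q_def)
    then have "f x + of_real q \<in> ball (f x) R" by (simp add: dist_norm)
    from ser[OF this] have "summable (\<lambda>n. a n * of_real q ^ n)"
      by (simp add: sums_iff)
    from powser_insidea[OF this, of "of_real K"] K q show ?thesis by (simp add: norm_mult norm_power)
  qed
  have anS: "summable (\<lambda>n. norm (a n) * S n)"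
    by (rule summable_comparison_test'[OF an, of 0]) (use S0 c(1) in \<open>auto simp: abs_mult intro: mult_left_mono\<close>)
  have inner: "((\<lambda>m. norm (a n * c n m) * \<sigma> ^ mdeg m) has_sum norm (a n) * S n) multi_indices" for n
    using has_sum_cmult_right[OF c(2)[of n], of "norm (a n)"] by (simp add: norm_mult algebra_simps)
  have "(\<lambda>i. norm (a (fst i) * c (fst i) (snd i)) * \<sigma> ^ mdeg (snd i)) summable_on ?I"
  proof (rule summable_on_SigmaI)
    show "((\<lambda>y. norm (a (fst (n, y)) * c (fst (n, y)) (snd (n, y))) * \<sigma> ^ mdeg (snd (n, y))) has_sum norm (a n) * S n) multi_indices" for n
      using inner by simp
    show "(\<lambda>n. norm (a n) * S n) summable_on UNIV"
      by (rule norm_summable_imp_summable_on) (use anS S0 in \<open>simp add: abs_mult\<close>)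
    show "norm (a (fst (n, y)) * c (fst (n, y)) (snd (n, y))) * \<sigma> ^ mdeg (snd (n, y)) \<ge> 0" for n y
      using s(1) by simp
  qed
  then obtain T where T: "((\<lambda>i. norm (a (fst i) * c (fst i) (snd i)) * \<sigma> ^ mdeg (snd i)) has_sum T) ?I"
    using has_sum_infsum by blast
  have "has_mseries \<sigma> T (\<lambda>h. g (f (x + h)))"
  proof (rule has_mseries_regroup[OF _ s(1) T])
    fix h :: 'a assume h: "h \<in> mcube \<sigma>"
    show "((\<lambda>i. mpow h (snd i) *\<^sub>R (a (fst i) * c (fst i) (snd i))) has_sum g (f (x + h))) ?I"
    proof (rule has_sum_SigmaI)
      show "((\<lambda>y. mpow h (snd (n, y)) *\<^sub>R (a (fst (n, y)) * c (fst (n, y)) (snd (n, y)))) has_sum a n * (f (x + h) - f x) ^ n) multi_indices" for n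
        using has_sum_cmult_right[OF c(3)[OF h, of n], of "a n"] by (simp add: scaleR_conv_of_real algebra_simps)
      have le: "norm (f (x + h) - f x) \<le> K"
      proof -
        show ?thesis using has_mseries_norm_le[OF s(2) h] by (simp add: K_def)
      qed
      then have "f (x + h) \<in> ball (f x) R" using K by (simp add: dist_norm norm_minus_commute)
      note sm = ser[OF this]
      have "summable (\<lambda>n. norm (a n * (f (x + h) - f x) ^ n))"
        by (rule summable_comparison_test'[OF an, of 0])
           (use le in \<open>auto simp: norm_mult norm_power intro!: mult_left_mono power_mono\<close>)
      from norm_summable_imp_has_sum[OF this sm]
      show "((\<lambda>n. a n * (f (x + h) - f x) ^ n) has_sum g (f (x + h))) UNIV" .
      show "(\<lambda>i. mpow h (snd i) *\<^sub>R (a (fst i) * c (fst i) (snd i))) summable_on ?I"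
        by (rule abs_summable_summable[OF has_mseries_summable[OF T h]])
    qed
  qed auto
  then show ?thesis unfolding mseries_at_def by blast
qed

lemma real_analytic_onI:
  assumes "\<And>x. x \<in> A \<Longrightarrow> mseries_at f x"
  shows "f real_analytic_on A"
  unfolding real_analytic_on_def
proof
  fix x assume "x \<in> A"
  from assms[OF this] obtain \<rho> c where "\<rho> > 0"
    "\<forall>h\<in>mcube \<rho>. ((\<lambda>m. mpow h m *\<^sub>R c m) has_sum f (x + h)) multi_indices"
    unfolding mseries_at_def has_mseries_def by blast
  then show "\<exists>c e. e > 0 \<and> (\<forall>h. norm h < e \<longrightarrow>
           ((\<lambda>m. (\<Prod>b\<in>Basis. (h \<bullet> b) ^ m b) *\<^sub>R c m) has_sum f (x + h)) (Basis \<rightarrow>\<^sub>E UNIV))"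
    using ball_subset_mcube unfolding mpow_def multi_indices_def by blast
qed

lemma mseries_at_cong:
  assumes "mseries_at f x" "eventually (\<lambda>y. f y = g y) (nhds x)"
  shows "mseries_at g x"
proof -
  obtain \<rho> K where *: "has_mseries \<rho> K (\<lambda>h. f (x + h))" using assms(1) by (auto simp: mseries_at_def)
  obtain e where e: "e > 0" "\<And>y. dist y x < e \<Longrightarrow> f y = g y"
    using assms(2) unfolding eventually_nhds_metric by blast
  have r: "\<rho> > 0" using * by (simp add: has_mseries_def)
  \<comment> \<open>The l1 norm of a point of this cube is at most \<open>e / 2\<close>, which
    places the cube in the neighbourhood where the two functions agree.\<close>
  define \<sigma> where "\<sigma> = min \<rho> (e / (2 * DIM('a)))"
  have s: "\<sigma> > 0" "\<sigma> \<le> \<rho>" using r e by (auto simp: \<sigma>_def)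
  have eq: "f (x + h) = g (x + h)" if "h \<in> mcube \<sigma>" for h
  proof (rule e(2))
    have "norm h \<le> (\<Sum>b\<in>Basis. \<bar>h \<bullet> b\<bar>)" by (rule norm_le_l1)
    also have "\<dots> \<le> (\<Sum>b\<in>(Basis::'a set). e / (2 * DIM('a)))"
      using that by (intro sum_mono) (auto simp: mcube_def \<sigma>_def)
    also have "\<dots> = e / 2" by simp
    finally show "dist (x + h) x < e" using e by (simp add: dist_norm)
  qed
  have "has_mseries \<sigma> K (\<lambda>h. g (x + h))"
    using has_mseries_weaken[OF * s order.refl] eq by (rule has_mseries_cong)
  then show ?thesis unfolding mseries_at_def by blast
qed

section \<open>Rotations\<close>

text \<open>Rodrigues' formula; a rotation by the angle \<open>t\<close> about \<open>w\<close> when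
  \<open>w\<close> is a unit vector.\<close>

definition rot :: "real^3 \<Rightarrow> real \<Rightarrow> real^3 \<Rightarrow> real^3" where
  "rot w t y = cos t *\<^sub>R y + sin t *\<^sub>R cross3 w y + ((1 - cos t) * (w \<bullet> y)) *\<^sub>R w"

definition bang_axis :: "real \<Rightarrow> real \<Rightarrow> real^3" where
  "bang_axis \<alpha> w = vector [w * sin \<alpha>, 0, cos \<alpha>]"

definition mid_axis :: "real \<Rightarrow> real \<Rightarrow> real \<Rightarrow> real^3" where
  "mid_axis \<epsilon> \<alpha> t = vector [0, - \<epsilon> * B_fun \<alpha> t, C_fun \<alpha> t]"

lemmas vec3_simps = vec_eq_iff forall_3 matrix_vector_mult_def sum_3 vector_3 cross3_def inner_vec_def

lemma control_matrix_cross: "control_matrix \<alpha> w *v y = cross3 (bang_axis \<alpha> w) y"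
  by (simp add: control_matrix_def F_mat_def G_mat_def bang_axis_def vec3_simps algebra_simps)

lemma control_matrix_transpose_cross:
  "- (transpose (control_matrix \<alpha> w) *v y) = cross3 (bang_axis \<alpha> w) y"
  by (simp add: control_matrix_def F_mat_def G_mat_def bang_axis_def transpose_def vec3_simps algebra_simps)

lemma X_mat_cross: "X_mat \<epsilon> \<alpha> *v y = cross3 (bang_axis \<alpha> \<epsilon>) y"
  using control_matrix_cross[of \<alpha> \<epsilon> y] by (simp add: X_mat_def control_matrix_def)

lemma Z_mat_cross: "Z_mat \<epsilon> \<alpha> t *v y = cross3 (mid_axis \<epsilon> \<alpha> t) y"
  by (simp add: Z_mat_def mid_axis_def vec3_simps algebra_simps)

lemma norm_bang_axis: "\<bar>\<epsilon>\<bar> = 1 \<Longrightarrow> norm (bang_axis \<alpha> \<epsilon>) = 1"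
proof -
  assume "\<bar>\<epsilon>\<bar> = 1"
  then have "\<epsilon>\<^sup>2 = 1" by (simp add: abs_square_eq_1)
  then have "bang_axis \<alpha> \<epsilon> \<bullet> bang_axis \<alpha> \<epsilon> = 1"
    by (simp add: bang_axis_def vec3_simps power2_eq_square[symmetric] power_mult_distrib)
  then show ?thesis by (simp add: norm_eq_sqrt_inner)
qed

section \<open>Exponentials of cross product operators\<close>

lemma cross3_cubed:
  assumes "norm w = 1"
  shows "cross3 w (cross3 w (cross3 w y)) = - cross3 w y"
proof -
  have "w \<bullet> w = 1" using assms by (simp add: dot_square_norm)
  then show ?thesis by (simp add: Lagrange Cross3.right_diff_distrib cross_mult_right)
qed

text \<open>The cube of the operator is its negative, so odd powers are multiples of the operator
  and even positive powers multiples of its square. The correction at \<open>k = 0\<close> replaces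
  the cosine series by that of \<open>1 - cos t\<close>, which multiplies the square.\<close>

lemma cross3_pow_sin_cos:
  assumes w: "norm w = 1"
  shows "(1 / fact k) *\<^sub>R ((\<lambda>y. t *\<^sub>R cross3 w y) ^^ k) y =
    (if k = 0 then y else 0) + (sin_coeff k * t ^ k) *\<^sub>R cross3 w y
      + ((if k = 0 then 1 else 0) - cos_coeff k * t ^ k) *\<^sub>R cross3 w (cross3 w y)"
proof -
  have odd: "((\<lambda>y. t *\<^sub>R cross3 w y) ^^ (2 * j + 1)) y = ((-1) ^ j * t ^ (2 * j + 1)) *\<^sub>R cross3 w y" for j
  proof (induction j)
    case (Suc j)
    have "((\<lambda>y. t *\<^sub>R cross3 w y) ^^ (2 * Suc j + 1)) y
       = t *\<^sub>R cross3 w (t *\<^sub>R cross3 w (((\<lambda>y. t *\<^sub>R cross3 w y) ^^ (2 * j + 1)) y))"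
      by simp
    then show ?case unfolding Suc by (simp add: cross_mult_right cross3_cubed[OF w])
  qed simp
  have even: "((\<lambda>y. t *\<^sub>R cross3 w y) ^^ (2 * j + 2)) y = ((-1) ^ j * t ^ (2 * j + 2)) *\<^sub>R cross3 w (cross3 w y)" for j
  proof -
    have "((\<lambda>y. t *\<^sub>R cross3 w y) ^^ (2 * j + 2)) y = t *\<^sub>R cross3 w (((\<lambda>y. t *\<^sub>R cross3 w y) ^^ (2 * j + 1)) y)"
      by simp
    then show ?thesis unfolding odd by (simp add: cross_mult_right)
  qed
  consider "k = 0" | j where "k = 2 * j + 1" | j where "k = 2 * j + 2"
    by (metis One_nat_def Suc_1 add_2_eq_Suc' add_Suc_right mult_Suc_right nat.exhaust_sel oddE evenE Suc_eq_plus1 add.commute)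
  then show ?thesis
  proof cases
    case 1 then show ?thesis by (simp add: sin_coeff_def cos_coeff_def)
  next
    case (2 j)
    show ?thesis unfolding 2 odd by (simp add: sin_coeff_def cos_coeff_def)
  next
    case (3 j)
    show ?thesis unfolding 3 even by (simp add: sin_coeff_def cos_coeff_def)
  qed
qed

lemma rot_alt:
  assumes "norm w = 1"
  shows "rot w t y = y + sin t *\<^sub>R cross3 w y + (1 - cos t) *\<^sub>R cross3 w (cross3 w y)"
proof -
  have "w \<bullet> w = 1" using assms by (simp add: dot_square_norm)
  then show ?thesis by (simp add: rot_def Lagrange algebra_simps)
qed

text \<open>Matrices are compared through their action on vectors: each term of the exponential
  series combines the identity, \<open>A\<close> and the square of \<open>A\<close> with sine and
  cosine coefficients, and these series are summed separately.\<close>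

lemma mat_exp_rot:
  assumes A: "\<And>y. A *v y = cross3 w y" and w: "norm w = 1"
  shows "mat_exp (t *\<^sub>R A) *v y = rot w t y"
proof -
  have pow: "((((**) (t *\<^sub>R A)) ^^ k) (mat 1)) *v y = ((\<lambda>y. t *\<^sub>R cross3 w y) ^^ k) y" for k y
    by (induction k) (simp_all add: matrix_vector_mul_assoc[symmetric] scaleR_matrix_vector_assoc[symmetric] A)
  define M where "M k = (if k = 0 then mat 1 else 0) + (sin_coeff k * t ^ k) *\<^sub>R A
      + ((if k = 0 then 1 else 0) - cos_coeff k * t ^ k) *\<^sub>R (A ** A)" for k
  have M: "(1 / fact k) *\<^sub>R (((**) (t *\<^sub>R A)) ^^ k) (mat 1) = M k" for k
  proof (unfold matrix_eq, intro allI)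
    fix y
    show "((1 / fact k) *\<^sub>R (((**) (t *\<^sub>R A)) ^^ k) (mat 1)) *v y = M k *v y"
      unfolding scaleR_matrix_vector_assoc[symmetric] pow cross3_pow_sin_cos[OF w] M_def
      by (simp add: matrix_vector_mult_add_rdistrib matrix_vector_mult_diff_rdistrib
          scaleR_matrix_vector_assoc[symmetric] matrix_vector_mul_assoc[symmetric] A)
  qed
  have "M sums (mat 1 + sin t *\<^sub>R A + (1 - cos t) *\<^sub>R (A ** A))"
  proof -
    have "(\<lambda>k. if k = 0 then (mat 1 :: real^3^3) else 0) sums mat 1" "(\<lambda>k. if k = 0 then (1::real) else 0) sums 1"
      using sums_single[of 0 "\<lambda>_. mat 1 :: real^3^3"] sums_single[of 0 "\<lambda>_. 1 :: real"] by simp_all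
    then show ?thesis unfolding M_def
      using sin_converges[of t] cos_converges[of t]
      by (intro sums_add sums_diff sums_scaleR_left) simp_all
  qed
  then have "mat_exp (t *\<^sub>R A) = mat 1 + sin t *\<^sub>R A + (1 - cos t) *\<^sub>R (A ** A)"
    unfolding mat_exp_def M by (rule sums_unique[symmetric])
  then show ?thesis unfolding rot_alt[OF w]
    by (simp add: matrix_vector_mult_add_rdistrib scaleR_matrix_vector_assoc[symmetric]
        matrix_vector_mul_assoc[symmetric] A)
qed

lemma rot_0 [simp]: "rot w 0 y = y"
  by (simp add: rot_def)

lemma cross3_rot:
  "cross3 w (rot w t y) = cos t *\<^sub>R cross3 w y + sin t *\<^sub>R cross3 w (cross3 w y)"
  by (simp add: rot_def cross_add_right cross_mult_right)

lemma rot_has_vector_derivative: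
  assumes "norm w = 1"
  shows "((\<lambda>t. rot w t y) has_vector_derivative cross3 w (rot w t y)) (at t within S)"
proof -
  have "((\<lambda>t. y + sin t *\<^sub>R cross3 w y + (1 - cos t) *\<^sub>R cross3 w (cross3 w y)) has_vector_derivative
     (0 + cos t *\<^sub>R cross3 w y + sin t *\<^sub>R cross3 w (cross3 w y))) (at t within S)"
    by (auto intro!: derivative_eq_intros)
  then show ?thesis unfolding rot_alt[OF assms, abs_def] cross3_rot[of w, unfolded rot_alt[OF assms]] by simp
qed

text \<open>The difference of two solutions solves the same linear equation with skew right-hand
  side, so its norm is constant. Further identities for \<open>rot\<close> follow by exhibiting both
  sides as solutions.\<close>

lemma rot_unique:
  assumes w: "norm w = 1" and y: "\<And>t. (y has_vector_derivative cross3 w (y t)) (at t)"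
  shows "y t = rot w t (y 0)"
proof -
  define d where "d t = y t - rot w t (y 0)" for t
  have d: "(d has_vector_derivative cross3 w (d t)) (at t)" for t
    unfolding d_def using has_vector_derivative_diff[OF y rot_has_vector_derivative[OF w]]
    by (simp add: Cross3.right_diff_distrib)
  have "((\<lambda>t. d t \<bullet> d t) has_vector_derivative 0) (at t)" for t
    using bounded_bilinear.has_vector_derivative[OF bounded_bilinear_inner d d]
    by (simp add: inner_commute dot_cross_self)
  then have "d t \<bullet> d t = d 0 \<bullet> d 0"
    by (intro DERIV_isconst_all) (simp add: has_real_derivative_iff_has_vector_derivative)
  then show ?thesis by (simp add: d_def)
qed

lemma rot_add: 
  assumes "norm w = 1"
  shows "rot w (s + t) y = rot w s (rot w t y)"
proof -
  have "((\<lambda>s. rot w (s + t) y) has_vector_derivative cross3 w (rot w (s + t) y)) (at s)" for s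
  proof -
    have "((\<lambda>s. s + t) has_vector_derivative 1) (at s)" by (auto intro!: derivative_eq_intros)
    from vector_diff_chain_at[OF this rot_has_vector_derivative[OF assms, where t="s + t" and S=UNIV and y=y]]
    show ?thesis by (simp add: o_def)
  qed
  from rot_unique[OF assms this, of s] show ?thesis by simp
qed

lemma rot_inner:
  assumes w: "norm w = 1"
  shows "rot w t x \<bullet> rot w t y = x \<bullet> y"
proof -
  have "((\<lambda>t. rot w t x \<bullet> rot w t y) has_vector_derivative 0) (at t)" for t
  proof -
    have "a \<bullet> cross3 w b + cross3 w a \<bullet> b = 0" for a b
      by (simp add: cross3_simps)
    then show ?thesis
      using bounded_bilinear.has_vector_derivative[OF bounded_bilinear_inner
          rot_has_vector_derivative[OF w] rot_has_vector_derivative[OF w], where x=t and s=UNIV] by simp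
  qed
  then have "rot w t x \<bullet> rot w t y = rot w 0 x \<bullet> rot w 0 y"
    by (intro DERIV_isconst_all[of "\<lambda>t. rot w t x \<bullet> rot w t y"])
       (simp add: has_real_derivative_iff_has_vector_derivative)
  then show ?thesis by simp
qed

text \<open>By the Jacobi identity the cross product of two solutions is again a solution. This is
  what makes the angular momentum of an extremal rotate along with position and covector.\<close>

lemma rot_cross:
  assumes w: "norm w = 1"
  shows "cross3 (rot w t x) (rot w t y) = rot w t (cross3 x y)"
proof -
  have jac: "cross3 a (cross3 w b) + cross3 (cross3 w a) b = cross3 w (cross3 a b)" for a b
    by (simp add: vec3_simps algebra_simps)
  have bl: "bounded_bilinear cross3"
    by (rule bilinear_conv_bounded_bilinear[THEN iffD1, OF bilinear_cross])
  have "((\<lambda>t. cross3 (rot w t x) (rot w t y)) has_vector_derivative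
      cross3 w (cross3 (rot w t x) (rot w t y))) (at t)" for t
    using bounded_bilinear.has_vector_derivative[OF bl
        rot_has_vector_derivative[OF w] rot_has_vector_derivative[OF w]] by (simp add: jac)
  from rot_unique[OF w this] show ?thesis by simp
qed

section \<open>Bang-bang extremals\<close>

text \<open>Common integral equation for the state and the covector: the system matrices are skew,
  so the adjoint equation has the same form. The free starting time \<open>a\<close> allows cutting
  and gluing.\<close>

definition bang_sol :: "real \<Rightarrow> real \<Rightarrow> real \<Rightarrow> (real \<Rightarrow> real) \<Rightarrow> (real \<Rightarrow> real^3) \<Rightarrow> bool" where
  "bang_sol \<alpha> a b u y \<longleftrightarrow>
     (\<forall>t\<in>{a..b}. ((\<lambda>\<tau>. cross3 (bang_axis \<alpha> (u \<tau>)) (y \<tau>)) has_integral (y t - y a)) {a..t})"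

lemma bang_sol_integral:
  assumes y: "bang_sol \<alpha> a b u y" and "a \<le> s" "s \<le> t" "t \<le> b"
  shows "((\<lambda>\<tau>. cross3 (bang_axis \<alpha> (u \<tau>)) (y \<tau>)) has_integral (y t - y s)) {s..t}"
proof -
  let ?f = "\<lambda>\<tau>. cross3 (bang_axis \<alpha> (u \<tau>)) (y \<tau>)"
  have s: "(?f has_integral (y s - y a)) {a..s}" and t: "(?f has_integral (y t - y a)) {a..t}"
    using assms unfolding bang_sol_def by auto
  have "?f integrable_on {s..t}"
    using has_integral_integrable[OF t] by (rule integrable_subinterval_real) (use assms in auto)
  then obtain j where j: "(?f has_integral j) {s..t}" by (auto simp: integrable_on_def)
  have "(?f has_integral (y s - y a + j)) {a..t}"
    using has_integral_combine[OF assms(2,3) s j] .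
  then have "y s - y a + j = y t - y a" using t has_integral_unique by blast
  then have "j = y t - y s" by (simp add: algebra_simps)
  with j show ?thesis by simp
qed

lemma bang_sol_subinterval:
  "bang_sol \<alpha> a b u y \<Longrightarrow> a \<le> a' \<Longrightarrow> b' \<le> b \<Longrightarrow> bang_sol \<alpha> a' b' u y"
  using bang_sol_integral unfolding bang_sol_def[of \<alpha> a' b'] by auto

lemma bang_sol_combine:
  assumes "bang_sol \<alpha> a b u y" "bang_sol \<alpha> b c u y" "a \<le> b"
  shows "bang_sol \<alpha> a c u y"
  unfolding bang_sol_def
proof
  fix t assume t: "t \<in> {a..c}"
  show "((\<lambda>\<tau>. cross3 (bang_axis \<alpha> (u \<tau>)) (y \<tau>)) has_integral y t - y a) {a..t}"
  proof (cases "t \<le> b")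
    case True then show ?thesis using assms(1) t by (auto simp: bang_sol_def)
  next
    case False
    then have "((\<lambda>\<tau>. cross3 (bang_axis \<alpha> (u \<tau>)) (y \<tau>)) has_integral (y b - y a) + (y t - y b)) {a..t}"
      using assms t by (intro has_integral_combine[of a b t]) (auto simp: bang_sol_def)
    then show ?thesis by simp
  qed
qed

section \<open>Regularity of solutions under measurable controls\<close>

lemma norm_bang_axis_le:
  assumes "\<bar>w\<bar> \<le> 1" shows "norm (bang_axis \<alpha> w) \<le> 2"
proof -
  have "norm (bang_axis \<alpha> w) \<le> (\<Sum>i\<in>UNIV. norm (bang_axis \<alpha> w $ i))"
    by (rule norm_le_l1_cart[simplified real_norm_def[symmetric]])
  also have "\<dots> = \<bar>w\<bar> * \<bar>sin \<alpha>\<bar> + \<bar>cos \<alpha>\<bar>"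
    by (simp add: sum_3 bang_axis_def abs_mult)
  also have "\<dots> \<le> 1 * 1 + 1"
    using assms by (intro add_mono mult_mono) auto
  finally show ?thesis by simp
qed

lemma norm_cross3_le: "norm (cross3 a b) \<le> norm a * norm b"
proof -
  have "(norm (cross3 a b))\<^sup>2 \<le> (norm a * norm b)\<^sup>2"
    using norm_cross_dot[of a b] by (metis le_add_same_cancel1 zero_le_power2)
  then show ?thesis by (rule power2_le_imp_le) simp
qed

lemma bang_sol_continuous:
  assumes "bang_sol \<alpha> a b u y" shows "continuous_on {a..b} y"
proof (cases "a \<le> b")
  case True
  let ?f = "\<lambda>\<tau>. cross3 (bang_axis \<alpha> (u \<tau>)) (y \<tau>)"
  have "(?f has_integral (y b - y a)) {a..b}" using assms True by (auto simp: bang_sol_def)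
  then have "continuous_on {a..b} (\<lambda>t. y a + integral {a..t} ?f)"
    by (intro continuous_intros indefinite_integral_continuous_1) auto
  then show ?thesis
  proof (rule continuous_on_eq)
    fix t assume "t \<in> {a..b}"
    then have "integral {a..t} ?f = y t - y a" using assms integral_unique unfolding bang_sol_def by blast
    then show "y a + integral {a..t} ?f = y t" by simp
  qed
qed simp

text \<open>A solution is continuous, hence bounded by some \<open>M\<close> on the compact
  interval, and the integrand is then bounded by \<open>2 * M\<close>; this one constant serves for
  both estimates.\<close>

lemma bang_sol_Lipschitz:
  assumes y: "bang_sol \<alpha> a b u y" and u: "\<And>t. t \<in> {a..b} \<Longrightarrow> \<bar>u t\<bar> \<le> 1"
  obtains K where "K \<ge> 0" "\<And>t. t \<in> {a..b} \<Longrightarrow> norm (y t) \<le> K"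
    "\<And>s t. s \<in> {a..b} \<Longrightarrow> t \<in> {a..b} \<Longrightarrow> norm (y t - y s) \<le> K * \<bar>t - s\<bar>"
proof -
  have "bounded (y ` {a..b})"
    by (intro compact_imp_bounded compact_continuous_image bang_sol_continuous[OF y]) auto
  then obtain M where M: "M > 0" "\<And>t. t \<in> {a..b} \<Longrightarrow> norm (y t) \<le> M"
    by (auto simp: bounded_pos)
  have le: "norm (y t - y s) \<le> (2 * M) * \<bar>t - s\<bar>" if "s \<in> {a..b}" "t \<in> {a..b}" "s \<le> t" for s t
  proof -
    have I: "((\<lambda>\<tau>. cross3 (bang_axis \<alpha> (u \<tau>)) (y \<tau>)) has_integral (y t - y s)) {s..t}"
      using that by (intro bang_sol_integral[OF y]) auto
    have "norm (y t - y s) \<le> (2 * M) * measure lborel {s..t}"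
    proof (rule has_integral_bound_real[OF _ _ I])
      fix \<tau> assume "\<tau> \<in> {s..t} - {}"
      then have "\<tau> \<in> {a..b}" using that by auto
      then have "norm (bang_axis \<alpha> (u \<tau>)) * norm (y \<tau>) \<le> 2 * M"
        using u M norm_bang_axis_le by (intro mult_mono) auto
      then show "norm (cross3 (bang_axis \<alpha> (u \<tau>)) (y \<tau>)) \<le> 2 * M"
        using norm_cross3_le order.trans by blast
    qed (use M in auto)
    then show ?thesis using that by simp
  qed
  have "norm (y t - y s) \<le> (2 * M) * \<bar>t - s\<bar>" if "s \<in> {a..b}" "t \<in> {a..b}" for s t
    using le[of s t] le[of t s] that by (cases "s \<le> t") (auto simp: norm_minus_commute abs_minus_commute)
  then show ?thesis using M by (intro that[of "2 * M"]) force+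
qed

lemma has_real_derivative_quadratic:
  fixes h :: "real \<Rightarrow> real"
  assumes "\<And>t. t \<in> S \<Longrightarrow> \<bar>h t - h s - c * (t - s)\<bar> \<le> M * (t - s)\<^sup>2"
  shows "(h has_real_derivative c) (at s within S)"
proof -
  have "((\<lambda>t. (h t - h s) / (t - s) - c) \<longlongrightarrow> 0) (at s within S)"
  proof (rule Lim_null_comparison)
    show "\<forall>\<^sub>F t in at s within S. norm ((h t - h s) / (t - s) - c) \<le> M * \<bar>t - s\<bar>"
      unfolding eventually_at_filter
    proof (rule eventuallyI, intro impI)
      fix t assume t: "t \<noteq> s" "t \<in> S"
      have "(h t - h s) / (t - s) - c = (h t - h s - c * (t - s)) / (t - s)"
        using t by (simp add: field_simps)
      then have "norm ((h t - h s) / (t - s) - c) = \<bar>h t - h s - c * (t - s)\<bar> / \<bar>t - s\<bar>"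
        by (simp add: abs_divide)
      also have "\<dots> \<le> M * (t - s)\<^sup>2 / \<bar>t - s\<bar>"
        using assms[OF t(2)] by (intro divide_right_mono) auto
      also have "\<dots> = M * \<bar>t - s\<bar>" using t
        by (simp add: power2_eq_square abs_if field_simps)
      finally show "norm ((h t - h s) / (t - s) - c) \<le> M * \<bar>t - s\<bar>" .
    qed
    show "((\<lambda>t. M * \<bar>t - s\<bar>) \<longlongrightarrow> 0) (at s within S)"
      by (auto intro!: tendsto_eq_intros)
  qed
  then show ?thesis by (simp add: has_field_derivative_iff LIM_zero_iff)
qed

lemma bang_axis_split: "bang_axis \<alpha> w = (w * sin \<alpha>) *\<^sub>R axis 1 1 + cos \<alpha> *\<^sub>R axis 3 1"
  by (simp add: bang_axis_def vec_eq_iff forall_3 vector_3 axis_def)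

text \<open>No differentiability is available for merely measurable controls, but a bilinear
  quantity that does not see the controlled axis is differentiable everywhere: its increments
  agree with the expected derivative up to a quadratic error.\<close>

lemma bang_sol_bilinear_derivative:
  assumes f: "bang_sol \<alpha> a b u f" and g: "bang_sol \<alpha> a b u g"
    and u: "\<And>t. t \<in> {a..b} \<Longrightarrow> \<bar>u t\<bar> \<le> 1" and E: "bounded_linear E"
    and comm: "\<And>z. E (cross3 (axis 1 1) z) = cross3 (axis 1 1) (E z)" and s: "s \<in> {a..b}"
  shows "((\<lambda>t. f t \<bullet> E (g t)) has_real_derivative
     (cos \<alpha> * (f s \<bullet> E (cross3 (axis 3 1) (g s)) + cross3 (axis 3 1) (f s) \<bullet> E (g s)))) (at s within {a..b})"
proof -
  interpret E: bounded_linear E by fact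
  obtain K where K: "K \<ge> 0" "\<And>t. t \<in> {a..b} \<Longrightarrow> norm (f t) \<le> K"
    "\<And>s t. s \<in> {a..b} \<Longrightarrow> t \<in> {a..b} \<Longrightarrow> norm (f t - f s) \<le> K * \<bar>t - s\<bar>"
    using bang_sol_Lipschitz[OF f u] by blast
  obtain L where L: "L \<ge> 0" "\<And>t. t \<in> {a..b} \<Longrightarrow> norm (g t) \<le> L"
    "\<And>s t. s \<in> {a..b} \<Longrightarrow> t \<in> {a..b} \<Longrightarrow> norm (g t - g s) \<le> L * \<bar>t - s\<bar>"
    using bang_sol_Lipschitz[OF g u] by blast
  obtain B where B: "B \<ge> 0" "\<And>z. norm (E z) \<le> norm z * B"
    using E.nonneg_bounded by blast
  define c where "c = cos \<alpha> * (f s \<bullet> E (cross3 (axis 3 1) (g s)) + cross3 (axis 3 1) (f s) \<bullet> E (g s))"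
  \<comment> \<open>The linear part at \<open>s\<close> of the bilinear quantity, as a function of
    the increments \<open>d\<close> and \<open>e\<close>.\<close>
  define P where "P d e = d \<bullet> E (g s) + f s \<bullet> E e" for d e
  define \<phi> where "\<phi> \<tau> = P (cross3 (bang_axis \<alpha> (u \<tau>)) (f \<tau>)) (cross3 (bang_axis \<alpha> (u \<tau>)) (g \<tau>))" for \<tau>
  have skew: "cross3 w x \<bullet> y = - (x \<bullet> cross3 w y)" for w x y
    by (simp add: cross3_simps)
  \<comment> \<open>The two contributions of the controlled first axis cancel, because the cross
    product is skew and \<open>E\<close> commutes with it. Hence the rate at \<open>s\<close> is the
    same for every control value.\<close>
  have c: "P (cross3 (bang_axis \<alpha> w) (f s)) (cross3 (bang_axis \<alpha> w) (g s)) = c" for w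
    unfolding P_def c_def bang_axis_split
    by (simp add: cross_add_left cross_mult_left E.add E.scaleR comm inner_add_left inner_add_right skew algebra_simps)
  have Pdiff: "P (d - d') (e - e') = P d e - P d' e'" for d d' e e'
    by (simp add: P_def E.diff inner_diff_left inner_diff_right)
  \<comment> \<open>The integrand differs from \<open>c\<close> only through increments of
    \<open>f\<close> and \<open>g\<close> from \<open>s\<close>, so by at most a multiple of
    \<open>q - r\<close>; integration supplies the second factor. Both one-sided cases are covered
    by letting \<open>s\<close> be either end point.\<close>
  have key: "\<bar>P (f q - f r) (g q - g r) - c * (q - r)\<bar> \<le> (4 * K * L * B) * (q - r)\<^sup>2"
    if qr: "r \<in> {a..b}" "q \<in> {a..b}" "r \<le> q" "s = r \<or> s = q" for q r
  proof -
    have bl: "bounded_linear (\<lambda>d. d \<bullet> E (g s))" "bounded_linear (\<lambda>e. f s \<bullet> E e)"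
      by (rule bounded_linear_inner_left, rule bounded_linear_compose[OF bounded_linear_inner_right E])
    have arq: "a \<le> r" "r \<le> q" "q \<le> b" using qr by auto
    have "(\<phi> has_integral P (f q - f r) (g q - g r)) {r..q}"
      unfolding \<phi>_def P_def
      by (rule has_integral_add[OF has_integral_linear[OF bang_sol_integral[OF f arq] bl(1), unfolded o_def]
            has_integral_linear[OF bang_sol_integral[OF g arq] bl(2), unfolded o_def]])
    moreover have "((\<lambda>_. c) has_integral c * (q - r)) {r..q}"
      using has_integral_const_real[of c r q] qr by (simp add: mult.commute)
    ultimately have I: "((\<lambda>\<tau>. \<phi> \<tau> - c) has_integral (P (f q - f r) (g q - g r) - c * (q - r))) {r..q}"
      by (rule has_integral_diff)
    have "norm (P (f q - f r) (g q - g r) - c * (q - r)) \<le> (4 * K * L * B * (q - r)) * measure lborel {r..q}"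
    proof (rule has_integral_bound_real[OF _ _ I])
      fix \<tau> assume t: "\<tau> \<in> {r..q} - {}"
      then have tab: "\<tau> \<in> {a..b}" and ts: "\<bar>\<tau> - s\<bar> \<le> q - r" using qr by auto
      let ?w = "bang_axis \<alpha> (u \<tau>)"
      have w: "norm ?w \<le> 2" using norm_bang_axis_le u tab by auto
      have "\<phi> \<tau> - c = P (cross3 ?w (f \<tau> - f s)) (cross3 ?w (g \<tau> - g s))"
        unfolding \<phi>_def c[of "u \<tau>", symmetric] by (simp add: Cross3.right_diff_distrib Pdiff)
      also have "norm \<dots> \<le> norm (cross3 ?w (f \<tau> - f s) \<bullet> E (g s)) + norm (f s \<bullet> E (cross3 ?w (g \<tau> - g s)))"
        unfolding P_def by (rule norm_triangle_ineq)
      also have "\<dots> \<le> (2 * (K * (q - r))) * (L * B) + K * ((2 * (L * (q - r))) * B)"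
      proof (rule add_mono)
        have "norm (cross3 ?w (f \<tau> - f s)) \<le> norm ?w * norm (f \<tau> - f s)" by (rule norm_cross3_le)
        also have "\<dots> \<le> 2 * (K * (q - r))"
          using w K(3)[OF s tab] ts K(1) by (intro mult_mono order.trans[OF K(3)[OF s tab]] mult_left_mono) auto
        finally have 1: "norm (cross3 ?w (f \<tau> - f s)) \<le> 2 * (K * (q - r))" .
        have 2: "norm (E (g s)) \<le> L * B" using B(2)[of "g s"] L(2)[OF s] B(1) by (meson mult_right_mono order.trans)
        have "norm (cross3 ?w (f \<tau> - f s) \<bullet> E (g s)) \<le> norm (cross3 ?w (f \<tau> - f s)) * norm (E (g s))"
          by (simp add: Cauchy_Schwarz_ineq2)
        also have "\<dots> \<le> (2 * (K * (q - r))) * (L * B)" using 1 2 K(1) qr by (intro mult_mono) auto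
        finally show "norm (cross3 ?w (f \<tau> - f s) \<bullet> E (g s)) \<le> (2 * (K * (q - r))) * (L * B)" .
        have "norm (cross3 ?w (g \<tau> - g s)) \<le> norm ?w * norm (g \<tau> - g s)" by (rule norm_cross3_le)
        also have "\<dots> \<le> 2 * (L * (q - r))"
          using w L(3)[OF s tab] ts L(1) by (intro mult_mono order.trans[OF L(3)[OF s tab]] mult_left_mono) auto
        finally have 3: "norm (cross3 ?w (g \<tau> - g s)) \<le> 2 * (L * (q - r))" .
        have 4: "norm (E (cross3 ?w (g \<tau> - g s))) \<le> 2 * (L * (q - r)) * B"
          using B(2)[of "cross3 ?w (g \<tau> - g s)"] 3 B(1) by (meson mult_right_mono order.trans)
        have "norm (f s \<bullet> E (cross3 ?w (g \<tau> - g s))) \<le> norm (f s) * norm (E (cross3 ?w (g \<tau> - g s)))"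
          by (simp add: Cauchy_Schwarz_ineq2)
        also have "\<dots> \<le> K * ((2 * (L * (q - r))) * B)" using K(2)[OF s] 4 K(1) by (intro mult_mono) auto
        finally show "norm (f s \<bullet> E (cross3 ?w (g \<tau> - g s))) \<le> K * ((2 * (L * (q - r))) * B)" .
      qed
      also have "\<dots> = 4 * K * L * B * (q - r)" by (simp add: algebra_simps)
      finally show "norm (\<phi> \<tau> - c) \<le> 4 * K * L * B * (q - r)" .
    qed (use qr K L B in auto)
    then show ?thesis using qr by (simp add: power2_eq_square algebra_simps)
  qed
  show ?thesis unfolding c_def[symmetric]
  proof (rule has_real_derivative_quadratic)
    fix t assume t: "t \<in> {a..b}"
    have 1: "\<bar>P (f t - f s) (g t - g s) - c * (t - s)\<bar> \<le> (4 * K * L * B) * (t - s)\<^sup>2"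
    proof (cases "s \<le> t")
      case True then show ?thesis using key[OF s t] by simp
    next
      case False
      have "P (f s - f t) (g s - g t) = - P (f t - f s) (g t - g s)"
        using Pdiff[of "f s - f s" "f t - f s" "g s - g s" "g t - g s"] by (simp add: P_def E.zero)
      then show ?thesis using key[OF t s] False by (simp add: power2_commute abs_if algebra_simps split: if_splits)
    qed
    \<comment> \<open>Exact bilinear expansion; the last term is a product of two increments, hence
      quadratic by the Lipschitz bounds.\<close>
    have 2: "f t \<bullet> E (g t) - f s \<bullet> E (g s) = P (f t - f s) (g t - g s) + (f t - f s) \<bullet> E (g t - g s)"
      by (simp add: P_def E.diff inner_diff_left inner_diff_right)
    have "\<bar>(f t - f s) \<bullet> E (g t - g s)\<bar> \<le> norm (f t - f s) * norm (E (g t - g s))"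
      by (rule Cauchy_Schwarz_ineq2)
    also have "\<dots> \<le> (K * \<bar>t - s\<bar>) * ((L * \<bar>t - s\<bar>) * B)"
      using K(3)[OF s t] L(3)[OF s t] K(1) B by (intro mult_mono) (meson mult_right_mono order.trans | simp)+
    also have "\<dots> = (K * L * B) * (t - s)\<^sup>2"
      by (simp add: power2_eq_square algebra_simps)
    finally have "\<bar>f t \<bullet> E (g t) - f s \<bullet> E (g s) - c * (t - s)\<bar> \<le> (4 * K * L * B) * (t - s)\<^sup>2 + (K * L * B) * (t - s)\<^sup>2"
      using 1 unfolding 2 by linarith
    then show "\<bar>f t \<bullet> E (g t) - f s \<bullet> E (g s) - c * (t - s)\<bar> \<le> (5 * K * L * B) * (t - s)\<^sup>2"
      by (simp add: algebra_simps)
  qed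
qed

text \<open>The difference is again a solution, and with \<open>E\<close> the identity its squared
  norm has derivative zero everywhere.\<close>

lemma bang_sol_unique:
  assumes f: "bang_sol \<alpha> a b u f" and g: "bang_sol \<alpha> a b u g"
    and u: "\<And>t. t \<in> {a..b} \<Longrightarrow> \<bar>u t\<bar> \<le> 1" and eq: "f a = g a" and t: "t \<in> {a..b}"
  shows "f t = g t"
proof -
  define d where "d t = f t - g t" for t
  have d: "bang_sol \<alpha> a b u d"
    unfolding bang_sol_def
  proof
    fix t assume "t \<in> {a..b}"
    with f g have "((\<lambda>\<tau>. cross3 (bang_axis \<alpha> (u \<tau>)) (f \<tau>) - cross3 (bang_axis \<alpha> (u \<tau>)) (g \<tau>)) has_integral (f t - f a) - (g t - g a)) {a..t}"
      by (intro has_integral_diff) (auto simp: bang_sol_def)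
    then show "((\<lambda>\<tau>. cross3 (bang_axis \<alpha> (u \<tau>)) (d \<tau>)) has_integral d t - d a) {a..t}"
      unfolding d_def Cross3.right_diff_distrib by (simp add: algebra_simps)
  qed
  have "((\<lambda>t. d t \<bullet> d t) has_real_derivative 0) (at s within {a..b})" if "s \<in> {a..b}" for s
    using bang_sol_bilinear_derivative[OF d d u bounded_linear_ident _ that]
    by (simp add: inner_commute dot_cross_self cross_triple)
  then have "\<exists>k. \<forall>t\<in>{a..b}. d t \<bullet> d t = k"
    by (intro has_field_derivative_zero_constant) auto
  then have "d t \<bullet> d t = d a \<bullet> d a" using t by auto
  then show ?thesis by (simp add: d_def eq)
qed

lemma bang_sol_rot:
  assumes N: "negligible N" "\<And>t. t \<in> {a<..<b} - N \<Longrightarrow> u t = \<sigma>" and \<sigma>: "\<bar>\<sigma>\<bar> = 1"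
  shows "bang_sol \<alpha> a b u (\<lambda>t. rot (bang_axis \<alpha> \<sigma>) (t - a) z)"
  unfolding bang_sol_def
proof
  fix t assume t: "t \<in> {a..b}"
  let ?y = "\<lambda>t. rot (bang_axis \<alpha> \<sigma>) (t - a) z"
  have d: "(?y has_vector_derivative cross3 (bang_axis \<alpha> \<sigma>) (?y s)) (at s within {a..t})" for s
  proof -
    have "((\<lambda>t. t - a) has_vector_derivative 1) (at s)" by (auto intro!: derivative_eq_intros)
    from vector_diff_chain_at[OF this rot_has_vector_derivative[OF norm_bang_axis[OF \<sigma>], where t="s - a" and S=UNIV and y=z]]
    show ?thesis by (auto simp: o_def intro: has_vector_derivative_at_within)
  qed
  have "((\<lambda>s. cross3 (bang_axis \<alpha> \<sigma>) (?y s)) has_integral (?y t - ?y a)) {a..t}"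
    using t d by (intro fundamental_theorem_of_calculus) auto
  then show "((\<lambda>\<tau>. cross3 (bang_axis \<alpha> (u \<tau>)) (?y \<tau>)) has_integral (?y t - ?y a)) {a..t}"
  proof (rule has_integral_spike[rotated 2])
    show "negligible (N \<union> {a, b})" using N(1) by simp
  qed (use N(2) t in auto)
qed

lemma bang_sol_eq_rot:
  assumes y: "bang_sol \<alpha> a b u y" and u: "\<And>t. t \<in> {a..b} \<Longrightarrow> \<bar>u t\<bar> \<le> 1"
    and N: "negligible N" "\<And>t. t \<in> {a<..<b} - N \<Longrightarrow> u t = \<sigma>" and \<sigma>: "\<bar>\<sigma>\<bar> = 1" and t: "t \<in> {a..b}"
  shows "y t = rot (bang_axis \<alpha> \<sigma>) (t - a) (y a)"
  using bang_sol_unique[OF y bang_sol_rot[OF N \<sigma>] u _ t, of "y a"] by simp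

text \<open>The first momentum component is the triple product
  \<open>p \<bullet> cross3 (axis 1 1) x\<close>, a bilinear quantity whose operator is the cross
  product with the controlled axis and therefore commutes with it.\<close>

lemma momentum_derivative:
  assumes x: "bang_sol \<alpha> a b u x" and p: "bang_sol \<alpha> a b u p"
    and u: "\<And>t. t \<in> {a..b} \<Longrightarrow> \<bar>u t\<bar> \<le> 1" and s: "s \<in> {a..b}"
  shows "((\<lambda>t. cross3 (x t) (p t) $ 1) has_real_derivative (- cos \<alpha> * (cross3 (x s) (p s) $ 2))) (at s within {a..b})"
proof -
  have 1: "p t \<bullet> cross3 (axis 1 1) (x t) = cross3 (x t) (p t) $ 1" for t
    by (simp add: vec3_simps axis_def)
  have 2: "cos \<alpha> * (p s \<bullet> cross3 (axis 1 1) (cross3 (axis 3 1) (x s)) + cross3 (axis 3 1) (p s) \<bullet> cross3 (axis 1 1) (x s))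
     = - cos \<alpha> * (cross3 (x s) (p s) $ 2)"
    by (simp add: vec3_simps axis_def algebra_simps)
  have "bounded_linear (cross3 (axis 1 1))"
    by (intro linear_conv_bounded_linear[THEN iffD1] linearI) (simp_all add: cross_add_right cross_mult_right)
  from bang_sol_bilinear_derivative[OF p x u this refl s] show ?thesis unfolding 1 2 .
qed

text \<open>While the first momentum component has the sign \<open>\<sigma>\<close>, maximality
  forces the control to be \<open>\<sigma>\<close> almost everywhere, so state, covector and
  momentum all rotate. At a first failure time before \<open>a + L\<close> the momentum would be
  given by the rotation alone, against \<open>pos\<close>. The alternatives in \<open>init\<close>
  start the argument, by value or by slope.\<close>

lemma extremal_arc:
  assumes x: "bang_sol \<alpha> 0 T u x" and p: "bang_sol \<alpha> 0 T u p"
    and u: "\<And>t. t \<in> {0..T} \<Longrightarrow> \<bar>u t\<bar> \<le> 1" and N: "negligible N"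
    and max: "\<And>t w. t \<in> {0..T} - N \<Longrightarrow> \<bar>w\<bar> \<le> 1 \<Longrightarrow> w * cross3 (x t) (p t) $ 1 \<le> u t * cross3 (x t) (p t) $ 1"
    and \<sigma>: "\<bar>\<sigma>\<bar> = 1" and a: "0 \<le> a" "a < T" and L: "L > 0"
    and pos: "\<And>\<tau>. 0 < \<tau> \<Longrightarrow> \<tau> < L \<Longrightarrow> 0 < \<sigma> * rot (bang_axis \<alpha> \<sigma>) \<tau> (cross3 (x a) (p a)) $ 1"
    and init: "0 < \<sigma> * cross3 (x a) (p a) $ 1 \<or>
       cross3 (x a) (p a) $ 1 = 0 \<and> \<sigma> * (cos \<alpha> * cross3 (x a) (p a) $ 2) < 0"
    and t: "a \<le> t" "t \<le> a + L" "t \<le> T"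
  shows "x t = rot (bang_axis \<alpha> \<sigma>) (t - a) (x a)" "p t = rot (bang_axis \<alpha> \<sigma>) (t - a) (p a)"
proof -
  define h where "h t = \<sigma> * cross3 (x t) (p t) $ 1" for t
  have der: "(h has_real_derivative (- \<sigma> * (cos \<alpha> * cross3 (x s) (p s) $ 2))) (at s within {0..T})"
    if "s \<in> {0..T}" for s
    unfolding h_def using DERIV_cmult[OF momentum_derivative[OF x p u that], of \<sigma>] by (simp add: mult.assoc)
  have cont: "continuous_on {0..T} h"
    by (rule DERIV_continuous_on[OF der])
  have us: "u t = \<sigma>" if "t \<in> {0..T} - N" "h t > 0" for t
  proof -
    let ?z = "cross3 (x t) (p t) $ 1"
    have le: "\<sigma> * ?z \<le> u t * ?z" using max[OF that(1)] \<sigma> by simp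
    have u1: "\<bar>u t\<bar> \<le> 1" using u that by auto
    have "\<sigma> = 1 \<or> \<sigma> = -1" using \<sigma> by (auto simp: abs_if split: if_splits)
    then show ?thesis
    proof
      assume "\<sigma> = 1"
      then show ?thesis using that(2) le u1 mult_le_cancel_right[of 1 ?z "u t"] by (simp add: h_def)
    next
      assume "\<sigma> = -1"
      then show ?thesis using that(2) le u1 mult_le_cancel_right[of "-1" ?z "u t"] by (simp add: h_def)
    qed
  qed
  have flow: "x r = rot (bang_axis \<alpha> \<sigma>) (r - a) (x a) \<and> p r = rot (bang_axis \<alpha> \<sigma>) (r - a) (p a)"
    if r: "a \<le> r" "r \<le> T" and h: "\<And>q. a < q \<Longrightarrow> q < r \<Longrightarrow> h q > 0" for r
  proof -
    have "bang_sol \<alpha> a r u x" "bang_sol \<alpha> a r u p"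
      using bang_sol_subinterval[OF x, of a r] bang_sol_subinterval[OF p, of a r] a r by auto
    moreover have "u q = \<sigma>" if "q \<in> {a<..<r} - N" for q using us[of q] h[of q] that a r by auto
    moreover have "\<bar>u q\<bar> \<le> 1" if "q \<in> {a..r}" for q using u[of q] that a r by auto
    ultimately show ?thesis
      using bang_sol_eq_rot[where N=N and b=r and \<sigma>=\<sigma> and a=a and u=u and t=r] N \<sigma> r by auto
  qed
  \<comment> \<open>Positivity just after \<open>a\<close>: by continuity if \<open>h a > 0\<close>,
    otherwise because \<open>h a = 0\<close> and the derivative is positive.\<close>
  obtain d where d: "d > 0" "\<And>q. a < q \<Longrightarrow> q < a + d \<Longrightarrow> q \<le> T \<Longrightarrow> h q > 0"
  proof (cases "h a > 0")
    case True
    have "a \<in> {0..T}" using a by auto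
    from cont[unfolded continuous_on_iff, rule_format, OF this True] obtain d where
      "d > 0" "\<And>q. q \<in> {0..T} \<Longrightarrow> dist q a < d \<Longrightarrow> dist (h q) (h a) < h a" by blast
    note d = this
    show ?thesis
    proof (rule that[of d])
      fix q assume q: "a < q" "q < a + d" "q \<le> T"
      then have "dist (h q) (h a) < h a" using a by (intro d(2)) (auto simp: dist_real_def)
      then show "h q > 0" by (simp add: dist_real_def abs_less_iff)
    qed (rule d)
  next
    case False
    then have h0: "h a = 0" "0 < - \<sigma> * (cos \<alpha> * cross3 (x a) (p a) $ 2)" using init by (auto simp: h_def)
    have "a \<in> {0..T}" using a by auto
    from has_real_derivative_pos_inc_right[OF der[OF this] h0(2)] obtain d where
      "d > 0" "\<And>k. 0 < k \<Longrightarrow> a + k \<in> {0..T} \<Longrightarrow> k < d \<Longrightarrow> h a < h (a + k)" by blast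
    note d = this
    show ?thesis
    proof (rule that[of d])
      fix q assume q: "a < q" "q < a + d" "q \<le> T"
      then have "h a < h (a + (q - a))" using a by (intro d(2)) auto
      then show "h q > 0" by (simp add: h0)
    qed (rule d)
  qed
  have main: "h q > 0" if q: "a < q" "q < a + L" "q \<le> T" for q
  proof (rule ccontr)
    assume neg: "\<not> h q > 0"
    \<comment> \<open>Starting at \<open>a + d / 2\<close> keeps the set closed while excluding
      \<open>a\<close>, where \<open>h\<close> may vanish; its infimum is then the first
      failure.\<close>
    define Z where "Z = {r \<in> {a + d / 2..q}. h r \<le> 0}"
    have qd: "a + d \<le> q" using d(2)[of q] q neg by force
    have "Z = {a + d / 2..q} \<inter> {r \<in> {0..T}. h r \<le> 0}" using a d q by (auto simp: Z_def)
    moreover have "closed {r \<in> {0..T}. h r \<le> 0}"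
      using continuous_closed_preimage[OF cont closed_atLeastAtMost closed_atMost[of 0]] by (simp add: vimage_def Int_def)
    ultimately have cl: "closed Z" by (simp add: closed_Int)
    have ne: "Z \<noteq> {}" using neg qd d by (auto simp: Z_def intro!: exI[of _ q])
    have bb: "bdd_below Z" by (auto simp: Z_def intro!: bdd_belowI[of _ "a + d / 2"])
    define r where "r = Inf Z"
    have r: "r \<in> Z" unfolding r_def by (rule closed_contains_Inf[OF ne bb cl])
    have "h k > 0" if "a < k" "k < r" for k
    proof (cases "k < a + d")
      case True then show ?thesis using d(2)[of k] that r q by (auto simp: Z_def)
    next
      case False
      have "k \<notin> Z" using that(2) cInf_lower[OF _ bb, of k] unfolding r_def by auto
      then show ?thesis using False that r d by (auto simp: Z_def)
    qed
    moreover have ra: "a < r" "r \<le> T" "r < a + L" using r q d by (auto simp: Z_def)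
    ultimately have "x r = rot (bang_axis \<alpha> \<sigma>) (r - a) (x a) \<and> p r = rot (bang_axis \<alpha> \<sigma>) (r - a) (p a)"
      using flow[of r] by auto
    then have "h r > 0" unfolding h_def using pos[of "r - a"] ra
      by (simp add: rot_cross[OF norm_bang_axis[OF \<sigma>]])
    then show False using r by (auto simp: Z_def)
  qed
  show "x t = rot (bang_axis \<alpha> \<sigma>) (t - a) (x a)" "p t = rot (bang_axis \<alpha> \<sigma>) (t - a) (p a)"
    using flow[of t] main t by auto
qed

text \<open>The angular momentum \<open>x \<times> p\<close> at a switch and at time \<open>0\<close>, in terms of the length \<open>s\<close> of the
  first arc. The positive factor \<open>\<kappa>\<close> spares normalizing covectors.\<close>

definition switch_momentum :: "real \<Rightarrow> real \<Rightarrow> real \<Rightarrow> real \<Rightarrow> real^3" where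
  "switch_momentum \<epsilon> \<alpha> s \<kappa> =
     vector [0, \<epsilon> * (\<kappa> * ((sin \<alpha>)\<^sup>2 * cos s + (cos \<alpha>)\<^sup>2)), \<kappa> * sin s * sin \<alpha>]"

definition start_momentum :: "real \<Rightarrow> real \<Rightarrow> real \<Rightarrow> real \<Rightarrow> real^3" where
  "start_momentum \<epsilon> \<alpha> s \<kappa> =
     vector [\<epsilon> * (\<kappa> * (cos \<alpha> * sin s)), \<epsilon> * (\<kappa> * ((sin \<alpha>)\<^sup>2 + (cos \<alpha>)\<^sup>2 * cos s)), 0]"

section \<open>The switching function and its zeros\<close>

lemma sin_cos_quarter:
  fixes \<alpha> :: real
  assumes "0 < \<alpha>" "\<alpha> < pi / 4"
  shows "0 < sin \<alpha>" "0 < cos \<alpha>" "(sin \<alpha>)\<^sup>2 < (cos \<alpha>)\<^sup>2"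
proof -
  have "cos (2 * \<alpha>) > 0" using assms by (intro cos_gt_zero) auto
  then show "(sin \<alpha>)\<^sup>2 < (cos \<alpha>)\<^sup>2" by (simp add: cos_double)
  show "0 < sin \<alpha>" "0 < cos \<alpha>" using assms by (auto intro!: sin_gt_zero cos_gt_zero)
qed

text \<open>This quantity is, up to sign and scaling, the second momentum component at a switch; its
  positivity means that the first component crosses zero transversally.\<close>

lemma switch_coeff_pos:
  assumes "0 < \<alpha>" "\<alpha> < pi / 4"
  shows "0 < (sin \<alpha>)\<^sup>2 * cos s + (cos \<alpha>)\<^sup>2"
proof -
  have "(sin \<alpha>)\<^sup>2 * (-1) \<le> (sin \<alpha>)\<^sup>2 * cos s" by (intro mult_left_mono) auto
  then show ?thesis using sin_cos_quarter[OF assms] by simp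
qed

text \<open>\<open>A\<close> is half the excess of \<open>v\<close> over pi. Its tangent relation is
  kept free of divisions, in the form that enters the zeros of the switching function.\<close>

lemma v_fun_arctan:
  assumes "0 < \<alpha>" "\<alpha> < pi / 4" "0 \<le> s" "s \<le> pi"
  obtains A where "v_fun \<alpha> s = pi + 2 * A" "0 \<le> A" "A < pi / 2"
    "sin A * ((sin \<alpha>)\<^sup>2 * cos s + (cos \<alpha>)\<^sup>2) = cos A * (sin s * (sin \<alpha>)\<^sup>2)"
proof -
  define q where "q = (sin \<alpha>)\<^sup>2 * cos s + (cos \<alpha>)\<^sup>2"
  define A where "A = arctan (sin s / (cos s + (cot \<alpha>)\<^sup>2))"
  have q: "q > 0" unfolding q_def by (rule switch_coeff_pos[OF assms(1,2)])
  have sa: "sin \<alpha> \<noteq> 0" using sin_cos_quarter[OF assms(1,2)] by simp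
  have "cos s + (cot \<alpha>)\<^sup>2 = q / (sin \<alpha>)\<^sup>2"
    using sa by (simp add: q_def cot_def power_divide field_simps)
  then have A: "A = arctan (sin s * (sin \<alpha>)\<^sup>2 / q)" by (simp add: A_def)
  then have "tan A = sin s * (sin \<alpha>)\<^sup>2 / q" by (simp add: tan_arctan)
  moreover have "cos A \<noteq> 0" by (simp add: A)
  ultimately have "sin A * q = cos A * (sin s * (sin \<alpha>)\<^sup>2)"
    using q by (simp add: tan_def field_simps)
  moreover have "0 \<le> A" using assms(3,4) q by (simp add: A sin_ge_zero)
  ultimately show ?thesis using that[of A] arctan_ubound by (auto simp: v_fun_def A_def q_def)
qed

lemma rot_first:
  "rot w t y $ 1 = cos t * y $ 1 + sin t * (w $ 2 * y $ 3 - w $ 3 * y $ 2) + (1 - cos t) * (w $ 1 * y $ 1 + w $ 2 * y $ 2 + w $ 3 * y $ 3) * w $ 1"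
  "rot w t y $ 2 = cos t * y $ 2 + sin t * (w $ 3 * y $ 1 - w $ 1 * y $ 3) + (1 - cos t) * (w $ 1 * y $ 1 + w $ 2 * y $ 2 + w $ 3 * y $ 3) * w $ 2"
  "rot w t y $ 3 = cos t * y $ 3 + sin t * (w $ 1 * y $ 2 - w $ 2 * y $ 1) + (1 - cos t) * (w $ 1 * y $ 1 + w $ 2 * y $ 2 + w $ 3 * y $ 3) * w $ 3"
  by (simp_all add: rot_def vec3_simps)

lemma rot_axis_inner:
  assumes "norm w = 1" shows "w \<bullet> rot w t y = w \<bullet> y"
proof -
  have "w \<bullet> w = 1" using assms by (simp add: dot_square_norm)
  then show ?thesis by (simp add: rot_def inner_add_right dot_cross_self algebra_simps)
qed

lemma bang_axis_inner: "bang_axis \<alpha> \<sigma> \<bullet> y = \<sigma> * sin \<alpha> * y $ 1 + cos \<alpha> * y $ 3"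
  by (simp add: bang_axis_def vec3_simps)

context
  fixes \<alpha> \<epsilon> s \<kappa> :: real
  assumes \<alpha>: "0 < \<alpha>" "\<alpha> < pi / 4" and \<epsilon>: "\<bar>\<epsilon>\<bar> = 1" and s: "0 < s" "s \<le> pi" and \<kappa>: "\<kappa> > 0"
begin

lemma eps_sq: "\<epsilon> * \<epsilon> = 1" "\<epsilon> * (\<epsilon> * z) = z"
proof -
  have "\<epsilon> = 1 \<or> \<epsilon> = -1" using \<epsilon> by (auto simp: abs_if split: if_splits)
  then show "\<epsilon> * \<epsilon> = 1" "\<epsilon> * (\<epsilon> * z) = z" by auto
qed

lemma first_arc_component:
  "\<epsilon> * rot (bang_axis \<alpha> \<epsilon>) \<tau> (start_momentum \<epsilon> \<alpha> s \<kappa>) $ 1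
     = \<kappa> * cos \<alpha> * ((sin \<alpha>)\<^sup>2 * (sin s - sin \<tau>) + (cos \<alpha>)\<^sup>2 * sin (s - \<tau>))"
proof -
  have "\<epsilon> * rot (bang_axis \<alpha> \<epsilon>) \<tau> (start_momentum \<epsilon> \<alpha> s \<kappa>) $ 1 =
    \<kappa> * cos \<alpha> * (cos \<tau> * sin s - sin \<tau> * ((sin \<alpha>)\<^sup>2 + (cos \<alpha>)\<^sup>2 * cos s) + (1 - cos \<tau>) * (sin \<alpha>)\<^sup>2 * sin s) * (\<epsilon> * \<epsilon>)"
    unfolding rot_first bang_axis_def start_momentum_def vector_3
    using eps_sq(1) by algebra
  also have "\<dots> = \<kappa> * cos \<alpha> * (cos \<tau> * (1 - (sin \<alpha>)\<^sup>2) * sin s - sin \<tau> * ((sin \<alpha>)\<^sup>2 + (cos \<alpha>)\<^sup>2 * cos s) + (sin \<alpha>)\<^sup>2 * sin s)"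
    by (simp add: eps_sq algebra_simps)
  finally show ?thesis by (simp add: cos_squared_eq[symmetric] sin_diff algebra_simps)
qed

text \<open>Half-angle formulas split off the positive factor \<open>sin ((s - \<tau>) / 2)\<close>.
  In the remaining factor the cosine of the half sum is at least minus that of the half difference,
  their sum being \<open>2 * cos (s / 2) * cos (\<tau> / 2)\<close>; the inequality between the
  squares of sine and cosine of \<open>\<alpha>\<close> then decides the sign.\<close>

lemma first_arc_pos:
  assumes "0 < \<tau>" "\<tau> < s"
  shows "0 < \<epsilon> * rot (bang_axis \<alpha> \<epsilon>) \<tau> (start_momentum \<epsilon> \<alpha> s \<kappa>) $ 1"
proof -
  note q = sin_cos_quarter[OF \<alpha>]
  let ?d = "(s - \<tau>) / 2" and ?e = "(s + \<tau>) / 2"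
  have "sin s - sin \<tau> = 2 * sin ?d * cos ?e" using sin_diff_sin[of s \<tau>] by simp
  moreover have "sin (s - \<tau>) = 2 * sin ?d * cos ?d" unfolding sin_double[symmetric] by (rule arg_cong[of _ _ sin]) simp
  ultimately have eq: "(sin \<alpha>)\<^sup>2 * (sin s - sin \<tau>) + (cos \<alpha>)\<^sup>2 * sin (s - \<tau>)
     = 2 * sin ?d * ((sin \<alpha>)\<^sup>2 * cos ?e + (cos \<alpha>)\<^sup>2 * cos ?d)" by (simp add: algebra_simps)
  have sd: "sin ?d > 0" using assms s by (intro sin_gt_zero) auto
  have cd: "cos ?d > 0" using assms s by (intro cos_gt_zero_pi) auto
  have "cos ?d + cos ?e = 2 * cos (s / 2) * cos (\<tau> / 2)"
  proof -
    have "?d = s / 2 - \<tau> / 2" "?e = s / 2 + \<tau> / 2" by (simp_all add: field_simps)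
    then show ?thesis by (simp only: cos_add cos_diff)
  qed
  also have "\<dots> \<ge> 0" using assms s by (intro mult_nonneg_nonneg cos_ge_zero) auto
  finally have "- cos ?d \<le> cos ?e" by simp
  then have "(sin \<alpha>)\<^sup>2 * (- cos ?d) \<le> (sin \<alpha>)\<^sup>2 * cos ?e" by (intro mult_left_mono) auto
  moreover have "(sin \<alpha>)\<^sup>2 * cos ?d < (cos \<alpha>)\<^sup>2 * cos ?d" using q cd by simp
  ultimately have "0 < (sin \<alpha>)\<^sup>2 * cos ?e + (cos \<alpha>)\<^sup>2 * cos ?d" by simp
  then show ?thesis unfolding first_arc_component eq using q sd \<kappa> by simp
qed

text \<open>The first component vanishes by the explicit formula. The rotation conserves the inner
  product with its axis, which then determines the third component; the second is computed
  directly.\<close>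

lemma first_arc_end:
  "rot (bang_axis \<alpha> \<epsilon>) s (start_momentum \<epsilon> \<alpha> s \<kappa>) = switch_momentum \<epsilon> \<alpha> s \<kappa>"
proof -
  let ?y = "rot (bang_axis \<alpha> \<epsilon>) s (start_momentum \<epsilon> \<alpha> s \<kappa>)"
  have "\<epsilon> * ?y $ 1 = 0" by (simp add: first_arc_component)
  then have 1: "?y $ 1 = 0" using \<epsilon> by auto
  have "cos \<alpha> * ?y $ 3 = bang_axis \<alpha> \<epsilon> \<bullet> ?y" by (simp add: bang_axis_inner 1)
  also have "\<dots> = \<epsilon> * sin \<alpha> * (\<epsilon> * (\<kappa> * (cos \<alpha> * sin s)))"
    unfolding rot_axis_inner[OF norm_bang_axis[OF \<epsilon>]] by (simp add: bang_axis_inner start_momentum_def vector_3)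
  also have "\<dots> = cos \<alpha> * (\<kappa> * sin s * sin \<alpha>)" by (simp add: eps_sq algebra_simps)
  finally have 3: "?y $ 3 = \<kappa> * sin s * sin \<alpha>" using sin_cos_quarter[OF \<alpha>] by simp
  have "?y $ 2 = \<epsilon> * \<kappa> * ((sin \<alpha>)\<^sup>2 * cos s + (cos \<alpha>)\<^sup>2 * ((cos s)\<^sup>2 + (sin s)\<^sup>2))"
    by (simp add: rot_first bang_axis_def start_momentum_def vector_3 power2_eq_square algebra_simps del: sin_cos_squared_add3)
  then have 2: "?y $ 2 = \<epsilon> * (\<kappa> * ((sin \<alpha>)\<^sup>2 * cos s + (cos \<alpha>)\<^sup>2))" by simp
  show ?thesis using 1 2 3 by (simp add: vec_eq_iff forall_3 switch_momentum_def vector_3)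
qed

text \<open>This is where \<open>v\<close> originates: the tangent relation for \<open>A\<close>
  turns the component into a sum of two sines, which factors. After the zero at
  \<open>\<tau> = 0\<close> the next one is where \<open>\<tau> / 2 - A\<close> equals
  \<open>pi / 2\<close>, that is \<open>\<tau> = pi + 2 * A\<close>.\<close>

lemma full_arc_component:
  assumes "sin A * ((sin \<alpha>)\<^sup>2 * cos s + (cos \<alpha>)\<^sup>2) = cos A * (sin s * (sin \<alpha>)\<^sup>2)"
  shows "cos A * (- \<epsilon> * rot (bang_axis \<alpha> (- \<epsilon>)) \<tau> (switch_momentum \<epsilon> \<alpha> s \<kappa>) $ 1)
     = \<kappa> * cos \<alpha> * ((sin \<alpha>)\<^sup>2 * cos s + (cos \<alpha>)\<^sup>2) * (2 * sin (\<tau> / 2) * cos (\<tau> / 2 - A))"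
proof -
  define q where "q = (sin \<alpha>)\<^sup>2 * cos s + (cos \<alpha>)\<^sup>2"
  have "- \<epsilon> * rot (bang_axis \<alpha> (- \<epsilon>)) \<tau> (switch_momentum \<epsilon> \<alpha> s \<kappa>) $ 1
    = \<kappa> * cos \<alpha> * (q * sin \<tau> + (1 - cos \<tau>) * (sin s * (sin \<alpha>)\<^sup>2)) * (\<epsilon> * \<epsilon>)"
    unfolding rot_first bang_axis_def switch_momentum_def vector_3 q_def[symmetric]
    using eps_sq(1) by algebra
  then have "cos A * (- \<epsilon> * rot (bang_axis \<alpha> (- \<epsilon>)) \<tau> (switch_momentum \<epsilon> \<alpha> s \<kappa>) $ 1)
    = \<kappa> * cos \<alpha> * (q * cos A * sin \<tau> + (1 - cos \<tau>) * (cos A * (sin s * (sin \<alpha>)\<^sup>2)))"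
    by (simp add: eps_sq algebra_simps)
  also have "\<dots> = \<kappa> * cos \<alpha> * q * (sin (\<tau> - A) + sin A)"
    unfolding assms[symmetric] q_def[symmetric] by (simp add: sin_diff algebra_simps)
  also have "sin (\<tau> - A) + sin A = 2 * sin (\<tau> / 2) * cos (\<tau> / 2 - A)"
    using sin_plus_sin[of "\<tau> - A" A] by (simp add: diff_divide_distrib)
  finally show ?thesis by (simp add: q_def)
qed

lemma full_arc_pos:
  assumes "0 < \<tau>" "\<tau> < v_fun \<alpha> s"
  shows "0 < - \<epsilon> * rot (bang_axis \<alpha> (- \<epsilon>)) \<tau> (switch_momentum \<epsilon> \<alpha> s \<kappa>) $ 1"
proof -
  obtain A where A: "v_fun \<alpha> s = pi + 2 * A" "0 \<le> A" "A < pi / 2"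
    "sin A * ((sin \<alpha>)\<^sup>2 * cos s + (cos \<alpha>)\<^sup>2) = cos A * (sin s * (sin \<alpha>)\<^sup>2)"
    using v_fun_arctan[OF \<alpha>, of s] s by auto
  have "cos A > 0" using A by (intro cos_gt_zero_pi) auto
  moreover have "sin (\<tau> / 2) > 0" using assms A by (intro sin_gt_zero) auto
  moreover have "cos (\<tau> / 2 - A) > 0" using assms A by (intro cos_gt_zero_pi) auto
  ultimately have "0 < cos A * (- \<epsilon> * rot (bang_axis \<alpha> (- \<epsilon>)) \<tau> (switch_momentum \<epsilon> \<alpha> s \<kappa>) $ 1)"
    unfolding full_arc_component[OF A(4)] using switch_coeff_pos[OF \<alpha>] sin_cos_quarter[OF \<alpha>] \<kappa> by simp
  from zero_less_mult_pos[OF this \<open>cos A > 0\<close>] show ?thesis .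
qed

text \<open>Conservation along the rotation axis again gives the third component. The second is
  multiplied by \<open>cos A\<close> to collapse to a single cosine, which shows that it merely
  changes sign; hence all later arcs repeat this one.\<close>

lemma full_arc_end:
  "rot (bang_axis \<alpha> (- \<epsilon>)) (v_fun \<alpha> s) (switch_momentum \<epsilon> \<alpha> s \<kappa>) = switch_momentum (- \<epsilon>) \<alpha> s \<kappa>"
proof -
  obtain A where A: "v_fun \<alpha> s = pi + 2 * A" "0 \<le> A" "A < pi / 2"
    "sin A * ((sin \<alpha>)\<^sup>2 * cos s + (cos \<alpha>)\<^sup>2) = cos A * (sin s * (sin \<alpha>)\<^sup>2)"
    using v_fun_arctan[OF \<alpha>, of s] s by auto
  define q where "q = (sin \<alpha>)\<^sup>2 * cos s + (cos \<alpha>)\<^sup>2"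
  let ?y = "rot (bang_axis \<alpha> (- \<epsilon>)) (v_fun \<alpha> s) (switch_momentum \<epsilon> \<alpha> s \<kappa>)"
  have cA: "cos A > 0" using A by (intro cos_gt_zero_pi) auto
  have c0: "cos (v_fun \<alpha> s / 2 - A) = 0" by (simp add: A add_divide_distrib)
  have "cos A * (- \<epsilon> * ?y $ 1) = 0" unfolding full_arc_component[OF A(4)] c0 by simp
  then have 1: "?y $ 1 = 0" using cA \<epsilon> by auto
  have "cos \<alpha> * ?y $ 3 = bang_axis \<alpha> (- \<epsilon>) \<bullet> ?y" by (simp add: bang_axis_inner 1)
  also have "\<dots> = cos \<alpha> * (\<kappa> * sin s * sin \<alpha>)"
    using \<epsilon> by (subst rot_axis_inner) (simp_all add: norm_bang_axis bang_axis_inner switch_momentum_def vector_3)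
  finally have 3: "?y $ 3 = \<kappa> * sin s * sin \<alpha>" using sin_cos_quarter[OF \<alpha>] by simp
  have "?y $ 2 = \<epsilon> * \<kappa> * (q * cos (v_fun \<alpha> s) + sin s * (sin \<alpha>)\<^sup>2 * sin (v_fun \<alpha> s))"
    by (simp add: rot_first bang_axis_def switch_momentum_def vector_3 q_def power2_eq_square algebra_simps)
  then have "cos A * ?y $ 2 = \<epsilon> * \<kappa> * (q * cos A * cos (v_fun \<alpha> s) + (cos A * (sin s * (sin \<alpha>)\<^sup>2)) * sin (v_fun \<alpha> s))"
    by (simp add: algebra_simps)
  also have "\<dots> = \<epsilon> * \<kappa> * q * cos (v_fun \<alpha> s - A)"
    unfolding A(4)[symmetric] q_def[symmetric] by (simp add: cos_diff algebra_simps)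
  also have "\<dots> = cos A * (- \<epsilon> * (\<kappa> * q))" by (simp add: A)
  finally have 2: "?y $ 2 = - \<epsilon> * (\<kappa> * q)"
    by (rule mult_left_cancel[THEN iffD1, rotated]) (use cA in simp)
  show ?thesis using 1 2 3 by (simp add: vec_eq_iff forall_3 switch_momentum_def vector_3 q_def)
qed

end

text \<open>Position at time \<open>s + j * v_fun \<alpha> s\<close>, after an arc of length
  \<open>s\<close> with control \<open>\<epsilon>\<close> and \<open>j\<close> complete arcs with
  alternating controls.\<close>

primrec bang_point :: "real \<Rightarrow> real \<Rightarrow> real \<Rightarrow> nat \<Rightarrow> real^3" where
  "bang_point \<alpha> \<epsilon> s 0 = rot (bang_axis \<alpha> \<epsilon>) s north"
| "bang_point \<alpha> \<epsilon> s (Suc j) = rot (bang_axis \<alpha> (\<epsilon> * (-1) ^ Suc j)) (v_fun \<alpha> s) (bang_point \<alpha> \<epsilon> s j)"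

text \<open>Up to positive scaling, the directions in the closed half-plane
  \<open>C \<ge> 0\<close>, without the ray \<open>C = 0\<close>, \<open>D > 0\<close>, are swept
  once the curve parameter runs through (0, pi]. The parameter pi gives the ray with
  \<open>D < 0\<close>.\<close>

lemma start_momentum_param:
  assumes \<alpha>: "0 < \<alpha>" "\<alpha> < pi / 4" and C: "0 \<le> C" "C = 0 \<Longrightarrow> D < 0"
  obtains s \<kappa> where "0 < s" "s \<le> pi" "\<kappa> > 0" "C = \<kappa> * (cos \<alpha> * sin s)"
    "D = \<kappa> * ((sin \<alpha>)\<^sup>2 + (cos \<alpha>)\<^sup>2 * cos s)"
proof (cases "C = 0")
  case True
  note q = sin_cos_quarter[OF \<alpha>]
  define \<kappa> where "\<kappa> = D / ((sin \<alpha>)\<^sup>2 - (cos \<alpha>)\<^sup>2)"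
  have "(sin \<alpha>)\<^sup>2 - (cos \<alpha>)\<^sup>2 \<noteq> 0" using q(3) by linarith
  then have D: "\<kappa> * ((sin \<alpha>)\<^sup>2 - (cos \<alpha>)\<^sup>2) = D" by (simp add: \<kappa>_def)
  have "\<kappa> > 0" using C(2)[OF True] q by (simp add: \<kappa>_def divide_neg_neg)
  moreover have "D = \<kappa> * ((sin \<alpha>)\<^sup>2 + (cos \<alpha>)\<^sup>2 * cos pi)" using D by simp
  ultimately show ?thesis using True that[of pi \<kappa>] by simp
next
  case False
  note q = sin_cos_quarter[OF \<alpha>]
  have C0: "C > 0" using C False by simp
  \<comment> \<open>Determinant of \<open>(C, D)\<close> against the curve of directions: a zero
    means proportionality. It equals \<open>C\<close> at 0 and is negative at pi because \<alpha> <
    pi/4.\<close>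
  define g where "g t = C * ((sin \<alpha>)\<^sup>2 + (cos \<alpha>)\<^sup>2 * cos t) - D * (cos \<alpha> * sin t)" for t
  have g0: "g 0 > 0" using C0 by (simp add: g_def)
  have gpi: "g pi < 0" using C0 q by (simp add: g_def mult_less_0_iff)
  have "\<exists>t\<ge>0. t \<le> pi \<and> g t = 0"
    by (rule IVT2') (use g0 gpi in \<open>auto simp: g_def intro!: continuous_intros\<close>)
  then obtain s where s: "0 \<le> s" "s \<le> pi" "g s = 0" by blast
  then have s': "0 < s" "s < pi" using g0 gpi by (metis less_eq_real_def less_irrefl)+
  have ss: "sin s > 0" using s' by (intro sin_gt_zero)
  define \<kappa> where "\<kappa> = C / (cos \<alpha> * sin s)"
  have k: "\<kappa> > 0" using C0 q ss by (simp add: \<kappa>_def)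
  have Ck: "C = \<kappa> * (cos \<alpha> * sin s)" using q ss by (simp add: \<kappa>_def)
  have "D * (cos \<alpha> * sin s) = (\<kappa> * ((sin \<alpha>)\<^sup>2 + (cos \<alpha>)\<^sup>2 * cos s)) * (cos \<alpha> * sin s)"
    using s(3) unfolding g_def by (subst (asm) Ck) (simp add: algebra_simps)
  then have "D = \<kappa> * ((sin \<alpha>)\<^sup>2 + (cos \<alpha>)\<^sup>2 * cos s)"
    by (rule mult_right_cancel[THEN iffD1, rotated]) (use q ss in simp)
  then show ?thesis using s' k Ck by (intro that[of s \<kappa>]) auto
qed

section \<open>Extremals as concatenations of bang arcs\<close>

lemma v_fun_ge_pi:
  assumes "0 < \<alpha>" "\<alpha> < pi / 4" "0 \<le> s" "s \<le> pi" shows "pi \<le> v_fun \<alpha> s"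
  by (rule v_fun_arctan[OF assms]) simp

lemma hamiltonian_eq:
  "hamiltonian \<alpha> p x w = w * sin \<alpha> * cross3 x p $ 1 + cos \<alpha> * cross3 x p $ 3"
  unfolding hamiltonian_def control_matrix_cross
  by (simp add: bang_axis_def vec3_simps algebra_simps)

text \<open>The initial covector determines the sign and length of the first arc; then each switch
  reproduces the same momentum up to sign, so \<open>extremal_arc\<close> applies inductively. The
  index \<open>j\<close> of the arc containing \<open>T\<close> is supplied by the caller.\<close>

lemma PMP_bang_bang:
  assumes \<alpha>: "0 < \<alpha>" "\<alpha> < pi / 4" and adm: "admissible_control T u"
    and traj: "trajectory \<alpha> T u x" and PMP: "satisfies_PMP \<alpha> T u x" and T: "T > 0"
  obtains \<epsilon> s where "\<epsilon> \<in> {1, -1}" "0 < s" "s \<le> pi"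
    "\<And>j. s + real j * v_fun \<alpha> s \<le> T \<Longrightarrow> T \<le> s + real (Suc j) * v_fun \<alpha> s \<Longrightarrow>
       x T = rot (bang_axis \<alpha> (\<epsilon> * (-1) ^ Suc j)) (T - (s + real j * v_fun \<alpha> s)) (bang_point \<alpha> \<epsilon> s j)"
proof -
  obtain p \<mu> where p0: "\<forall>t\<in>{0..T}. p t \<noteq> 0 \<and> p t \<bullet> x t = 0"
    and p1: "\<forall>t\<in>{0..T}. ((\<lambda>\<tau>. - (transpose (control_matrix \<alpha> (u \<tau>)) *v p \<tau>)) has_integral (p t - p 0)) {0..t}"
    and ae: "AE t in lebesgue_on {0..T}. \<forall>w\<in>{-1..1}. hamiltonian \<alpha> (p t) (x t) w \<le> hamiltonian \<alpha> (p t) (x t) (u t)"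
    using PMP unfolding satisfies_PMP_def by blast
  have xs: "bang_sol \<alpha> 0 T u x" and x0: "x 0 = north"
    using traj unfolding trajectory_def bang_sol_def control_matrix_cross by auto
  have ps: "bang_sol \<alpha> 0 T u p"
    using p1 unfolding bang_sol_def control_matrix_transpose_cross by auto
  have u: "\<bar>u t\<bar> \<le> 1" if "t \<in> {0..T}" for t using adm that unfolding admissible_control_def by auto
  have "AE t in lebesgue. t \<in> {0..T} \<longrightarrow> (\<forall>w\<in>{-1..1}. hamiltonian \<alpha> (p t) (x t) w \<le> hamiltonian \<alpha> (p t) (x t) (u t))"
    using ae by (subst (asm) AE_restrict_space_iff) auto
  then obtain N where N: "N \<in> null_sets lebesgue"
    "\<And>t. t \<in> space lebesgue - N \<Longrightarrow> t \<in> {0..T} \<longrightarrow> (\<forall>w\<in>{-1..1}. hamiltonian \<alpha> (p t) (x t) w \<le> hamiltonian \<alpha> (p t) (x t) (u t))"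
    by (rule AE_E3) blast
  have neg: "negligible N" using N(1) by (simp add: negligible_iff_null_sets)
  note q = sin_cos_quarter[OF \<alpha>]
  have max: "w * cross3 (x t) (p t) $ 1 \<le> u t * cross3 (x t) (p t) $ 1" if "t \<in> {0..T} - N" "\<bar>w\<bar> \<le> 1" for t w
  proof -
    have "w \<in> {-1..1}" using that by auto
    then have "hamiltonian \<alpha> (p t) (x t) w \<le> hamiltonian \<alpha> (p t) (x t) (u t)" using N(2)[of t] that by auto
    then have "sin \<alpha> * (w * cross3 (x t) (p t) $ 1) \<le> sin \<alpha> * (u t * cross3 (x t) (p t) $ 1)"
      unfolding hamiltonian_eq by (simp add: mult_ac)
    then show ?thesis using q by (simp add: mult_le_cancel_left_pos)
  qed
  have "p 0 \<noteq> 0" "p 0 \<bullet> north = 0" using p0[rule_format, of 0] T x0 by auto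
  then have p3: "p 0 $ 3 = 0" and pn: "p 0 $ 1 \<noteq> 0 \<or> p 0 $ 2 \<noteq> 0"
    by (auto simp: north_def vec3_simps)
  \<comment> \<open>At \<open>north\<close> the momentum is \<open>(- p 0 $ 2, p 0 $ 1, 0)\<close>.
    The sign of its first component selects the control; if that component is zero, its slope does,
    which has the sign opposite to the second component.\<close>
  define \<epsilon> :: real where "\<epsilon> = (if p 0 $ 2 < 0 \<or> p 0 $ 2 = 0 \<and> p 0 $ 1 < 0 then 1 else -1)"
  have \<epsilon>: "\<epsilon> \<in> {1, -1}" "\<bar>\<epsilon>\<bar> = 1" by (auto simp: \<epsilon>_def)
  obtain s \<kappa> where s: "0 < s" "s \<le> pi" "\<kappa> > 0" "- \<epsilon> * p 0 $ 2 = \<kappa> * (cos \<alpha> * sin s)"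
    "\<epsilon> * p 0 $ 1 = \<kappa> * ((sin \<alpha>)\<^sup>2 + (cos \<alpha>)\<^sup>2 * cos s)"
  proof (rule start_momentum_param[OF \<alpha>, of "- \<epsilon> * p 0 $ 2" "\<epsilon> * p 0 $ 1"])
    show "0 \<le> - \<epsilon> * p 0 $ 2" by (auto simp: \<epsilon>_def)
    show "\<epsilon> * p 0 $ 1 < 0" if "- \<epsilon> * p 0 $ 2 = 0" using that pn by (auto simp: \<epsilon>_def split: if_splits)
  qed blast
  have m0: "cross3 (x 0) (p 0) = start_momentum \<epsilon> \<alpha> s \<kappa>"
    unfolding start_momentum_def s(4,5)[symmetric] x0 using \<epsilon>(1) p3
    by (auto simp: north_def vec3_simps)
  define v where "v = v_fun \<alpha> s"
  have v: "v > 0" using v_fun_ge_pi[OF \<alpha>, of s] s pi_gt_zero unfolding v_def by linarith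
  note arc = extremal_arc[OF xs ps u neg max]
  have arc0: "x t = rot (bang_axis \<alpha> \<epsilon>) t (x 0)" "p t = rot (bang_axis \<alpha> \<epsilon>) t (p 0)"
    if t: "0 \<le> t" "t \<le> s" "t \<le> T" for t
  proof -
    have init: "0 < \<epsilon> * cross3 (x 0) (p 0) $ 1 \<or>
       cross3 (x 0) (p 0) $ 1 = 0 \<and> \<epsilon> * (cos \<alpha> * cross3 (x 0) (p 0) $ 2) < 0"
    proof (cases "s = pi")
      case True
      have "\<epsilon> * (cos \<alpha> * cross3 (x 0) (p 0) $ 2) = cos \<alpha> * (\<kappa> * ((sin \<alpha>)\<^sup>2 - (cos \<alpha>)\<^sup>2))"
        using \<epsilon>(1) unfolding m0 by (auto simp: start_momentum_def vector_3 True)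
      also have "\<dots> < 0" using q s(3) by (simp add: mult_less_0_iff)
      finally show ?thesis unfolding m0 by (simp add: start_momentum_def vector_3 True)
    next
      case False
      then have "sin s > 0" using s by (intro sin_gt_zero) auto
      moreover have "\<epsilon> * cross3 (x 0) (p 0) $ 1 = \<kappa> * (cos \<alpha> * sin s)"
        using \<epsilon>(1) unfolding m0 by (auto simp: start_momentum_def vector_3)
      ultimately show ?thesis using q s by simp
    qed
    have pos: "0 < \<epsilon> * rot (bang_axis \<alpha> \<epsilon>) \<tau> (cross3 (x 0) (p 0)) $ 1" if "0 < \<tau>" "\<tau> < s" for \<tau>
      unfolding m0 by (rule first_arc_pos[OF \<alpha> \<epsilon>(2) s(1-3) that])
    from arc[of \<epsilon> 0 s t] show "x t = rot (bang_axis \<alpha> \<epsilon>) t (x 0)" "p t = rot (bang_axis \<alpha> \<epsilon>) t (p 0)"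
      using \<epsilon> T s(1) init pos t by auto
  qed
  \<comment> \<open>At a switch with momentum of sign \<open>\<sigma>\<close> the slope of the first
    component has sign \<open>- \<sigma>\<close>, so the next control is
    \<open>- \<sigma>\<close>.\<close>
  have arcj: "x t = rot (bang_axis \<alpha> (- \<sigma>)) (t - a) (x a) \<and> p t = rot (bang_axis \<alpha> (- \<sigma>)) (t - a) (p a)"
    if a: "0 \<le> a" "a \<le> t" "t \<le> a + v" "t \<le> T" and m: "cross3 (x a) (p a) = switch_momentum \<sigma> \<alpha> s \<kappa>"
      and \<sigma>: "\<bar>\<sigma>\<bar> = 1" for a t \<sigma>
  proof (cases "a < t")
    case True
    have "- \<sigma> * (cos \<alpha> * cross3 (x a) (p a) $ 2) = - (\<sigma> * \<sigma>) * (cos \<alpha> * (\<kappa> * ((sin \<alpha>)\<^sup>2 * cos s + (cos \<alpha>)\<^sup>2)))"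
      unfolding m by (simp add: switch_momentum_def vector_3)
    also have "\<dots> < 0" unfolding eps_sq[OF \<alpha> \<sigma> s(1-3)] using q s(3) switch_coeff_pos[OF \<alpha>, of s] by simp
    finally have init: "- \<sigma> * (cos \<alpha> * cross3 (x a) (p a) $ 2) < 0" "cross3 (x a) (p a) $ 1 = 0"
      unfolding m by (simp_all add: switch_momentum_def vector_3)
    have pos: "0 < - \<sigma> * rot (bang_axis \<alpha> (- \<sigma>)) \<tau> (cross3 (x a) (p a)) $ 1" if "0 < \<tau>" "\<tau> < v" for \<tau>
      unfolding m by (rule full_arc_pos[OF \<alpha> \<sigma> s(1-3) that[unfolded v_def]])
    from arc[of "- \<sigma>" a v t] show ?thesis using True a v init pos \<sigma> by auto
  qed (use a in auto)
  have sgn: "\<bar>\<epsilon> * (-1) ^ j\<bar> = 1" for j using \<epsilon>(2) by (simp add: abs_mult power_abs)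
  have step: "x (s + real j * v) = bang_point \<alpha> \<epsilon> s j \<and>
      cross3 (x (s + real j * v)) (p (s + real j * v)) = switch_momentum (\<epsilon> * (-1) ^ j) \<alpha> s \<kappa>"
    if "s + real j * v \<le> T" for j
    using that
  proof (induction j)
    case 0
    from arc0[of s] 0 s show ?case
      by (simp add: x0 rot_cross[OF norm_bang_axis[OF \<epsilon>(2)]] m0[unfolded x0] first_arc_end[OF \<alpha> \<epsilon>(2) s(1-3)])
  next
    case (Suc j)
    let ?a = "s + real j * v"
    have IH: "x ?a = bang_point \<alpha> \<epsilon> s j" "cross3 (x ?a) (p ?a) = switch_momentum (\<epsilon> * (-1) ^ j) \<alpha> s \<kappa>"
      using Suc v by (auto simp: algebra_simps)
    have e: "s + real (Suc j) * v - ?a = v" by (simp add: algebra_simps)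
    have a: "0 \<le> ?a" "?a \<le> s + real (Suc j) * v" "s + real (Suc j) * v \<le> ?a + v"
      using s v by (auto simp: algebra_simps)
    from arcj[OF a Suc.prems IH(2) sgn]
    have "x (s + real (Suc j) * v) = rot (bang_axis \<alpha> (- (\<epsilon> * (-1) ^ j))) v (bang_point \<alpha> \<epsilon> s j)"
      "p (s + real (Suc j) * v) = rot (bang_axis \<alpha> (- (\<epsilon> * (-1) ^ j))) v (p ?a)" unfolding e IH by auto
    moreover have "cross3 (bang_point \<alpha> \<epsilon> s j) (p ?a) = switch_momentum (\<epsilon> * (-1) ^ j) \<alpha> s \<kappa>"
      using IH by simp
    moreover have "\<bar>- (\<epsilon> * (-1) ^ j)\<bar> = 1" using sgn by simp
    ultimately show ?case
      by (simp add: rot_cross[OF norm_bang_axis] full_arc_end[OF \<alpha> sgn s(1-3)] v_def)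
  qed
  show ?thesis
  proof (rule that[OF \<epsilon>(1) s(1,2)])
    fix j assume j: "s + real j * v_fun \<alpha> s \<le> T" "T \<le> s + real (Suc j) * v_fun \<alpha> s"
    let ?a = "s + real j * v"
    have "0 \<le> ?a" using s v by auto
    moreover have "T \<le> ?a + v" using j(2) by (simp add: v_def algebra_simps)
    ultimately have "x T = rot (bang_axis \<alpha> (- (\<epsilon> * (-1) ^ j))) (T - ?a) (x ?a)"
      using arcj[of ?a T, OF _ _ _ _ step[THEN conjunct2] sgn] j(1) by (auto simp: v_def)
    then show "x T = rot (bang_axis \<alpha> (\<epsilon> * (-1) ^ Suc j)) (T - (s + real j * v_fun \<alpha> s)) (bang_point \<alpha> \<epsilon> s j)"
      using step[of j] j(1) by (simp add: v_def)
  qed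
qed

section \<open>Construction of extremals from bang arcs\<close>

lemma bang_sol_cong:
  assumes "\<And>t. t \<in> {a..b} \<Longrightarrow> u t = u' t" "\<And>t. t \<in> {a..b} \<Longrightarrow> y t = y' t" and "a \<le> b"
  shows "bang_sol \<alpha> a b u y \<longleftrightarrow> bang_sol \<alpha> a b u' y'"
  unfolding bang_sol_def using assms
  by (intro ball_cong refl) (auto intro!: has_integral_cong arg_cong2[where f="(-)"] 
      simp: has_integral_cong[of "{a.._}" "\<lambda>\<tau>. cross3 (bang_axis \<alpha> (u \<tau>)) (y \<tau>)" "\<lambda>\<tau>. cross3 (bang_axis \<alpha> (u' \<tau>)) (y' \<tau>)"])

text \<open>The maximum principle in a form suited to gluing: all pointwise conditions hold
  everywhere instead of almost everywhere, the control is Borel on the whole line, and the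
  Hamiltonian value is carried as the parameter \<open>\<mu>\<close>.\<close>

definition extremal_lift ::
    "real \<Rightarrow> real \<Rightarrow> real \<Rightarrow> (real \<Rightarrow> real) \<Rightarrow> (real \<Rightarrow> real^3) \<Rightarrow> (real \<Rightarrow> real^3) \<Rightarrow> bool" where
  "extremal_lift \<alpha> \<mu> T u x p \<longleftrightarrow> u \<in> borel_measurable borel \<and> (\<forall>t. \<bar>u t\<bar> \<le> 1) \<and>
     bang_sol \<alpha> 0 T u x \<and> bang_sol \<alpha> 0 T u p \<and> x 0 = north \<and>
     (\<forall>t\<in>{0..T}. p t \<noteq> 0 \<and> p t \<bullet> x t = 0 \<and> bang_axis \<alpha> (u t) \<bullet> cross3 (x t) (p t) = \<mu> \<and>
        (\<forall>w. \<bar>w\<bar> \<le> 1 \<longrightarrow> w * cross3 (x t) (p t) $ 1 \<le> u t * cross3 (x t) (p t) $ 1))"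

lemma mult_le_sign_mult:
  fixes z :: real
  assumes "\<bar>\<sigma>\<bar> = 1" "0 \<le> \<sigma> * z" "\<bar>w\<bar> \<le> 1" shows "w * z \<le> \<sigma> * z"
proof -
  have "w * z \<le> \<bar>w\<bar> * \<bar>z\<bar>" by (metis abs_ge_self abs_mult)
  also have "\<dots> \<le> 1 * \<bar>z\<bar>" using assms by (intro mult_right_mono) auto
  also have "\<dots> = \<bar>\<sigma> * z\<bar>" using assms by (simp add: abs_mult)
  finally show ?thesis using assms(2) by simp
qed

text \<open>The added arc rotates state, covector and momentum together. Lengths, orthogonality and
  the momentum along the axis are conserved, so the covector stays nonzero and the Hamiltonian keeps
  its value. The weak inequality in \<open>pos\<close> admits switching instants.\<close>

lemma extremal_lift_extend:
  assumes ext: "extremal_lift \<alpha> \<mu> a u x p" and ab: "0 \<le> a" "a \<le> b" and \<sigma>: "\<bar>\<sigma>\<bar> = 1"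
    and pos: "\<And>\<tau>. 0 < \<tau> \<Longrightarrow> \<tau> \<le> b - a \<Longrightarrow> 0 \<le> \<sigma> * rot (bang_axis \<alpha> \<sigma>) \<tau> (cross3 (x a) (p a)) $ 1"
    and \<mu>: "bang_axis \<alpha> \<sigma> \<bullet> cross3 (x a) (p a) = \<mu>"
  obtains u' x' p' where "extremal_lift \<alpha> \<mu> b u' x' p'"
    "x' b = rot (bang_axis \<alpha> \<sigma>) (b - a) (x a)" "p' b = rot (bang_axis \<alpha> \<sigma>) (b - a) (p a)"
proof -
  define u' where "u' t = (if t \<le> a then u t else \<sigma>)" for t
  define f where "f y t = (if t \<le> a then y t else rot (bang_axis \<alpha> \<sigma>) (t - a) (y a))" for y t
  note n = norm_bang_axis[OF \<sigma>, of \<alpha>]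
  have fa: "f y t = rot (bang_axis \<alpha> \<sigma>) (t - a) (y a)" if "a \<le> t" for y t
    using that by (cases "t = a") (auto simp: f_def)
  have sol: "bang_sol \<alpha> 0 b u' (f y)" if y: "bang_sol \<alpha> 0 a u y" for y
  proof (rule bang_sol_combine[OF _ _ ab(1)])
    show "bang_sol \<alpha> 0 a u' (f y)"
      using y by (rule bang_sol_cong[THEN iffD1, rotated 3]) (use ab in \<open>auto simp: u'_def f_def\<close>)
    have "bang_sol \<alpha> a b u' (\<lambda>t. rot (bang_axis \<alpha> \<sigma>) (t - a) (y a))"
      by (rule bang_sol_rot[of "{}"]) (use \<sigma> in \<open>auto simp: u'_def\<close>)
    then show "bang_sol \<alpha> a b u' (f y)"
      by (rule bang_sol_cong[THEN iffD1, rotated 3]) (use ab fa in auto)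
  qed
  have old: "p a \<noteq> 0" "p a \<bullet> x a = 0" using ext ab unfolding extremal_lift_def by auto
  have "extremal_lift \<alpha> \<mu> b u' (f x) (f p)"
    unfolding extremal_lift_def
  proof (intro conjI ballI)
    have "u \<in> borel_measurable borel" using ext by (simp add: extremal_lift_def)
    then show "u' \<in> borel_measurable borel" unfolding u'_def by (intro measurable_If) auto
    show "\<forall>t. \<bar>u' t\<bar> \<le> 1" using ext \<sigma> by (auto simp: extremal_lift_def u'_def)
    show "bang_sol \<alpha> 0 b u' (f x)" "bang_sol \<alpha> 0 b u' (f p)" using ext sol by (auto simp: extremal_lift_def)
    show "f x 0 = north" using ext ab by (simp add: extremal_lift_def f_def)
    fix t assume t: "t \<in> {0..b}"
    have "f p t \<noteq> 0 \<and> f p t \<bullet> f x t = 0 \<and> bang_axis \<alpha> (u' t) \<bullet> cross3 (f x t) (f p t) = \<mu> \<and>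
        (\<forall>w. \<bar>w\<bar> \<le> 1 \<longrightarrow> w * cross3 (f x t) (f p t) $ 1 \<le> u' t * cross3 (f x t) (f p t) $ 1)"
    proof (cases "t \<le> a")
      case True then show ?thesis using ext t by (auto simp: extremal_lift_def f_def u'_def)
    next
      case False
      then have m: "cross3 (f x t) (f p t) = rot (bang_axis \<alpha> \<sigma>) (t - a) (cross3 (x a) (p a))"
        using fa[of t] by (simp add: rot_cross[OF n])
      have "f p t \<bullet> f p t = p a \<bullet> p a" "f p t \<bullet> f x t = 0" using fa[of t] False old by (simp_all add: rot_inner[OF n])
      moreover have "bang_axis \<alpha> (u' t) \<bullet> cross3 (f x t) (f p t) = \<mu>"
        using False \<mu> unfolding m by (simp add: u'_def rot_axis_inner[OF n])
      moreover have "w * cross3 (f x t) (f p t) $ 1 \<le> u' t * cross3 (f x t) (f p t) $ 1" if "\<bar>w\<bar> \<le> 1" for w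
        using mult_le_sign_mult[OF \<sigma> pos that, of "t - a"] False t unfolding m by (simp add: u'_def)
      ultimately show ?thesis using old by auto
    qed
    then show "f p t \<noteq> 0" "f p t \<bullet> f x t = 0" "bang_axis \<alpha> (u' t) \<bullet> cross3 (f x t) (f p t) = \<mu>"
      "\<forall>w. \<bar>w\<bar> \<le> 1 \<longrightarrow> w * cross3 (f x t) (f p t) $ 1 \<le> u' t * cross3 (f x t) (f p t) $ 1" by auto
  qed
  then show ?thesis using fa[OF ab(2)] by (intro that[of u' "f x" "f p"]) auto
qed

lemma extremal_lift_front:
  assumes ext: "extremal_lift \<alpha> \<mu> T u x p" and \<mu>: "\<mu> \<ge> 0" and \<alpha>: "0 < \<alpha>" "\<alpha> < pi / 4"
  shows "x T \<in> extremal_front \<alpha> T"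
proof -
  have "u \<in> borel_measurable lebesgue" using ext by (simp add: extremal_lift_def measurable_completion)
  then have "admissible_control T u"
    using ext by (auto simp: admissible_control_def extremal_lift_def intro: measurable_restrict_space1)
  moreover have "trajectory \<alpha> T u x"
    using ext by (auto simp: trajectory_def extremal_lift_def bang_sol_def control_matrix_cross)
  moreover have "satisfies_PMP \<alpha> T u x"
    unfolding satisfies_PMP_def
  proof (intro exI[of _ p] exI[of _ \<mu>] conjI \<mu>)
    show "\<forall>t\<in>{0..T}. p t \<noteq> 0 \<and> p t \<bullet> x t = 0" using ext by (auto simp: extremal_lift_def)
    show "\<forall>t\<in>{0..T}. ((\<lambda>\<tau>. - (transpose (control_matrix \<alpha> (u \<tau>)) *v p \<tau>)) has_integral (p t - p 0)) {0..t}"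
      using ext unfolding control_matrix_transpose_cross by (auto simp: extremal_lift_def bang_sol_def)
    have sa: "sin \<alpha> > 0" using sin_cos_quarter[OF \<alpha>] by simp
    show "AE t in lebesgue_on {0..T}. \<forall>w\<in>{-1..1}. hamiltonian \<alpha> (p t) (x t) w \<le> hamiltonian \<alpha> (p t) (x t) (u t)"
    proof (rule AE_I2, intro ballI)
      fix t w assume t: "t \<in> space (lebesgue_on {0..T})" and w: "w \<in> {-1..1::real}"
      have "w * cross3 (x t) (p t) $ 1 \<le> u t * cross3 (x t) (p t) $ 1"
        using ext t w by (auto simp: extremal_lift_def)
      from mult_left_mono[OF this, of "sin \<alpha>"] sa
      show "hamiltonian \<alpha> (p t) (x t) w \<le> hamiltonian \<alpha> (p t) (x t) (u t)"
        by (simp add: hamiltonian_eq mult_ac)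
    qed
    show "AE t in lebesgue_on {0..T}. hamiltonian \<alpha> (p t) (x t) (u t) = \<mu>"
      by (rule AE_I2) (use ext in \<open>auto simp: extremal_lift_def hamiltonian_eq bang_axis_inner\<close>)
  qed
  ultimately show ?thesis unfolding extremal_front_def by blast
qed

text \<open>Converse of \<open>PMP_bang_bang\<close>: a covector with the prescribed momentum at
  \<open>north\<close> is chosen, and the arcs are appended one at a time.\<close>

lemma bang_bang_extremal:
  assumes \<alpha>: "0 < \<alpha>" "\<alpha> < pi / 4" and \<epsilon>: "\<bar>\<epsilon>\<bar> = 1" and s: "0 < s" "s \<le> pi"
    and T: "s + real j * v_fun \<alpha> s \<le> T" "T \<le> s + real (Suc j) * v_fun \<alpha> s"
  shows "rot (bang_axis \<alpha> (\<epsilon> * (-1) ^ Suc j)) (T - (s + real j * v_fun \<alpha> s)) (bang_point \<alpha> \<epsilon> s j)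
    \<in> extremal_front \<alpha> T"
proof -
  note q = sin_cos_quarter[OF \<alpha>]
  define v where "v = v_fun \<alpha> s"
  have v: "v > 0" using v_fun_ge_pi[OF \<alpha>, of s] s pi_gt_zero unfolding v_def by linarith
  define \<mu> where "\<mu> = sin \<alpha> * cos \<alpha> * sin s"
  have \<mu>0: "\<mu> \<ge> 0" using q sin_ge_zero[of s] s by (simp add: \<mu>_def)
  have sgn: "\<bar>\<epsilon> * (-1) ^ j\<bar> = 1" for j using \<epsilon> by (simp add: abs_mult power_abs)
  have sw: "bang_axis \<alpha> \<sigma> \<bullet> switch_momentum \<sigma>' \<alpha> s 1 = \<mu>" for \<sigma> \<sigma>'
    by (simp add: bang_axis_inner switch_momentum_def vector_3 \<mu>_def)
  have full: "0 \<le> - \<sigma> * rot (bang_axis \<alpha> (- \<sigma>)) \<tau> (switch_momentum \<sigma> \<alpha> s 1) $ 1"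
    if \<sigma>: "\<bar>\<sigma>\<bar> = 1" and "0 < \<tau>" "\<tau> \<le> v" for \<sigma> \<tau>
  proof (cases "\<tau> = v")
    case True
    then show ?thesis unfolding v_def using full_arc_end[OF \<alpha> \<sigma> s, of 1]
      by (simp add: switch_momentum_def vector_3)
  next
    case False
    then show ?thesis using full_arc_pos[OF \<alpha> \<sigma> s, of 1 \<tau>] that by (simp add: v_def)
  qed
  have step: "\<exists>u x p. extremal_lift \<alpha> \<mu> (s + real j * v) u x p \<and> x (s + real j * v) = bang_point \<alpha> \<epsilon> s j \<and>
      cross3 (x (s + real j * v)) (p (s + real j * v)) = switch_momentum (\<epsilon> * (-1) ^ j) \<alpha> s 1" for j
  proof (induction j)
    case 0
    define p0 :: "real^3" where "p0 = vector [\<epsilon> * ((sin \<alpha>)\<^sup>2 + (cos \<alpha>)\<^sup>2 * cos s), - \<epsilon> * (cos \<alpha> * sin s), 0]"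
    have m: "cross3 north p0 = start_momentum \<epsilon> \<alpha> s 1"
      by (simp add: north_def p0_def start_momentum_def vec3_simps)
    have e: "\<epsilon> * (\<epsilon> * z) = z" for z using eps_sq[OF \<alpha> \<epsilon> s, of 1] by simp
    have "p0 \<noteq> 0"
    proof (cases "s = pi")
      case True
      then show ?thesis using q \<epsilon> by (auto simp: p0_def vec_eq_iff forall_3 vector_3)
    next
      case False
      then have "sin s > 0" using s by (intro sin_gt_zero) auto
      then show ?thesis using q \<epsilon> by (auto simp: p0_def vec_eq_iff forall_3 vector_3)
    qed
    moreover have \<mu>': "bang_axis \<alpha> \<epsilon> \<bullet> cross3 north p0 = \<mu>"
      unfolding m by (simp add: bang_axis_inner start_momentum_def vector_3 \<mu>_def e mult_ac)
    moreover have "w * cross3 north p0 $ 1 \<le> \<epsilon> * cross3 north p0 $ 1" if "\<bar>w\<bar> \<le> 1" for w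
      by (rule mult_le_sign_mult[OF \<epsilon> _ that])
         (use q s in \<open>simp add: m start_momentum_def vector_3 e sin_ge_zero\<close>)
    moreover have "p0 \<bullet> north = 0" by (simp add: north_def p0_def vec3_simps)
    ultimately have "extremal_lift \<alpha> \<mu> 0 (\<lambda>_. \<epsilon>) (\<lambda>_. north) (\<lambda>_. p0)"
      using \<epsilon> unfolding extremal_lift_def by (auto simp: bang_sol_def)
    then obtain u x p where "extremal_lift \<alpha> \<mu> s u x p" "x s = rot (bang_axis \<alpha> \<epsilon>) (s - 0) north"
      "p s = rot (bang_axis \<alpha> \<epsilon>) (s - 0) p0"
    proof (rule extremal_lift_extend[where b=s and \<sigma>=\<epsilon>])
      fix \<tau> assume t: "0 < \<tau>" "\<tau> \<le> s - 0"
      show "0 \<le> \<epsilon> * rot (bang_axis \<alpha> \<epsilon>) \<tau> (cross3 north p0) $ 1"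
      proof (cases "\<tau> = s")
        case True then show ?thesis unfolding m first_arc_component[OF \<alpha> \<epsilon> s zero_less_one] by simp
      next
        case False
        then show ?thesis using first_arc_pos[OF \<alpha> \<epsilon> s, of 1 \<tau>] t by (simp add: m)
      qed
    qed (use s \<epsilon> \<mu>' in auto)
    then show ?case
      by (intro exI[of _ u] exI[of _ x] exI[of _ p])
         (simp add: rot_cross[OF norm_bang_axis[OF \<epsilon>]] m first_arc_end[OF \<alpha> \<epsilon> s])
  next
    case (Suc j)
    let ?a = "s + real j * v" and ?\<sigma> = "\<epsilon> * (-1) ^ j"
    obtain u x p where IH: "extremal_lift \<alpha> \<mu> ?a u x p" "x ?a = bang_point \<alpha> \<epsilon> s j"
      "cross3 (x ?a) (p ?a) = switch_momentum ?\<sigma> \<alpha> s 1" using Suc by blast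
    have e: "s + real (Suc j) * v - ?a = v" by (simp add: algebra_simps)
    have n: "\<bar>- ?\<sigma>\<bar> = 1" using sgn by simp
    from IH(1) obtain u' x' p' where *: "extremal_lift \<alpha> \<mu> (s + real (Suc j) * v) u' x' p'"
      "x' (s + real (Suc j) * v) = rot (bang_axis \<alpha> (- ?\<sigma>)) (s + real (Suc j) * v - ?a) (x ?a)"
      "p' (s + real (Suc j) * v) = rot (bang_axis \<alpha> (- ?\<sigma>)) (s + real (Suc j) * v - ?a) (p ?a)"
    proof (rule extremal_lift_extend[where b="s + real (Suc j) * v" and \<sigma>="- ?\<sigma>"])
      show "0 \<le> - ?\<sigma> * rot (bang_axis \<alpha> (- ?\<sigma>)) \<tau> (cross3 (x ?a) (p ?a)) $ 1"
        if "0 < \<tau>" "\<tau> \<le> s + real (Suc j) * v - ?a" for \<tau>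
        using full[OF sgn that(1) that(2)[unfolded e]] unfolding IH(3) .
      show "bang_axis \<alpha> (- ?\<sigma>) \<bullet> cross3 (x ?a) (p ?a) = \<mu>" unfolding IH(3) by (rule sw)
      show "0 \<le> ?a" "?a \<le> s + real (Suc j) * v" using s v by (auto simp: algebra_simps)
    qed (use n in auto)
    have "cross3 (x' (s + real (Suc j) * v)) (p' (s + real (Suc j) * v)) = switch_momentum (- ?\<sigma>) \<alpha> s 1"
      unfolding *(2,3) e rot_cross[OF norm_bang_axis[OF n]] IH(3)
      by (rule full_arc_end[OF \<alpha> sgn s zero_less_one, folded v_def])
    moreover have "x' (s + real (Suc j) * v) = bang_point \<alpha> \<epsilon> s (Suc j)"
      unfolding *(2) e IH(2) by (simp add: v_def)
    moreover have "- ?\<sigma> = \<epsilon> * (-1) ^ Suc j" by simp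
    ultimately have "extremal_lift \<alpha> \<mu> (s + real (Suc j) * v) u' x' p' \<and>
       x' (s + real (Suc j) * v) = bang_point \<alpha> \<epsilon> s (Suc j) \<and>
       cross3 (x' (s + real (Suc j) * v)) (p' (s + real (Suc j) * v)) = switch_momentum (\<epsilon> * (-1) ^ Suc j) \<alpha> s 1"
      using *(1) by metis
    then show ?case by blast
  qed
  let ?a = "s + real j * v" and ?\<sigma> = "\<epsilon> * (-1) ^ j"
  obtain u x p where IH: "extremal_lift \<alpha> \<mu> ?a u x p" "x ?a = bang_point \<alpha> \<epsilon> s j"
      "cross3 (x ?a) (p ?a) = switch_momentum ?\<sigma> \<alpha> s 1" using step by blast
  have n: "\<bar>- ?\<sigma>\<bar> = 1" using sgn by simp
  have Tv: "T - ?a \<le> v" using T(2) by (simp add: v_def algebra_simps)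
  from IH(1) obtain u' x' p' where *: "extremal_lift \<alpha> \<mu> T u' x' p'"
    "x' T = rot (bang_axis \<alpha> (- ?\<sigma>)) (T - ?a) (x ?a)"
  proof (rule extremal_lift_extend[where b=T and \<sigma>="- ?\<sigma>"])
    show "0 \<le> - ?\<sigma> * rot (bang_axis \<alpha> (- ?\<sigma>)) \<tau> (cross3 (x ?a) (p ?a)) $ 1"
      if "0 < \<tau>" "\<tau> \<le> T - ?a" for \<tau>
      using full[OF sgn that(1)] that(2) Tv unfolding IH(3) by simp
    show "bang_axis \<alpha> (- ?\<sigma>) \<bullet> cross3 (x ?a) (p ?a) = \<mu>" unfolding IH(3) by (rule sw)
    show "0 \<le> ?a" "?a \<le> T" using s v T(1) by (auto simp: v_def)
  qed (use n in auto)
  from extremal_lift_front[OF *(1) \<mu>0 \<alpha>] show ?thesis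
    unfolding *(2) IH(2) by (simp add: v_def)
qed

section \<open>The extremal front\<close>

lemma rot_half: "norm w = 1 \<Longrightarrow> rot w t y = y + (2 * sin (t/2) * cos (t/2)) *\<^sub>R cross3 w y + (2 * (sin (t/2))\<^sup>2) *\<^sub>R cross3 w (cross3 w y)"
  using rot_alt[of w t y] sin_double[of "t/2"] cos_double_sin[of "t/2"] by simp

text \<open>Rotation by the angle \<open>t\<close> written in \<open>a = sin (t / 2)\<close> and \<open>b = cos (t / 2)\<close>, so that the
  product of two rotations becomes a polynomial identity.\<close>

definition half_rot :: "real \<Rightarrow> real \<Rightarrow> real^3 \<Rightarrow> real^3 \<Rightarrow> real^3" where
  "half_rot a b w y = y + (2 * a * b) *\<^sub>R cross3 w y + (2 * a\<^sup>2) *\<^sub>R cross3 w (cross3 w y)"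

text \<open>The axis on the right is the unnormalized axis of the composed rotation, so no square
  root occurs. Componentwise this is a polynomial identity modulo the two Pythagorean relations and
  \<open>\<epsilon> * \<epsilon> = 1\<close>.\<close>

lemma half_rot_product:
  fixes a b S C :: real
  assumes "a\<^sup>2 + b\<^sup>2 = 1" "S\<^sup>2 + C\<^sup>2 = 1" and e: "\<epsilon> = 1 \<or> \<epsilon> = -1"
  shows "half_rot a b (vector [\<epsilon> * S, 0, C]) (half_rot a b (vector [- \<epsilon> * S, 0, C]) y)
    = y + (4 * a * C * (2 * a\<^sup>2 * C\<^sup>2 - 1)) *\<^sub>R cross3 (vector [0, \<epsilon> * S * a, - b]) y
        + (8 * a\<^sup>2 * C\<^sup>2) *\<^sub>R cross3 (vector [0, \<epsilon> * S * a, - b]) (cross3 (vector [0, \<epsilon> * S * a, - b]) y)"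
proof -
  have b: "b * b = 1 - a * a" and C: "C * C = 1 - S * S" using assms(1,2) by (simp_all add: power2_eq_square algebra_simps)
  have e2: "\<epsilon> * \<epsilon> = 1" using e by auto
  show ?thesis
    unfolding half_rot_def vec_eq_iff forall_3 cross3_def vector_add_component vector_scaleR_component vector_3 power2_eq_square real_scaleR_def
    by (intro conjI; use b C e2 in algebra)
qed

lemma mid_axis_denominator_pos:
  fixes \<alpha> t :: real
  assumes "sin \<alpha> \<noteq> 0"
  shows "0 < (sin (t / 2))\<^sup>2 * (sin \<alpha>)\<^sup>2 + (cos (t / 2))\<^sup>2"
proof (cases "sin (t / 2) = 0")
  case True
  then show ?thesis using sin_cos_squared_add[of "t / 2"] by simp
next
  case False
  then show ?thesis using assms by (simp add: add_pos_nonneg)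
qed

lemma norm_mid_axis:
  assumes "sin \<alpha> \<noteq> 0" "\<bar>\<epsilon>\<bar> = 1"
  shows "norm (mid_axis \<epsilon> \<alpha> t) = 1"
proof -
  define D where "D = (sin (t / 2))\<^sup>2 * (sin \<alpha>)\<^sup>2 + (cos (t / 2))\<^sup>2"
  have D: "D > 0" unfolding D_def by (rule mid_axis_denominator_pos[OF assms(1)])
  have e: "\<epsilon>\<^sup>2 = 1" using assms(2) by (simp add: abs_square_eq_1)
  have "mid_axis \<epsilon> \<alpha> t \<bullet> mid_axis \<epsilon> \<alpha> t = (B_fun \<alpha> t)\<^sup>2 + (C_fun \<alpha> t)\<^sup>2"
    using e by (simp add: mid_axis_def vec3_simps power2_eq_square algebra_simps)
  moreover have "(B_fun \<alpha> t)\<^sup>2 = (sin (t / 2))\<^sup>2 * (sin \<alpha>)\<^sup>2 / D" "(C_fun \<alpha> t)\<^sup>2 = (cos (t / 2))\<^sup>2 / D"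
    unfolding B_fun_def C_fun_def D_def[symmetric] using D
    by (simp_all add: power_divide power_mult_distrib mult.commute)
  moreover have "(sin (t / 2))\<^sup>2 * (sin \<alpha>)\<^sup>2 / D + (cos (t / 2))\<^sup>2 / D = 1"
    using D unfolding add_divide_distrib[symmetric] by (simp add: D_def[symmetric])
  ultimately show ?thesis by (simp add: norm_eq_sqrt_inner)
qed

lemma chi_formula_rot:
  assumes "sin \<alpha> \<noteq> 0" "\<bar>\<epsilon>\<bar> = 1"
  shows "chi_formula \<epsilon> \<alpha> r s = rot (bang_axis \<alpha> (- \<epsilon>)) (psi_fun \<alpha> r s)
     (rot (mid_axis (- \<epsilon>) \<alpha> (v_fun \<alpha> s)) (theta_fun \<alpha> r s) (rot (bang_axis \<alpha> \<epsilon>) s north))"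
  unfolding chi_formula_def using assms
  by (simp add: mat_exp_rot[OF X_mat_cross norm_bang_axis] mat_exp_rot[OF Z_mat_cross norm_mid_axis])

text \<open>With \<open>c\<close> and \<open>2 * a * C * q\<close> as cosine and sine of half the
  angle \<open>Theta_fun \<alpha> t\<close>, the double-angle formulas produce the coefficients of
  \<open>half_rot_product\<close>, the powers of \<open>q\<close> normalizing the axis. The range of
  \<open>t\<close> makes \<open>a\<close> positive, which fixes the sign of the sine.\<close>

lemma bang_pair:
  assumes \<alpha>: "0 < \<alpha>" "\<alpha> < pi / 4" and \<epsilon>: "\<bar>\<epsilon>\<bar> = 1" and t: "0 < t" "t < 2 * pi"
  shows "rot (bang_axis \<alpha> \<epsilon>) t (rot (bang_axis \<alpha> (- \<epsilon>)) t y) = rot (mid_axis (- \<epsilon>) \<alpha> t) (Theta_fun \<alpha> t) y"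
proof -
  define a b S C where "a = sin (t / 2)" "b = cos (t / 2)" "S = sin \<alpha>" "C = cos \<alpha>"
  note defs = this
  have a: "a > 0" unfolding defs using t by (intro sin_gt_zero) auto
  have SC: "S > 0" "C > 0" using sin_cos_quarter[OF \<alpha>] by (auto simp: defs)
  have ab: "a\<^sup>2 + b\<^sup>2 = 1" "S\<^sup>2 + C\<^sup>2 = 1" by (simp_all add: defs)
  define q where "q = sqrt (a\<^sup>2 * S\<^sup>2 + b\<^sup>2)"
  have q2: "q\<^sup>2 = a\<^sup>2 * S\<^sup>2 + b\<^sup>2" and q: "q > 0"
    using mid_axis_denominator_pos[of \<alpha> t] SC by (auto simp: q_def defs)
  have q2': "q\<^sup>2 = 1 - a\<^sup>2 * C\<^sup>2" using ab unfolding q2 by algebra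
  define V where "V = (vector [0, \<epsilon> * S * a, - b] :: real^3)"
  have Z: "mid_axis (- \<epsilon>) \<alpha> t = (1 / q) *\<^sub>R V"
    by (simp add: mid_axis_def B_fun_def C_fun_def V_def q_def defs vec_eq_iff forall_3 vector_3)
  define c where "c = 2 * a\<^sup>2 * C\<^sup>2 - 1"
  have c: "a\<^sup>2 * cos (2 * \<alpha>) - b\<^sup>2 = c"
    unfolding cos_double defs(3)[symmetric] defs(4)[symmetric] c_def using ab by algebra
  have sq: "1 - c\<^sup>2 = (2 * a * C * q)\<^sup>2"
    unfolding power_mult_distrib q2' c_def by (simp add: power2_eq_square algebra_simps)
  then have "c\<^sup>2 \<le> 1" by (metis diff_ge_0_iff_ge zero_le_power2)
  then have c1: "- 1 \<le> c" "c \<le> 1" by (auto simp: abs_square_le_1 abs_le_iff)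
  have T: "Theta_fun \<alpha> t = 2 * arccos c" by (simp add: Theta_fun_def c[symmetric] defs)
  have cosT: "cos (arccos c) = c" using c1 by simp
  have sinT: "sin (arccos c) = 2 * a * C * q"
    using sin_arccos[OF c1] a SC q unfolding sq by simp
  have s2: "sin (Theta_fun \<alpha> t) = q * (4 * a * C * c)" unfolding T sin_double cosT sinT by simp
  have c2: "1 - cos (Theta_fun \<alpha> t) = q\<^sup>2 * (8 * a\<^sup>2 * C\<^sup>2)"
    unfolding T cos_double_sin sinT by (simp add: power_mult_distrib)
  have nz: "norm (mid_axis (- \<epsilon>) \<alpha> t) = 1" using SC \<epsilon> by (intro norm_mid_axis) (auto simp: defs)
  have "rot (mid_axis (- \<epsilon>) \<alpha> t) (Theta_fun \<alpha> t) y
     = y + (4 * a * C * c) *\<^sub>R cross3 V y + (8 * a\<^sup>2 * C\<^sup>2) *\<^sub>R cross3 V (cross3 V y)"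
    unfolding rot_alt[OF nz] s2 c2 unfolding Z cross_mult_left cross_mult_right using q
    by (simp add: power2_eq_square)
  also have "\<dots> = half_rot a b (vector [\<epsilon> * S, 0, C]) (half_rot a b (vector [- \<epsilon> * S, 0, C]) y)"
    unfolding V_def c_def by (rule half_rot_product[symmetric, OF ab]) (use \<epsilon> in \<open>auto simp: abs_if split: if_splits\<close>)
  also have "\<dots> = rot (bang_axis \<alpha> \<epsilon>) t (rot (bang_axis \<alpha> (- \<epsilon>)) t y)"
  proof -
    have "half_rot a b (vector [e * S, 0, C]) z = rot (bang_axis \<alpha> e) t z" if "\<bar>e\<bar> = 1" for e z
      unfolding rot_half[OF norm_bang_axis[OF that]] half_rot_def by (simp add: bang_axis_def defs)
    from this[of \<epsilon>] this[of "- \<epsilon>"] show ?thesis using \<epsilon> by simp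
  qed
  finally show ?thesis ..
qed

lemma v_fun_ends [simp]: "v_fun \<alpha> 0 = pi" "v_fun \<alpha> pi = pi"
  by (simp_all add: v_fun_def)

lemma v_fun_less: "v_fun \<alpha> s < 2 * pi"
  using arctan_ubound[of "sin s / (cos s + (cot \<alpha>)\<^sup>2)"] by (simp add: v_fun_def)

lemma bang_pair_power:
  assumes "0 < \<alpha>" "\<alpha> < pi / 4" "\<bar>\<epsilon>\<bar> = 1" "0 < t" "t < 2 * pi"
  shows "((\<lambda>y. rot (bang_axis \<alpha> \<epsilon>) t (rot (bang_axis \<alpha> (- \<epsilon>)) t y)) ^^ i) y
    = rot (mid_axis (- \<epsilon>) \<alpha> t) (real i * Theta_fun \<alpha> t) y"
proof -
  have n: "norm (mid_axis (- \<epsilon>) \<alpha> t) = 1"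
    using assms sin_cos_quarter[OF assms(1,2)] by (intro norm_mid_axis) auto
  show ?thesis
    unfolding bang_pair[OF assms]
  proof (induction i)
    case (Suc i)
    have "real (Suc i) * Theta_fun \<alpha> t = Theta_fun \<alpha> t + real i * Theta_fun \<alpha> t" by (simp add: algebra_simps)
    then show ?case by (simp add: Suc rot_add[OF n])
  qed simp
qed

lemma bang_point_even:
  assumes \<alpha>: "0 < \<alpha>" "\<alpha> < pi / 4" and \<epsilon>: "\<bar>\<epsilon>\<bar> = 1" and s: "0 \<le> s" "s \<le> pi"
  shows "bang_point \<alpha> \<epsilon> s (2 * i) = rot (mid_axis (- \<epsilon>) \<alpha> (v_fun \<alpha> s)) (real i * Theta_fun \<alpha> (v_fun \<alpha> s))
     (rot (bang_axis \<alpha> \<epsilon>) s north)"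
proof -
  have v: "0 < v_fun \<alpha> s" using v_fun_ge_pi[OF \<alpha> s] pi_gt_zero by linarith
  show ?thesis
    unfolding bang_pair_power[OF \<alpha> \<epsilon> v v_fun_less, symmetric]
    by (induction i) simp_all
qed

lemma odd_k_M:
  assumes "0 < \<alpha>" "odd (k_M \<alpha>)"
  obtains i :: nat where "of_int (k_M \<alpha>) = 2 * real i + 1" "2 * real i + 1 \<le> pi / (2 * \<alpha>)"
    "r_M \<alpha> = pi / (2 * \<alpha>) - (2 * real i + 1)"
proof -
  have "0 \<le> k_M \<alpha>" using assms(1) by (simp add: k_M_def)
  then have "odd (nat (k_M \<alpha>))" using assms(2) by (simp add: even_nat_iff)
  then obtain i where "nat (k_M \<alpha>) = 2 * i + 1" by (elim oddE)
  then have "k_M \<alpha> = 2 * int i + 1" using \<open>0 \<le> k_M \<alpha>\<close> by linarith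
  then have "real_of_int (k_M \<alpha>) = 2 * real i + 1" by simp
  moreover have "real_of_int (k_M \<alpha>) \<le> pi / (2 * \<alpha>)" by (simp add: k_M_def)
  ultimately show ?thesis by (intro that[of i]) (auto simp: r_M_def)
qed

text \<open>At this value of \<open>r\<close> the two factors in the angles become the integers
  \<open>2 * i + 1\<close> and \<open>i\<close>: the middle rotation is \<open>i\<close> pairs of
  full arcs, and the last angle is the time left after the first arc and \<open>2 * i\<close> full
  ones.\<close>

lemma psi_theta_r_M:
  assumes "\<alpha> \<noteq> 0" "r = pi / (2 * \<alpha>) - (2 * real i + 1)"
  shows "psi_fun \<alpha> r s = (2 * real i + 1) * pi - (s + real (2 * i) * v_fun \<alpha> s)"
    "theta_fun \<alpha> r s = real i * Theta_fun \<alpha> (v_fun \<alpha> s)"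
proof -
  have "pi / (2 * \<alpha>) - r = 2 * real i + 1" "pi / (4 * \<alpha>) - (1 + r) / 2 = real i"
    using assms by (simp_all add: field_simps)
  then show "psi_fun \<alpha> r s = (2 * real i + 1) * pi - (s + real (2 * i) * v_fun \<alpha> s)"
    "theta_fun \<alpha> r s = real i * Theta_fun \<alpha> (v_fun \<alpha> s)"
    unfolding psi_fun_def theta_fun_def by (simp_all only:) (simp add: algebra_simps)
qed

text \<open>The final time falls in the same arc for every \<open>s\<close>. With
  \<open>v = pi + 2 * A\<close> the first bound says \<open>4 * i * A \<le> pi - s\<close>. Here
  \<open>A \<le> tan A\<close>, the numerator of \<open>tan A\<close> is at most
  \<open>(pi - s) * \<alpha>\<^sup>2\<close>, its denominator is at least
  \<open>1 - 2 * \<alpha>\<^sup>2\<close>, hence at least 7/8, and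
  \<open>4 * i \<le> pi / \<alpha>\<close>; what remains is
  \<open>8 / 7 * pi * \<alpha> \<le> 1\<close>, which \<open>\<alpha> < 1 / 4\<close> provides. The
  second bound is immediate from \<open>v \<ge> pi\<close>.\<close>

lemma last_arc_bounds:
  assumes \<alpha>: "0 < \<alpha>" "\<alpha> < 1 / 4" and i: "2 * real i + 1 \<le> pi / (2 * \<alpha>)" and s: "0 \<le> s" "s \<le> pi"
  shows "s + real (2 * i) * v_fun \<alpha> s \<le> (2 * real i + 1) * pi"
    "(2 * real i + 1) * pi \<le> s + real (Suc (2 * i)) * v_fun \<alpha> s"
proof -
  have \<alpha>': "\<alpha> < pi / 4" using \<alpha> pi_gt3 by simp
  obtain A where A: "v_fun \<alpha> s = pi + 2 * A" "0 \<le> A" "A < pi / 2"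
    "sin A * ((sin \<alpha>)\<^sup>2 * cos s + (cos \<alpha>)\<^sup>2) = cos A * (sin s * (sin \<alpha>)\<^sup>2)"
    using v_fun_arctan[OF \<alpha>(1) \<alpha>' s] by auto
  define q where "q = (sin \<alpha>)\<^sup>2 * cos s + (cos \<alpha>)\<^sup>2"
  have sa: "(sin \<alpha>)\<^sup>2 \<le> \<alpha>\<^sup>2" using abs_sin_x_le_abs_x[of \<alpha>] by (metis abs_le_square_iff)
  have "\<alpha>\<^sup>2 \<le> (1/4)\<^sup>2" using \<alpha> by (intro power_mono) auto
  then have a2: "\<alpha>\<^sup>2 \<le> 1 / 16" by (simp add: power2_eq_square)
  have "(sin \<alpha>)\<^sup>2 * (-1) \<le> (sin \<alpha>)\<^sup>2 * cos s" by (intro mult_left_mono) auto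
  then have q: "7 / 8 \<le> q" unfolding q_def cos_squared_eq using sa a2 by simp
  have cA: "cos A > 0" using A by (intro cos_gt_zero_pi) auto
  have "tan A = sin s * (sin \<alpha>)\<^sup>2 / q" using A(4) cA q unfolding q_def[symmetric] tan_def by (simp add: field_simps)
  moreover have "A \<le> tan A"
  proof (cases "A = 0")
    case False
    then have "arctan (tan A) \<le> tan A" using A arctan_le_self[of "tan A"] by (simp add: tan_pos_pi2_le)
    then show ?thesis using A by (simp add: arctan_tan)
  qed simp
  moreover have "sin s \<le> pi - s"
    using sin_x_le_x[of "pi - s"] s by simp
  moreover have "sin s * (sin \<alpha>)\<^sup>2 / q \<le> (pi - s) * \<alpha>\<^sup>2 / (7 / 8)"
    if "sin s \<le> pi - s"
  proof (rule frac_le[OF _ _ _ q])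
    show "sin s * (sin \<alpha>)\<^sup>2 \<le> (pi - s) * \<alpha>\<^sup>2"
      using that sa s by (intro mult_mono) auto
  qed (use s in auto)
  ultimately have "A \<le> (pi - s) * \<alpha>\<^sup>2 / (7 / 8)" by linarith
  then have "4 * real i * A \<le> 4 * real i * ((pi - s) * \<alpha>\<^sup>2 / (7 / 8))" by (intro mult_left_mono) auto
  also have "\<dots> \<le> (pi / \<alpha>) * ((pi - s) * \<alpha>\<^sup>2 / (7 / 8))"
  proof (rule mult_right_mono)
    have "4 * real i \<le> 2 * (pi / (2 * \<alpha>))" using i by linarith
    then show "4 * real i \<le> pi / \<alpha>" by simp
  qed (use s in simp)
  also have "\<dots> = (pi - s) * (8 / 7 * pi * \<alpha>)" using \<alpha> by (simp add: power2_eq_square field_simps)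
  also have "\<dots> \<le> (pi - s) * 1"
  proof (rule mult_left_mono)
    have "pi * \<alpha> \<le> (7 / 2) * (1 / 4)" using pi_less_4 \<alpha> pi_approx by (intro mult_mono) auto
    then show "8 / 7 * pi * \<alpha> \<le> 1" by simp
  qed (use s in simp)
  finally show "s + real (2 * i) * v_fun \<alpha> s \<le> (2 * real i + 1) * pi" by (simp add: A(1) algebra_simps)
  have "(2 * real i + 1) * pi \<le> real (Suc (2 * i)) * v_fun \<alpha> s"
    using A(1,2) by (simp add: algebra_simps)
  then show "(2 * real i + 1) * pi \<le> s + real (Suc (2 * i)) * v_fun \<alpha> s" using s by simp
qed

lemma extremal_front_eq:
  assumes \<alpha>: "0 < \<alpha>" "\<alpha> < 1 / 4" and k: "odd (k_M \<alpha>)"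
  shows "extremal_front \<alpha> (of_int (k_M \<alpha>) * pi) =
    (\<Union>\<epsilon>\<in>{1, -1}. chi_formula \<epsilon> \<alpha> (r_M \<alpha>) ` {0<..pi})"
proof -
  have \<alpha>': "\<alpha> < pi / 4" using \<alpha> pi_gt3 by simp
  obtain i :: nat where i: "of_int (k_M \<alpha>) = 2 * real i + 1" "2 * real i + 1 \<le> pi / (2 * \<alpha>)"
    "r_M \<alpha> = pi / (2 * \<alpha>) - (2 * real i + 1)" using odd_k_M[OF \<alpha>(1) k] .
  define T where "T = (2 * real i + 1) * pi"
  have T: "T > 0" by (auto simp: T_def intro!: mult_pos_pos)
  have chi: "chi_formula \<epsilon> \<alpha> (r_M \<alpha>) s = rot (bang_axis \<alpha> (\<epsilon> * (-1) ^ Suc (2 * i))) (T - (s + real (2 * i) * v_fun \<alpha> s)) (bang_point \<alpha> \<epsilon> s (2 * i))"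
    if "\<epsilon> \<in> {1, -1}" "0 < s" "s \<le> pi" for \<epsilon> s
  proof -
    have \<epsilon>: "\<bar>\<epsilon>\<bar> = 1" using that by auto
    have "sin \<alpha> \<noteq> 0" using sin_cos_quarter[OF \<alpha>(1) \<alpha>'] by simp
    then show ?thesis using that \<alpha>
      by (simp add: chi_formula_rot[OF _ \<epsilon>] psi_theta_r_M[OF _ i(3)] T_def bang_point_even[OF \<alpha>(1) \<alpha>' \<epsilon>])
  qed
  have "extremal_front \<alpha> T = (\<Union>\<epsilon>\<in>{1, -1}. chi_formula \<epsilon> \<alpha> (r_M \<alpha>) ` {0<..pi})"
  proof (intro equalityI subsetI)
    fix z assume "z \<in> extremal_front \<alpha> T"
    then obtain x u where x: "z = x T" "admissible_control T u" "trajectory \<alpha> T u x" "satisfies_PMP \<alpha> T u x"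
      unfolding extremal_front_def by blast
    obtain \<epsilon> s where es: "\<epsilon> \<in> {1, -1}" "0 < s" "s \<le> pi" and j: "\<And>j. s + real j * v_fun \<alpha> s \<le> T \<Longrightarrow> T \<le> s + real (Suc j) * v_fun \<alpha> s \<Longrightarrow>
       x T = rot (bang_axis \<alpha> (\<epsilon> * (-1) ^ Suc j)) (T - (s + real j * v_fun \<alpha> s)) (bang_point \<alpha> \<epsilon> s j)"
      using PMP_bang_bang[OF \<alpha>(1) \<alpha>' x(2-4) T] by blast
    have "z = chi_formula \<epsilon> \<alpha> (r_M \<alpha>) s"
      unfolding x(1) chi[OF es] using last_arc_bounds[OF \<alpha> i(2), of s] es by (intro j) (auto simp: T_def)
    then show "z \<in> (\<Union>\<epsilon>\<in>{1, -1}. chi_formula \<epsilon> \<alpha> (r_M \<alpha>) ` {0<..pi})"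
      using es by (intro UN_I[of \<epsilon>] image_eqI[of _ _ s]) simp_all
  next
    fix z assume "z \<in> (\<Union>\<epsilon>\<in>{1, -1}. chi_formula \<epsilon> \<alpha> (r_M \<alpha>) ` {0<..pi})"
    then obtain \<epsilon> where e: "\<epsilon> \<in> {1, -1}" and "z \<in> chi_formula \<epsilon> \<alpha> (r_M \<alpha>) ` {0<..pi}" by (rule UN_E)
    from this(2) obtain s where z: "z = chi_formula \<epsilon> \<alpha> (r_M \<alpha>) s" and "s \<in> {0<..pi}" by (rule imageE)
    then have es: "\<epsilon> \<in> {1, -1}" "0 < s" "s \<le> pi" using e by simp_all
    show "z \<in> extremal_front \<alpha> T"
      unfolding z chi[OF es] using last_arc_bounds[OF \<alpha> i(2), of s] es
      by (intro bang_bang_extremal[OF \<alpha>(1) \<alpha>']) (simp_all add: T_def, linarith)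
  qed
  then show ?thesis by (simp add: T_def i(1))
qed

text \<open>At both ends \<open>v = pi\<close>, so either side is an alternating word of rotations
  by pi applied to \<open>north\<close>. The two sides are the same word of length
  \<open>2 * i + 1\<close>, bracketed into pairs from different ends.\<close>

lemma chi_formula_junction:
  assumes \<alpha>: "0 < \<alpha>" "\<alpha> < pi / 4" and \<epsilon>: "\<epsilon> \<in> {1, -1}" and k: "odd (k_M \<alpha>)"
  shows "chi_formula \<epsilon> \<alpha> (r_M \<alpha>) 0 = chi_formula (- \<epsilon>) \<alpha> (r_M \<alpha>) pi"
proof -
  obtain i :: nat where i: "of_int (k_M \<alpha>) = 2 * real i + 1" "2 * real i + 1 \<le> pi / (2 * \<alpha>)"
    "r_M \<alpha> = pi / (2 * \<alpha>) - (2 * real i + 1)" using odd_k_M[OF \<alpha>(1) k] .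
  have e: "\<bar>\<epsilon>\<bar> = 1" "\<bar>- \<epsilon>\<bar> = 1" using \<epsilon> by auto
  have sa: "sin \<alpha> \<noteq> 0" using sin_cos_quarter[OF \<alpha>] by simp
  let ?P = "\<lambda>\<epsilon>. rot (bang_axis \<alpha> \<epsilon>) pi"
  have comm: "?P (- \<epsilon>) (((\<lambda>y. ?P \<epsilon> (?P (- \<epsilon>) y)) ^^ i) y) = ((\<lambda>y. ?P (- \<epsilon>) (?P \<epsilon> y)) ^^ i) (?P (- \<epsilon>) y)" for y
    by (induction i) simp_all
  have p: "0 < pi" "pi < 2 * pi" by simp_all
  have "chi_formula \<epsilon> \<alpha> (r_M \<alpha>) 0 = ?P (- \<epsilon>) (rot (mid_axis (- \<epsilon>) \<alpha> pi) (real i * Theta_fun \<alpha> pi) north)"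
    using \<alpha> by (simp add: chi_formula_rot[OF sa e(1)] psi_theta_r_M[OF _ i(3)] algebra_simps)
  also have "\<dots> = rot (mid_axis \<epsilon> \<alpha> pi) (real i * Theta_fun \<alpha> pi) (?P (- \<epsilon>) north)"
    using comm[of north] unfolding bang_pair_power[OF \<alpha> e(1) p] bang_pair_power[OF \<alpha> e(2) p, unfolded minus_minus] .
  also have "\<dots> = chi_formula (- \<epsilon>) \<alpha> (r_M \<alpha>) pi"
    using \<alpha> by (simp add: chi_formula_rot[OF sa e(2)] psi_theta_r_M[OF _ i(3)] algebra_simps)
  finally show ?thesis .
qed

section \<open>Holomorphic extension\<close>

definition sinc_ext :: "complex \<Rightarrow> complex" where
  "sinc_ext z = (if z = 0 then 1 else sin z / z)"

definition arctanc_ext :: "complex \<Rightarrow> complex" where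
  "arctanc_ext z = (if z = 0 then 1 else Arctan z / z)"

lemma holomorphic_sinc_ext: "sinc_ext holomorphic_on UNIV"
proof -
  have hol: "(\<lambda>z. if z = 0 then deriv sin 0 else (sin z - sin 0) / (z - 0)) holomorphic_on (UNIV :: complex set)"
    by (intro pole_lemma_open holomorphic_intros) auto
  have d: "deriv sin (0::complex) = 1" by (rule DERIV_imp_deriv) (auto intro!: derivative_eq_intros)
  show ?thesis
    using hol by (rule holomorphic_transform) (simp_all add: sinc_ext_def d)
qed

text \<open>The unit disc avoids the branch cuts of \<open>Arctan\<close>, and at the origin the
  difference quotient has a removable singularity with value the derivative 1.\<close>

lemma holomorphic_arctanc_ext: "arctanc_ext holomorphic_on ball 0 1"
proof -
  have "\<bar>Im z\<bar> < 1" if "z \<in> ball 0 1" for z :: complex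
    using that abs_Im_le_cmod[of z] by simp
  then have hol: "(\<lambda>z. if z = 0 then deriv Arctan 0 else (Arctan z - Arctan 0) / (z - 0)) holomorphic_on ball 0 1"
    by (intro pole_lemma_open holomorphic_on_Arctan) auto
  have d: "deriv Arctan 0 = 1" using has_field_derivative_Arctan[of 0] by (auto dest: DERIV_imp_deriv)
  show ?thesis
    using hol by (rule holomorphic_transform) (simp_all add: arctanc_ext_def d)
qed

lemma mult_arctanc_ext: "z * arctanc_ext z = Arctan z"
  by (simp add: arctanc_ext_def)

section \<open>Complexified rotations\<close>

type_synonym cvec3 = "complex \<times> complex \<times> complex"

text \<open>Rodrigues' formula with the bilinear, not the Hermitian, product: conjugation would
  destroy holomorphy.\<close>

definition crot :: "cvec3 \<Rightarrow> complex \<Rightarrow> cvec3 \<Rightarrow> cvec3" where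
  "crot = (\<lambda>(w1, w2, w3) t (y1, y2, y3).
     (cos t * y1 + sin t * (w2 * y3 - w3 * y2) + (1 - cos t) * (w1 * y1 + w2 * y2 + w3 * y3) * w1,
      cos t * y2 + sin t * (w3 * y1 - w1 * y3) + (1 - cos t) * (w1 * y1 + w2 * y2 + w3 * y3) * w2,
      cos t * y3 + sin t * (w1 * y2 - w2 * y1) + (1 - cos t) * (w1 * y1 + w2 * y2 + w3 * y3) * w3))"

definition cvec :: "real^3 \<Rightarrow> cvec3" where
  "cvec y = (of_real (y $ 1), of_real (y $ 2), of_real (y $ 3))"

definition re_vec :: "cvec3 \<Rightarrow> real^3" where
  "re_vec = (\<lambda>(a, b, c). Re a *\<^sub>R axis 1 1 + Re b *\<^sub>R axis 2 1 + Re c *\<^sub>R axis 3 1)"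

lemma re_vec_cvec [simp]: "re_vec (cvec y) = y"
  by (simp add: re_vec_def cvec_def vec_eq_iff forall_3 axis_def)

lemma crot_cvec: "crot (cvec w) (of_real t) (cvec y) = cvec (rot w t y)"
  by (simp add: crot_def cvec_def rot_first cos_of_real[symmetric] sin_of_real[symmetric] del: cos_of_real sin_of_real)

text \<open>The ingredients of \<open>\<chi>\<close> with all singularities at \<open>\<alpha> = 0\<close> removed:
  \<open>v = \<pi> + 2 arctan (w sin\<^sup>2 \<alpha>)\<close>, \<open>\<Theta> = \<plusminus>4 arctan (R tan \<alpha>)\<close>, and the axis of \<open>Z\<close> is
  \<open>\<plusminus>(0, \<epsilon> / R, w sin \<alpha> / R)\<close>. The two signs, both equal to the sign of \<open>\<alpha>\<close>, cancel.\<close>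

definition cx_w :: "complex \<Rightarrow> complex \<Rightarrow> complex" where
  "cx_w s a = sin s / (1 - (1 - cos s) * (sin a)\<^sup>2)"

definition cx_R :: "complex \<Rightarrow> complex \<Rightarrow> complex" where
  "cx_R s a = csqrt (1 + (sin a)\<^sup>2 * (cx_w s a)\<^sup>2)"

text \<open>The factor \<open>4 * \<alpha> * (pi / (4 * \<alpha>) - (1 + r) / 2)\<close>. It is
  common to both angles: with \<open>A\<close> half of \<open>v - pi\<close>, the angle
  \<open>psi_fun\<close> equals \<open>pi - s\<close> minus this factor times
  \<open>A / \<alpha>\<close>.\<close>

definition cx_kappa :: "complex \<Rightarrow> complex \<Rightarrow> complex" where
  "cx_kappa r a = of_real pi - 2 * (1 + r) * a"

definition cx_psi :: "complex \<Rightarrow> complex \<Rightarrow> complex \<Rightarrow> complex" where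
  "cx_psi r s a = of_real pi - s -
     cx_kappa r a * (a * (sinc_ext a)\<^sup>2 * cx_w s a * arctanc_ext ((sin a)\<^sup>2 * cx_w s a))"

definition cx_theta :: "complex \<Rightarrow> complex \<Rightarrow> complex \<Rightarrow> complex" where
  "cx_theta r s a = cx_kappa r a *
     (sinc_ext a / cos a * cx_R s a * arctanc_ext (sin a / cos a * cx_R s a))"

definition cx_chi :: "real \<Rightarrow> complex \<Rightarrow> complex \<Rightarrow> complex \<Rightarrow> cvec3" where
  "cx_chi \<epsilon> r s a =
     crot (- of_real \<epsilon> * sin a, 0, cos a) (cx_psi r s a)
       (crot (0, of_real \<epsilon> / cx_R s a, sin a * cx_w s a / cx_R s a) (cx_theta r s a)
         (crot (of_real \<epsilon> * sin a, 0, cos a) s (0, 0, 1)))"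

text \<open>An open condition in both complex variables. Every real \<open>s\<close> satisfies its
  part with room to spare, which is why the restriction on \<open>a\<close> can be uniform in
  \<open>s\<close>.\<close>

definition cx_domain :: "complex \<Rightarrow> complex \<Rightarrow> bool" where
  "cx_domain s a \<longleftrightarrow> norm (sin a) < 1 / 4 \<and> norm (cos a) > 1 / 2 \<and> norm (sin s) < 2 \<and> norm (cos s) < 2"

text \<open>The chain of constants: the denominator of \<open>cx_w\<close> has modulus at least
  13/16, so \<open>cx_w\<close> at most 32/13; then \<open>cx_R\<close> squared differs from 1 by at
  most 11/25, so \<open>cx_R\<close> is nonzero of modulus at most 6/5, and the argument of the last
  arctangent stays below 3/5.\<close>

lemma cx_domain_bounds:
  assumes "cx_domain s a"
  shows "1 - (1 - cos s) * (sin a)\<^sup>2 \<noteq> 0" "1 + (sin a)\<^sup>2 * (cx_w s a)\<^sup>2 \<in> - \<real>\<^sub>\<le>\<^sub>0"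
    "norm ((sin a)\<^sup>2 * cx_w s a) < 1" "cos a \<noteq> 0" "cx_R s a \<noteq> 0"
    "norm (sin a / cos a * cx_R s a) < 1"
proof -
  have q: "norm (sin a) < 1 / 4" "norm (cos a) > 1 / 2" "norm (sin s) < 2" "norm (cos s) < 2"
    using assms by (auto simp: cx_domain_def)
  have "norm ((sin a)\<^sup>2) \<le> (1 / 4)\<^sup>2" unfolding norm_power using q by (intro power_mono) auto
  then have sa: "norm ((sin a)\<^sup>2) \<le> 1 / 16" by (simp add: power2_eq_square)
  have "norm (1 - cos s) \<le> 3" using norm_triangle_ineq4[of 1 "cos s"] q by simp
  then have "norm ((1 - cos s) * (sin a)\<^sup>2) \<le> 3 * (1 / 16)" unfolding norm_mult using sa by (intro mult_mono) auto
  then have D: "norm (1 - (1 - cos s) * (sin a)\<^sup>2) \<ge> 13 / 16"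
    using norm_triangle_ineq2[of 1 "(1 - cos s) * (sin a)\<^sup>2"] by simp
  then show "1 - (1 - cos s) * (sin a)\<^sup>2 \<noteq> 0" by auto
  have w: "norm (cx_w s a) \<le> 32 / 13"
  proof -
    have "norm (sin s) / norm (1 - (1 - cos s) * (sin a)\<^sup>2) \<le> 2 / (13 / 16)" using q D by (intro frac_le) auto
    then show ?thesis by (simp add: cx_w_def norm_divide)
  qed
  have "norm ((sin a)\<^sup>2 * cx_w s a) \<le> 1 / 16 * (32 / 13)" unfolding norm_mult using sa w by (intro mult_mono) auto
  then show "norm ((sin a)\<^sup>2 * cx_w s a) < 1" by simp
  have w2: "norm ((cx_w s a)\<^sup>2) \<le> (32 / 13)\<^sup>2" unfolding norm_power using w by (intro power_mono) auto
  have "norm ((sin a)\<^sup>2 * (cx_w s a)\<^sup>2) \<le> 1 / 16 * (32 / 13)\<^sup>2"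
    unfolding norm_mult[of "(sin a)\<^sup>2"] using sa w2 by (intro mult_mono) auto
  then have y: "norm ((sin a)\<^sup>2 * (cx_w s a)\<^sup>2) \<le> 11 / 25" by (simp add: power2_eq_square)
  then have "Re (1 + (sin a)\<^sup>2 * (cx_w s a)\<^sup>2) > 0"
    using abs_Re_le_cmod[of "(sin a)\<^sup>2 * (cx_w s a)\<^sup>2"] unfolding plus_complex.sel one_complex.sel by linarith
  then show 1: "1 + (sin a)\<^sup>2 * (cx_w s a)\<^sup>2 \<in> - \<real>\<^sub>\<le>\<^sub>0"
    by (auto simp: complex_nonpos_Reals_iff)
  have R2: "(cx_R s a)\<^sup>2 = 1 + (sin a)\<^sup>2 * (cx_w s a)\<^sup>2" by (simp add: cx_R_def)
  with 1 show "cx_R s a \<noteq> 0" by (metis ComplD nonpos_Reals_zero_I zero_power2)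
  have "norm (cx_R s a) ^ 2 \<le> 36 / 25"
    using norm_triangle_ineq[of 1 "(sin a)\<^sup>2 * (cx_w s a)\<^sup>2"] y unfolding norm_power[symmetric] R2 by simp
  also have "36 / 25 = (6 / 5 :: real)\<^sup>2" by (simp add: power2_eq_square)
  finally have R: "norm (cx_R s a) \<le> 6 / 5" by (rule power2_le_imp_le) simp
  show "cos a \<noteq> 0" using q by auto
  have "norm (sin a) / norm (cos a) \<le> (1 / 4) / (1 / 2)" using q by (intro frac_le) auto
  then have "norm (sin a / cos a) * norm (cx_R s a) \<le> 1 / 2 * (6 / 5)" using R by (intro mult_mono) (auto simp: norm_divide)
  then show "norm (sin a / cos a * cx_R s a) < 1" unfolding norm_mult[of "sin a / cos a"] by linarith
qed

text \<open>Instantiated with holomorphy as well as with local expansion into a multi-index series, so that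
  one computation covers both.\<close>

locale analytic_closure =
  fixes P :: "('t \<Rightarrow> complex) \<Rightarrow> bool" and T :: "'t set"
  assumes const: "P (\<lambda>_. k)"
    and add: "P f \<Longrightarrow> P g \<Longrightarrow> P (\<lambda>t. f t + g t)"
    and mult: "P f \<Longrightarrow> P g \<Longrightarrow> P (\<lambda>t. f t * g t)"
    and compose: "P f \<Longrightarrow> h holomorphic_on U \<Longrightarrow> open U \<Longrightarrow> (\<And>t. t \<in> T \<Longrightarrow> f t \<in> U) \<Longrightarrow> P (\<lambda>t. h (f t))"
begin

lemma uminus: "P f \<Longrightarrow> P (\<lambda>t. - f t)"
  using mult[OF const[of "- 1"]] by simp

lemma diff: "P f \<Longrightarrow> P g \<Longrightarrow> P (\<lambda>t. f t - g t)"
  using add[of f "\<lambda>t. - g t"] uminus by simp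

lemma power2: "P f \<Longrightarrow> P (\<lambda>t. (f t)\<^sup>2)"
  by (simp add: power2_eq_square mult)

lemma sin: "P f \<Longrightarrow> P (\<lambda>t. sin (f t))"
  by (rule compose[of f sin UNIV]) (auto intro: holomorphic_intros)

lemma cos: "P f \<Longrightarrow> P (\<lambda>t. cos (f t))"
  by (rule compose[of f cos UNIV]) (auto intro: holomorphic_intros)

lemma divide: "P f \<Longrightarrow> P g \<Longrightarrow> (\<And>t. t \<in> T \<Longrightarrow> g t \<noteq> 0) \<Longrightarrow> P (\<lambda>t. f t / g t)"
  unfolding divide_inverse
  by (intro mult compose[of g inverse "- {0}"] holomorphic_intros) (auto intro: open_Compl)

lemma csqrt: "P f \<Longrightarrow> (\<And>t. t \<in> T \<Longrightarrow> f t \<in> - \<real>\<^sub>\<le>\<^sub>0) \<Longrightarrow> P (\<lambda>t. csqrt (f t))"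
  by (rule compose[of f csqrt "- \<real>\<^sub>\<le>\<^sub>0"]) (auto intro!: holomorphic_intros open_Compl)

lemma arctanc_ext: "P f \<Longrightarrow> (\<And>t. t \<in> T \<Longrightarrow> norm (f t) < 1) \<Longrightarrow> P (\<lambda>t. arctanc_ext (f t))"
  by (rule compose[of f arctanc_ext "ball 0 1"]) (auto intro: holomorphic_arctanc_ext)

lemma sinc_ext: "P f \<Longrightarrow> P (\<lambda>t. sinc_ext (f t))"
  by (rule compose[of f sinc_ext UNIV]) (auto intro: holomorphic_sinc_ext)

definition P3 :: "('t \<Rightarrow> cvec3) \<Rightarrow> bool" where
  "P3 f \<longleftrightarrow> P (\<lambda>t. fst (f t)) \<and> P (\<lambda>t. fst (snd (f t))) \<and> P (\<lambda>t. snd (snd (f t)))"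

lemma P3_triple: "P f \<Longrightarrow> P g \<Longrightarrow> P h \<Longrightarrow> P3 (\<lambda>t. (f t, g t, h t))"
  by (simp add: P3_def)

lemma P3_crot: "P3 w \<Longrightarrow> P \<tau> \<Longrightarrow> P3 y \<Longrightarrow> P3 (\<lambda>t. crot (w t) (\<tau> t) (y t))"
  unfolding P3_def crot_def case_prod_unfold fst_conv snd_conv
  by (intro conjI add mult diff sin cos const) auto

lemma P3_cx_chi:
  assumes r: "P r" and s: "P s" and a: "P a" and dom: "\<And>t. t \<in> T \<Longrightarrow> cx_domain (s t) (a t)"
  shows "P3 (\<lambda>t. cx_chi \<epsilon> (r t) (s t) (a t))"
proof -
  note d = cx_domain_bounds[OF dom]
  have w: "P (\<lambda>t. cx_w (s t) (a t))"
    unfolding cx_w_def by (intro divide sin s diff const mult cos power2 a d(1))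
  have R: "P (\<lambda>t. cx_R (s t) (a t))"
    unfolding cx_R_def by (intro csqrt add const mult power2 sin a w d(2))
  have k: "P (\<lambda>t. cx_kappa (r t) (a t))"
    unfolding cx_kappa_def by (intro diff const mult add r a)
  have psi: "P (\<lambda>t. cx_psi (r t) (s t) (a t))"
    unfolding cx_psi_def by (intro diff const s mult k a power2 sinc_ext w arctanc_ext sin d(3))
  have theta: "P (\<lambda>t. cx_theta (r t) (s t) (a t))"
    unfolding cx_theta_def by (intro mult k divide sinc_ext a cos R arctanc_ext sin d(4,6))
  show ?thesis
    unfolding cx_chi_def
    by (intro P3_crot P3_triple psi theta s mult const sin a cos divide R w d(5))
qed

end

lemma holomorphic_closure:
  assumes "open T" shows "analytic_closure (\<lambda>f. f holomorphic_on T) T"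
proof
  show "(\<lambda>t. h (f t)) holomorphic_on T"
    if "f holomorphic_on T" "h holomorphic_on U" "open U" "\<And>t. t \<in> T \<Longrightarrow> f t \<in> U" for f h U
    using holomorphic_on_compose_gen[OF that(1,2)] that(4) by (auto simp: o_def)
qed (auto intro: holomorphic_intros)

text \<open>The index set is the single point \<open>x\<close>: since \<open>U\<close> is open and
  inner functions are expandable, the side conditions at \<open>x\<close> suffice for a local
  expansion.\<close>

lemma mseries_closure: "analytic_closure (\<lambda>f. mseries_at f x) {x}"
proof
  show "mseries_at (\<lambda>t. h (f t)) x"
    if "mseries_at f x" "h holomorphic_on U" "open U" "\<And>t. t \<in> {x} \<Longrightarrow> f t \<in> U" for f h U
    using mseries_at_compose_holomorphic[OF that(1-3)] that(4) by simp
qed (auto intro: mseries_at_const mseries_at_add mseries_at_mult)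

lemma holomorphic_cx_chi:
  assumes "open T" "r holomorphic_on T" "s holomorphic_on T" "a holomorphic_on T"
    and "\<And>t. t \<in> T \<Longrightarrow> cx_domain (s t) (a t)"
  shows "(\<lambda>t. fst (cx_chi \<epsilon> (r t) (s t) (a t))) holomorphic_on T"
    "(\<lambda>t. fst (snd (cx_chi \<epsilon> (r t) (s t) (a t)))) holomorphic_on T"
    "(\<lambda>t. snd (snd (cx_chi \<epsilon> (r t) (s t) (a t)))) holomorphic_on T"
proof -
  interpret analytic_closure "\<lambda>f. f holomorphic_on T" T by (rule holomorphic_closure[OF assms(1)])
  show "(\<lambda>t. fst (cx_chi \<epsilon> (r t) (s t) (a t))) holomorphic_on T"
    "(\<lambda>t. fst (snd (cx_chi \<epsilon> (r t) (s t) (a t)))) holomorphic_on T"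
    "(\<lambda>t. snd (snd (cx_chi \<epsilon> (r t) (s t) (a t)))) holomorphic_on T"
    using P3_cx_chi[of r s a \<epsilon>] assms unfolding P3_def by auto
qed

lemma mseries_at_cx_chi:
  assumes "mseries_at r x" "mseries_at s x" "mseries_at a x" and "cx_domain (s x) (a x)"
  shows "mseries_at (\<lambda>t. fst (cx_chi \<epsilon> (r t) (s t) (a t))) x"
    "mseries_at (\<lambda>t. fst (snd (cx_chi \<epsilon> (r t) (s t) (a t)))) x"
    "mseries_at (\<lambda>t. snd (snd (cx_chi \<epsilon> (r t) (s t) (a t)))) x"
proof -
  interpret analytic_closure "\<lambda>f. mseries_at f x" "{x}" by (rule mseries_closure)
  show "mseries_at (\<lambda>t. fst (cx_chi \<epsilon> (r t) (s t) (a t))) x"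
    "mseries_at (\<lambda>t. fst (snd (cx_chi \<epsilon> (r t) (s t) (a t)))) x"
    "mseries_at (\<lambda>t. snd (snd (cx_chi \<epsilon> (r t) (s t) (a t)))) x"
    using P3_cx_chi[of r s a \<epsilon>] assms unfolding P3_def by auto
qed

lemma mseries_at_re_vec:
  assumes "mseries_at (\<lambda>t. fst (f t)) x" "mseries_at (\<lambda>t. fst (snd (f t))) x" "mseries_at (\<lambda>t. snd (snd (f t))) x"
  shows "mseries_at (\<lambda>t. re_vec (f t)) x"
proof -
  have bl: "bounded_linear (\<lambda>z. Re z *\<^sub>R v)" for v :: "real^3"
    by (intro bounded_linear_compose[OF bounded_linear_scaleR_left bounded_linear_Re])
  show ?thesis unfolding re_vec_def case_prod_unfold
    by (intro mseries_at_add assms[THEN mseries_at_bounded_linear[OF _ bl]])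
qed

lemma rot_sign_cancel:
  assumes "g = 1 \<or> g = (-1::real)"
  shows "rot (g *\<^sub>R w) (g * t) y = rot w t y"
  using assms by (auto simp: rot_def)

text \<open>All functions of \<open>v\<close> are rewritten through its half excess
  \<open>A\<close>, with \<open>tan A = \<sigma>\<^sup>2 * w\<close>. The square root in
  \<open>B_fun\<close> and \<open>C_fun\<close> becomes
  \<open>cos A * \<bar>\<sigma>\<bar> * R\<close>, and \<open>Theta_fun\<close> becomes
  \<open>4 * \<bar>\<beta>\<bar>\<close>. Thus axis and angle each acquire the factor
  \<open>g\<close>, which \<open>rot_sign_cancel\<close> removes.\<close>

lemma chi_formula_cx_chi:
  assumes \<alpha>: "\<alpha> \<noteq> 0" "\<bar>\<alpha>\<bar> < pi / 2" and dom: "cx_domain (of_real s) (of_real \<alpha>)" and \<epsilon>: "\<bar>\<epsilon>\<bar> = 1"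
  shows "cx_chi \<epsilon> (of_real r) (of_real s) (of_real \<alpha>) = cvec (chi_formula \<epsilon> \<alpha> r s)"
proof -
  define \<sigma> c D w R where "\<sigma> = sin \<alpha>" "c = cos \<alpha>" "D = 1 - (1 - cos s) * \<sigma>\<^sup>2" "w = sin s / D" "R = sqrt (1 + \<sigma>\<^sup>2 * w\<^sup>2)"
  note defs = this
  define g where "g = sgn \<alpha>"
  have g: "g = 1 \<or> g = -1" "g * g = 1" using \<alpha> by (auto simp: g_def sgn_if)
  have g\<sigma>: "\<bar>\<sigma>\<bar> = g * \<sigma>" "\<sigma> \<noteq> 0" "\<sigma> = g * \<bar>\<sigma>\<bar>"
  proof -
    have "0 < \<sigma>" if "0 < \<alpha>" using that \<alpha> by (auto simp: defs intro: sin_gt_zero)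
    moreover have "\<sigma> < 0" if "\<alpha> < 0" using that \<alpha> sin_gt_zero[of "- \<alpha>"] by (auto simp: defs)
    ultimately show "\<bar>\<sigma>\<bar> = g * \<sigma>" "\<sigma> \<noteq> 0" "\<sigma> = g * \<bar>\<sigma>\<bar>" using \<alpha>(1) by (cases "\<alpha> > 0"; force simp: g_def)+
  qed
  have sa: "\<bar>\<sigma>\<bar> < 1 / 4" and ca: "\<bar>c\<bar> > 1 / 2"
    using dom by (simp_all add: cx_domain_def sin_of_real cos_of_real defs(1,2))
  have c2: "c\<^sup>2 = 1 - \<sigma>\<^sup>2" by (simp add: defs(1,2) cos_squared_eq)
  have "\<bar>\<sigma>\<bar>\<^sup>2 \<le> (1 / 4)\<^sup>2" using sa by (intro power_mono) auto
  then have s2: "\<sigma>\<^sup>2 \<le> 1 / 16" by (simp add: power2_eq_square)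
  have "(1 - cos s) * \<sigma>\<^sup>2 \<le> 2 * (1 / 16)" using s2 cos_ge_minus_one[of s] by (intro mult_mono zero_le_power2) linarith+
  then have D: "D > 0" by (simp add: defs(3))
  have R1: "1 + \<sigma>\<^sup>2 * w\<^sup>2 > 0" by (simp add: add_pos_nonneg)
  then have R: "R > 0" "R\<^sup>2 = 1 + \<sigma>\<^sup>2 * w\<^sup>2" by (auto simp: defs(5))
  have cw: "cx_w (of_real s) (of_real \<alpha>) = of_real w"
    by (simp add: cx_w_def defs sin_of_real cos_of_real)
  have cR: "cx_R (of_real s) (of_real \<alpha>) = of_real R"
  proof -
    have "cx_R (of_real s) (of_real \<alpha>) = csqrt (of_real (1 + \<sigma>\<^sup>2 * w\<^sup>2))"
      by (simp add: cx_R_def cw defs(1) sin_of_real)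
    also have "\<dots> = of_real R" using R1 by (subst csqrt_of_real_nonneg) (auto simp: defs(5))
    finally show ?thesis .
  qed
  define A where "A = arctan (\<sigma>\<^sup>2 * w)"
  define \<beta> where "\<beta> = arctan (\<sigma> / c * R)"
  have cA: "(of_real \<sigma>)\<^sup>2 * of_real w * arctanc_ext ((of_real \<sigma>)\<^sup>2 * of_real w) = of_real A"
    using mult_arctanc_ext[of "of_real (\<sigma>\<^sup>2 * w)"] unfolding Arctan_of_real A_def[symmetric] by simp
  have c\<beta>: "of_real \<sigma> / of_real c * of_real R * arctanc_ext (of_real \<sigma> / of_real c * of_real R) = of_real \<beta>"
    using mult_arctanc_ext[of "of_real (\<sigma> / c * R)"] unfolding Arctan_of_real \<beta>_def[symmetric] by simp
  have snc: "sinc_ext (of_real \<alpha>) = of_real (\<sigma> / \<alpha>)" using \<alpha> by (simp add: sinc_ext_def defs(1) sin_of_real)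
  have c0: "c \<noteq> 0" using ca by auto
  have v: "v_fun \<alpha> s = pi + 2 * A"
  proof -
    have "cos s + (cot \<alpha>)\<^sup>2 = D / \<sigma>\<^sup>2"
      using g\<sigma>(2) c2 by (simp add: defs(3) cot_def defs(1,2)[symmetric] field_simps)
    then show ?thesis by (simp add: v_fun_def A_def defs(4) mult.commute)
  qed
  have cpsi: "cx_psi (of_real r) (of_real s) (of_real \<alpha>) = of_real (psi_fun \<alpha> r s)"
  proof -
    have "cx_psi (of_real r) (of_real s) (of_real \<alpha>) = of_real pi - of_real s - (of_real pi - 2 * (1 + of_real r) * of_real \<alpha>) *
       (1 / of_real \<alpha> * ((of_real \<sigma>)\<^sup>2 * of_real w * arctanc_ext ((of_real \<sigma>)\<^sup>2 * of_real w)))"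
      unfolding cx_psi_def cx_kappa_def cw snc using \<alpha>
      by (simp add: sin_of_real defs(1)[symmetric] power2_eq_square)
    also have "\<dots> = of_real (pi - s - (pi - 2 * (1 + r) * \<alpha>) * (1 / \<alpha> * A))" unfolding cA by simp
    also have "pi - s - (pi - 2 * (1 + r) * \<alpha>) * (1 / \<alpha> * A) = psi_fun \<alpha> r s"
      unfolding psi_fun_def v using \<alpha> by (simp add: field_simps)
    finally show ?thesis .
  qed
  have cosA: "cos A > 0" unfolding A_def using arctan_bounded[of "\<sigma>\<^sup>2 * w"] by (intro cos_gt_zero_pi) linarith+
  have tanA: "sin A = \<sigma>\<^sup>2 * w * cos A"
    using tan_arctan[of "\<sigma>\<^sup>2 * w", folded A_def] cosA by (simp add: tan_def field_simps)
  have A1: "(cos A)\<^sup>2 * (1 + (\<sigma>\<^sup>2 * w)\<^sup>2) = 1"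
    using sin_cos_squared_add[of A] unfolding tanA by (simp add: power_mult_distrib algebra_simps)
  have vh: "sin (v_fun \<alpha> s / 2) = cos A" "cos (v_fun \<alpha> s / 2) = - sin A"
    unfolding v by (simp_all add: add_divide_distrib sin_add cos_add)
  define q where "q = cos A * \<bar>\<sigma>\<bar> * R"
  have q: "q > 0" using cosA g\<sigma> R by (simp add: q_def)
  have q2: "(cos A)\<^sup>2 * \<sigma>\<^sup>2 + (sin A)\<^sup>2 = q\<^sup>2"
    unfolding q_def tanA power_mult_distrib R(2) by (simp add: power2_eq_square algebra_simps)
  have sq: "sqrt ((sin (v_fun \<alpha> s / 2))\<^sup>2 * (sin \<alpha>)\<^sup>2 + (cos (v_fun \<alpha> s / 2))\<^sup>2) = q"
    unfolding vh defs(1)[symmetric] using q q2 by simp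
  have B: "B_fun \<alpha> (v_fun \<alpha> s) = g * (1 / R)"
  proof -
    have "B_fun \<alpha> (v_fun \<alpha> s) = \<sigma> * cos A / (cos A * \<bar>\<sigma>\<bar> * R)"
      unfolding B_fun_def sq unfolding vh(1) defs(1)[symmetric] q_def ..
    also have "\<dots> = \<sigma> / (\<bar>\<sigma>\<bar> * R)" using cosA by simp
    also have "\<dots> = (g * \<bar>\<sigma>\<bar>) / (\<bar>\<sigma>\<bar> * R)" using g\<sigma>(3) by simp
    finally show ?thesis using g\<sigma>(2) by simp
  qed
  have C: "C_fun \<alpha> (v_fun \<alpha> s) = g * (\<sigma> * w / R)"
  proof -
    have "C_fun \<alpha> (v_fun \<alpha> s) = \<sigma>\<^sup>2 * w * cos A / (cos A * \<bar>\<sigma>\<bar> * R)"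
      unfolding C_fun_def sq unfolding vh(2) tanA q_def by simp
    also have "\<dots> = \<sigma>\<^sup>2 * w / (\<bar>\<sigma>\<bar> * R)" using cosA by simp
    also have "\<sigma>\<^sup>2 = \<bar>\<sigma>\<bar> * (g * \<sigma>)" using g\<sigma> by (metis abs_mult_self_eq power2_eq_square mult.assoc)
    finally show ?thesis using g\<sigma>(2) by simp
  qed
  have mid: "mid_axis (- \<epsilon>) \<alpha> (v_fun \<alpha> s) = g *\<^sub>R vector [0, \<epsilon> / R, \<sigma> * w / R]"
    by (simp add: mid_axis_def B C vec_eq_iff forall_3 vector_3)
  have \<beta>2: "\<bar>\<beta>\<bar> < pi / 2" using arctan_bounded[of "\<sigma> / c * R"] unfolding \<beta>_def[symmetric] by linarith
  have Th: "Theta_fun \<alpha> (v_fun \<alpha> s) = 4 * (g * \<beta>)"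
  proof -
    have cb: "cos \<beta> > 0" using \<beta>2 by (intro cos_gt_zero_pi) linarith+
    have sb: "sin \<beta> = \<sigma> / c * R * cos \<beta>"
      using tan_arctan[of "\<sigma> / c * R", folded \<beta>_def] cb by (simp add: tan_def field_simps)
    have "(sin \<beta>)\<^sup>2 * c\<^sup>2 = \<sigma>\<^sup>2 * R\<^sup>2 * (1 - (sin \<beta>)\<^sup>2)"
      unfolding cos_squared_eq[symmetric] using sb c0 by (simp add: power_mult_distrib power_divide)
    then have "(sin \<beta>)\<^sup>2 * (c\<^sup>2 + \<sigma>\<^sup>2 * R\<^sup>2) = \<sigma>\<^sup>2 * R\<^sup>2" by (simp add: algebra_simps)
    moreover have "c\<^sup>2 + \<sigma>\<^sup>2 * R\<^sup>2 = 1 + (\<sigma>\<^sup>2 * w)\<^sup>2" unfolding c2 R(2) by (simp add: power2_eq_square algebra_simps)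
    ultimately have "(sin \<beta>)\<^sup>2 * (1 + (\<sigma>\<^sup>2 * w)\<^sup>2) * (cos A)\<^sup>2 = \<sigma>\<^sup>2 * R\<^sup>2 * (cos A)\<^sup>2" by simp
    then have "(sin \<beta>)\<^sup>2 * ((cos A)\<^sup>2 * (1 + (\<sigma>\<^sup>2 * w)\<^sup>2)) = q\<^sup>2"
      by (simp add: q_def power_mult_distrib mult_ac)
    \<comment> \<open>This identifies the argument \<open>1 - 2 * q\<^sup>2\<close> of the arccosine
      as \<open>cos (2 * \<beta>)\<close>.\<close>
    then have sb2: "(sin \<beta>)\<^sup>2 = q\<^sup>2" unfolding A1 by simp
    have "(sin (v_fun \<alpha> s / 2))\<^sup>2 * cos (2 * \<alpha>) - (cos (v_fun \<alpha> s / 2))\<^sup>2 = (cos A)\<^sup>2 * (1 - 2 * \<sigma>\<^sup>2) - (sin A)\<^sup>2"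
      unfolding vh cos_double_sin defs(1) by simp
    also have "\<dots> = 1 - 2 * q\<^sup>2" unfolding q2[symmetric] using sin_cos_squared_add[of A] by (simp add: algebra_simps)
    also have "\<dots> = cos (2 * \<beta>)" unfolding sb2[symmetric] cos_double_sin ..
    also have "\<dots> = cos (2 * (g * \<beta>))" using g by auto
    finally have T: "Theta_fun \<alpha> (v_fun \<alpha> s) = 2 * arccos (cos (2 * (g * \<beta>)))" by (simp add: Theta_fun_def)
    have "c > 0" unfolding defs(2) using \<alpha> by (intro cos_gt_zero_pi) auto
    \<comment> \<open>The sign selects the branch: \<open>2 * (g * \<beta>)\<close> lies between 0
      and pi, where \<open>arccos\<close> inverts the cosine.\<close>
    then have "g * \<beta> \<ge> 0"
      using g g\<sigma> R unfolding \<beta>_def by (auto simp: zero_le_mult_iff zero_le_divide_iff divide_le_0_iff mult_le_0_iff)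
    then have "arccos (cos (2 * (g * \<beta>))) = 2 * (g * \<beta>)" using \<beta>2 g by (intro arccos_cos) auto
    then show ?thesis unfolding T by simp
  qed
  have ctheta: "cx_theta (of_real r) (of_real s) (of_real \<alpha>) = of_real (g * theta_fun \<alpha> r s)"
  proof -
    have "cx_theta (of_real r) (of_real s) (of_real \<alpha>) = (of_real pi - 2 * (1 + of_real r) * of_real \<alpha>) *
       (1 / of_real \<alpha> * (of_real \<sigma> / of_real c * of_real R * arctanc_ext (of_real \<sigma> / of_real c * of_real R)))"
      unfolding cx_theta_def cx_kappa_def cR snc
      by (simp add: sin_of_real cos_of_real defs(1,2)[symmetric])
    also have "\<dots> = of_real ((pi - 2 * (1 + r) * \<alpha>) * (1 / \<alpha> * \<beta>))" unfolding c\<beta> by simp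
    also have "(pi - 2 * (1 + r) * \<alpha>) * (1 / \<alpha> * \<beta>) = g * theta_fun \<alpha> r s"
    proof -
      have "g * theta_fun \<alpha> r s = (pi / (4 * \<alpha>) - (1 + r) / 2) * 4 * ((g * g) * \<beta>)"
        unfolding theta_fun_def Th by simp
      then show ?thesis unfolding g(2) using \<alpha> by (simp add: field_simps)
    qed
    finally show ?thesis .
  qed
  have ax: "cvec (bang_axis \<alpha> e) = (of_real e * sin (of_real \<alpha>), 0, cos (of_real \<alpha>))" for e
    by (simp add: cvec_def bang_axis_def vector_3 sin_of_real cos_of_real)
  have mx: "cvec (vector [0, \<epsilon> / R, \<sigma> * w / R]) = (0, of_real \<epsilon> / of_real R, sin (of_real \<alpha>) * of_real w / of_real R)"
    by (simp add: cvec_def vector_3 sin_of_real defs(1))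
  have nx: "cvec north = (0, 0, 1)" by (simp add: cvec_def north_def vector_3)
  have "cx_chi \<epsilon> (of_real r) (of_real s) (of_real \<alpha>) = cvec (rot (bang_axis \<alpha> (- \<epsilon>)) (psi_fun \<alpha> r s)
     (rot (vector [0, \<epsilon> / R, \<sigma> * w / R]) (g * theta_fun \<alpha> r s) (rot (bang_axis \<alpha> \<epsilon>) s north)))"
    unfolding cx_chi_def cpsi ctheta cR cw mx[symmetric] nx[symmetric] of_real_minus[symmetric] ax[symmetric] crot_cvec ..
  also have "rot (vector [0, \<epsilon> / R, \<sigma> * w / R]) (g * theta_fun \<alpha> r s) z = rot (mid_axis (- \<epsilon>) \<alpha> (v_fun \<alpha> s)) (theta_fun \<alpha> r s) z" for z
    using rot_sign_cancel[OF g(1), of "vector [0, \<epsilon> / R, \<sigma> * w / R]" "g * theta_fun \<alpha> r s" z] g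
    unfolding mid by (auto simp: mult.assoc[symmetric])
  finally show ?thesis using g\<sigma>(2) by (simp add: chi_formula_rot[OF _ \<epsilon>] defs(1))
qed

section \<open>Coefficients of a joint expansion in one variable\<close>

lemma power_series_zero_real:
  fixes d :: "nat \<Rightarrow> real"
  assumes \<delta>: "\<delta> > 0" and s: "\<And>x. \<bar>x\<bar> < \<delta> \<Longrightarrow> (\<lambda>l. d l * x ^ l) sums 0"
  shows "d l = 0"
proof (rule ccontr)
  assume ne: "d l \<noteq> 0"
  have "d 0 = 0" using s[of 0] \<delta> by (simp add: sums_iff)
  then have "l > 0" using ne by (cases l) auto
  show False
  proof (rule powser_0_nonzero[OF \<delta>, of 0 d "\<lambda>_. 0" l])
    show "(\<lambda>n. d n * (x - 0) ^ n) sums 0" if "norm (x - 0) < \<delta>" for x using s[of x] that by simp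
    fix e :: real assume "0 < e" "\<And>z::real. z \<in> cball 0 e - {0} \<Longrightarrow> (0::real) \<noteq> 0"
    from this(1) this(2)[of e] show False by simp
  qed (use ne \<open>l > 0\<close> in simp_all)
qed

lemma mpow_mdeg_prod:
  fixes m :: "'a::euclidean_space \<times> real \<Rightarrow> nat"
  shows "mpow (h, \<alpha>) m = mpow h (\<lambda>u\<in>Basis. m (u, 0)) * \<alpha> ^ m (0, 1)"
    "mdeg m = mdeg (\<lambda>u\<in>Basis. m (u, 0)) + m (0, 1)"
proof -
  have B: "(Basis :: ('a \<times> real) set) = (\<lambda>u. (u, 0)) ` Basis \<union> {(0, 1)}"
    by (auto simp: Basis_prod_def)
  have d: "(\<lambda>u::'a. (u, 0::real)) ` Basis \<inter> {(0, 1)} = {}" by auto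
  have i: "inj_on (\<lambda>u::'a. (u, 0::real)) Basis" by (auto simp: inj_on_def)
  show "mpow (h, \<alpha>) m = mpow h (\<lambda>u\<in>Basis. m (u, 0)) * \<alpha> ^ m (0, 1)"
    unfolding mpow_def B by (subst prod.union_disjoint) (use d in \<open>auto simp: prod.reindex[OF i]\<close>)
  show "mdeg m = mdeg (\<lambda>u\<in>Basis. m (u, 0)) + m (0, 1)"
    unfolding mdeg_def B by (subst sum.union_disjoint) (use d in \<open>auto simp: sum.reindex[OF i]\<close>)
qed

text \<open>Group the multi-index series by the exponent of the last variable.\<close>

lemma mseries_at_coefficient:
  fixes G :: "'a::euclidean_space \<times> real \<Rightarrow> real" and a :: "nat \<Rightarrow> 'a \<Rightarrow> real"
  assumes G: "mseries_at G (x0, 0)" and \<delta>: "\<delta> > 0"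
    and ser: "\<And>x \<alpha>. \<bar>\<alpha>\<bar> < \<delta> \<Longrightarrow> (\<lambda>l. \<alpha> ^ l * a l x) sums G (x, \<alpha>)"
  shows "mseries_at (a l) x0"
proof -
  obtain \<rho> K where "has_mseries \<rho> K (\<lambda>h. G ((x0, 0) + h))" using G by (auto simp: mseries_at_def)
  then obtain c S where \<rho>: "\<rho> > 0" and
    c: "((\<lambda>m. norm (c m) * \<rho> ^ mdeg m) has_sum S) multi_indices"
    "\<And>h. h \<in> mcube \<rho> \<Longrightarrow> ((\<lambda>m. mpow h m *\<^sub>R c m) has_sum G ((x0, 0) + h)) multi_indices"
    unfolding has_mseries_def by blast
  define I where "I l = {m \<in> multi_indices. m (0::'a, 1::real) = l}" for l :: nat
  define \<mu> where "\<mu> m = (\<lambda>u\<in>Basis. m (u, 0::real))" for m :: "'a \<times> real \<Rightarrow> nat"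
  define b where "b l h = infsum (\<lambda>m. mpow h (\<mu> m) *\<^sub>R c m) (I l)" for l h
  have mp: "mpow (h, \<alpha>) m = mpow h (\<mu> m) * \<alpha> ^ m (0, 1)" "mdeg m = mdeg (\<mu> m) + m (0, 1)" for h \<alpha> m
    unfolding \<mu>_def by (rule mpow_mdeg_prod)+
  have Ksum: "(\<lambda>m. norm (c m) * \<rho> ^ mdeg (\<mu> m)) summable_on I l" for l
  proof -
    have "(\<lambda>m. norm (c m) * \<rho> ^ mdeg m) summable_on I l"
      using has_sum_imp_summable[OF c(1)] by (rule summable_on_subset_banach) (auto simp: I_def)
    then have "(\<lambda>m. norm (c m) * \<rho> ^ mdeg m * (1 / \<rho> ^ l)) summable_on I l"
      by (rule summable_on_cmult_left)
    then show ?thesis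
      by (rule summable_on_cong[THEN iffD1, rotated]) (use \<rho> in \<open>simp add: I_def mp(2) power_add\<close>)
  qed
  define K where "K l = infsum (\<lambda>m. norm (c m) * \<rho> ^ mdeg (\<mu> m)) (I l)" for l
  have K: "((\<lambda>m. norm (c m) * \<rho> ^ mdeg (\<mu> m)) has_sum K l) (I l)" for l
    unfolding K_def by (rule has_sum_infsum[OF Ksum])
  have b: "((\<lambda>m. mpow h (\<mu> m) *\<^sub>R c m) has_sum b l h) (I l)" if "h \<in> mcube \<rho>" for h l
    unfolding b_def by (rule has_sum_infsum[OF abs_summable_summable[OF has_mseries_summable[OF K that]]])
  have bser: "has_mseries \<rho> (K l) (b l)"
    by (rule has_mseries_regroup[OF _ \<rho> K b]) (auto simp: \<mu>_def multi_indices_def)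
  \<comment> \<open>For fixed \<open>h\<close> the regrouped sums and the given coefficients expand
    the same function of the last variable, so they agree by uniqueness of power series.\<close>
  have eq: "b l h = a l (x0 + h)" if h: "h \<in> mcube \<rho>" for h
  proof -
    have "(\<lambda>l. (b l h - a l (x0 + h)) * \<alpha> ^ l) sums 0" if \<alpha>: "\<bar>\<alpha>\<bar> < min \<rho> \<delta>" for \<alpha>
    proof -
      have cube: "(h, \<alpha>) \<in> mcube \<rho>" using h \<alpha> by (auto simp: mcube_def Basis_prod_def)
      have inj: "inj_on snd (Sigma UNIV I)" by (auto simp: inj_on_def I_def)
      have MI: "multi_indices = snd ` Sigma UNIV I" by (force simp: I_def)
      have "((\<lambda>p. mpow (h, \<alpha>) (snd p) *\<^sub>R c (snd p)) has_sum G (x0 + h, \<alpha>)) (Sigma UNIV I)"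
        using c(2)[OF cube] unfolding MI has_sum_reindex[OF inj] by (simp add: o_def)
      then have "((\<lambda>l. \<alpha> ^ l * b l h) has_sum G (x0 + h, \<alpha>)) UNIV"
      proof (rule has_sum_SigmaD)
        fix l :: nat
        have "((\<lambda>m. \<alpha> ^ l * (mpow h (\<mu> m) *\<^sub>R c m)) has_sum \<alpha> ^ l * b l h) (I l)"
          by (rule has_sum_cmult_right[OF b[OF h]])
        then show "((\<lambda>y. mpow (h, \<alpha>) (snd (l, y)) *\<^sub>R c (snd (l, y))) has_sum \<alpha> ^ l * b l h) (I l)"
          by (rule has_sum_cong[THEN iffD1, rotated]) (simp add: mp(1) I_def)
      qed
      then have "(\<lambda>l. \<alpha> ^ l * b l h) sums G (x0 + h, \<alpha>)" by (rule has_sum_imp_sums)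
      from sums_diff[OF this ser[of \<alpha> "x0 + h"]] \<alpha> show ?thesis by (simp add: algebra_simps)
    qed
    then have "b l h - a l (x0 + h) = 0"
      by (rule power_series_zero_real[of "min \<rho> \<delta>", rotated]) (use \<rho> \<delta> in simp_all)
    then show ?thesis by simp
  qed
  have "has_mseries \<rho> (K l) (\<lambda>h. a l (x0 + h))"
    using bser eq by (rule has_mseries_cong)
  then show ?thesis unfolding mseries_at_def by blast
qed

lemma mseries_at_isCont:
  assumes "mseries_at f x" shows "isCont f x"
  unfolding continuous_at_eps_delta
proof (intro allI impI)
  fix e :: real assume e: "e > 0"
  obtain \<rho> K where "has_mseries \<rho> K (\<lambda>h. f (x + h))" using assms by (auto simp: mseries_at_def)
  then have \<rho>: "\<rho> > 0" and ser: "has_mseries \<rho> K (\<lambda>h. f (x + h))"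
    by (simp_all add: has_mseries_def)
  have "has_mseries \<rho> (K + norm (- f x)) (\<lambda>h. f (x + h) + - f x)"
    by (rule has_mseries_add[OF ser has_mseries_const[OF \<rho>]])
  from has_mseries_shrink[OF this, of "e / 2"] e obtain \<sigma> where
    \<sigma>: "\<sigma> > 0" "has_mseries \<sigma> (e / 2) (\<lambda>h. f (x + h) + - f x)" by auto
  have "dist (f y) (f x) < e" if "dist y x < \<sigma>" for y
  proof -
    have "y - x \<in> mcube \<sigma>" using that by (intro ball_subset_mcube) (simp add: dist_norm)
    from has_mseries_norm_le[OF \<sigma>(2) this] e show ?thesis by (simp add: dist_norm)
  qed
  then show "\<exists>d>0. \<forall>x'. dist x' x < d \<longrightarrow> dist (f x') (f x) < e" using \<sigma>(1) by blast
qed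

text \<open>Complex Taylor coefficients in \<alpha> at 0, componentwise, followed by the real part;
  for real \<alpha> the real part passes through the series.\<close>

definition chi_coeff :: "real \<Rightarrow> nat \<Rightarrow> real \<Rightarrow> real \<Rightarrow> real^3" where
  "chi_coeff \<epsilon> l s r = (let f = cx_chi \<epsilon> (of_real r) (of_real s);
     d = (\<lambda>g. (deriv ^^ l) g 0 / fact l) in
     re_vec (d (\<lambda>a. fst (f a)), d (\<lambda>a. fst (snd (f a))), d (\<lambda>a. snd (snd (f a)))))"

text \<open>The bounds on complex sine and cosine put the disc into \<open>cx_domain\<close> for all
  real \<open>s\<close>; the bound 1/4 serves the arc count in
  \<open>last_arc_bounds\<close>.\<close>

definition alpha_radius :: "real \<Rightarrow> bool" where
  "alpha_radius \<alpha>\<^sub>0 \<longleftrightarrow> 0 < \<alpha>\<^sub>0 \<and> \<alpha>\<^sub>0 \<le> 1 / 4 \<and>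
     (\<forall>a::complex. norm a < \<alpha>\<^sub>0 \<longrightarrow> norm (sin a) < 1 / 4 \<and> norm (cos a) > 1 / 2)"

lemma alpha_radius_exists: "\<exists>\<alpha>\<^sub>0. alpha_radius \<alpha>\<^sub>0"
proof -
  have "((\<lambda>a::complex. norm (sin a)) \<longlongrightarrow> norm (sin (0::complex))) (nhds 0)" "((\<lambda>a::complex. norm (cos a)) \<longlongrightarrow> norm (cos (0::complex))) (nhds 0)"
    by (intro tendsto_intros filterlim_ident)+
  then have "((\<lambda>a::complex. norm (sin a)) \<longlongrightarrow> 0) (nhds 0)" "((\<lambda>a::complex. norm (cos a)) \<longlongrightarrow> 1) (nhds 0)"
    by simp_all
  from order_tendstoD(2)[OF this(1), of "1/4"] order_tendstoD(1)[OF this(2), of "1/2"]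
  have "eventually (\<lambda>a::complex. norm (sin a) < 1 / 4 \<and> norm (cos a) > 1 / 2) (nhds 0)"
    by (simp add: eventually_conj)
  then obtain d where "d > 0" "\<And>a::complex. norm a < d \<Longrightarrow> norm (sin a) < 1 / 4 \<and> norm (cos a) > 1 / 2"
    unfolding eventually_nhds_metric by auto
  then show ?thesis unfolding alpha_radius_def by (intro exI[of _ "min d (1 / 4)"]) auto
qed

lemma cx_domain_real:
  assumes "alpha_radius \<alpha>\<^sub>0" "norm a < \<alpha>\<^sub>0"
  shows "cx_domain (of_real s) a"
proof -
  have "\<bar>sin s\<bar> < 2" "\<bar>cos s\<bar> < 2" using abs_sin_le_one[of s] abs_cos_le_one[of s] by linarith+
  then show ?thesis using assms by (simp add: cx_domain_def alpha_radius_def sin_of_real cos_of_real)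
qed

text \<open>The parameter \<open>s\<close> enters through its sine and cosine, except in
  \<open>cx_psi\<close>, where the shift changes the angle by a period. The hypotheses on
  \<open>c\<close> cover all integer multiples of the period.\<close>

lemma cx_chi_shift:
  assumes "sin (c::real) = 0" "cos c = 1"
  shows "cx_chi \<epsilon> r (s + of_real c) a = cx_chi \<epsilon> r s a"
proof -
  have c: "sin (complex_of_real c) = 0" "cos (complex_of_real c) = 1" using assms by (simp_all add: sin_of_real cos_of_real)
  have s: "sin (s + of_real c) = sin s" "cos (s + of_real c) = cos s" by (simp_all add: sin_add cos_add c)
  have w: "cx_w (s + of_real c) a = cx_w s a" by (simp add: cx_w_def s)
  have R: "cx_R (s + of_real c) a = cx_R s a" by (simp add: cx_R_def w)
  have t: "cx_theta r (s + of_real c) a = cx_theta r s a" by (simp add: cx_theta_def R)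
  have p: "cx_psi r (s + of_real c) a = cx_psi r s a - of_real c" by (simp add: cx_psi_def w)
  have "sin (cx_psi r s a - of_real c) = sin (cx_psi r s a)" "cos (cx_psi r s a - of_real c) = cos (cx_psi r s a)"
    by (simp_all add: sin_diff cos_diff c)
  then show ?thesis unfolding cx_chi_def w R t p by (simp add: crot_def s)
qed

lemma mseries_at_of_real_linear:
  "linear l \<Longrightarrow> mseries_at (\<lambda>x. complex_of_real (l x)) x"
  by (intro mseries_at_linear linear_compose[of l of_real, unfolded o_def]) (auto intro: bounded_linear.linear bounded_linear_of_real)

lemma re_vec_tendsto:
  assumes "((\<lambda>t. fst (f t)) \<longlongrightarrow> fst y) F" "((\<lambda>t. fst (snd (f t))) \<longlongrightarrow> fst (snd y)) F"
    "((\<lambda>t. snd (snd (f t))) \<longlongrightarrow> snd (snd y)) F"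
  shows "((\<lambda>t. re_vec (f t)) \<longlongrightarrow> re_vec y) F"
  unfolding re_vec_def case_prod_unfold by (intro tendsto_intros assms)

lemma Re_mult_of_real_power: "Re (z * (of_real x - 0) ^ n) = x ^ n * Re z"
  by (simp add: of_real_power[symmetric] del: of_real_power)

lemma chi_coeff_shift:
  assumes "sin c = 0" "cos c = 1"
  shows "chi_coeff \<epsilon> l (s + c) r = chi_coeff \<epsilon> l s r"
  unfolding chi_coeff_def Let_def of_real_add cx_chi_shift[OF assms] ..

context
  fixes \<alpha>\<^sub>0 \<epsilon> :: real
  assumes radius: "alpha_radius \<alpha>\<^sub>0" and \<epsilon>: "\<bar>\<epsilon>\<bar> = 1"
begin

lemma cx_chi_holomorphic_alpha:
  "(\<lambda>a. fst (cx_chi \<epsilon> (of_real r) (of_real s) a)) holomorphic_on ball 0 \<alpha>\<^sub>0"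
  "(\<lambda>a. fst (snd (cx_chi \<epsilon> (of_real r) (of_real s) a))) holomorphic_on ball 0 \<alpha>\<^sub>0"
  "(\<lambda>a. snd (snd (cx_chi \<epsilon> (of_real r) (of_real s) a))) holomorphic_on ball 0 \<alpha>\<^sub>0"
  by (rule holomorphic_cx_chi[of "ball 0 \<alpha>\<^sub>0" "\<lambda>_. of_real r" "\<lambda>_. of_real s" "\<lambda>a. a"];
      use cx_domain_real[OF radius] in \<open>auto intro: holomorphic_intros\<close>)+

text \<open>At \<open>\<alpha> = 0\<close> the limit defining \<open>chi\<close> is evaluated by
  continuity of the holomorphic extension.\<close>

lemma chi_eq_cx_chi:
  assumes \<alpha>: "\<bar>\<alpha>\<bar> < \<alpha>\<^sub>0"
  shows "chi \<epsilon> \<alpha> r s = re_vec (cx_chi \<epsilon> (of_real r) (of_real s) (of_real \<alpha>))"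
proof -
  have a0: "\<alpha>\<^sub>0 > 0" "\<alpha>\<^sub>0 \<le> 1 / 4" using radius by (auto simp: alpha_radius_def)
  have ne: "chi_formula \<epsilon> a r s = re_vec (cx_chi \<epsilon> (of_real r) (of_real s) (of_real a))"
    if "a \<noteq> 0" "\<bar>a\<bar> < \<alpha>\<^sub>0" for a
  proof -
    have "\<bar>a\<bar> < pi / 2" using that a0 pi_gt3 by linarith
    moreover have "cx_domain (of_real s) (of_real a)" using cx_domain_real[OF radius] that by simp
    ultimately show ?thesis using chi_formula_cx_chi[OF that(1) _ _ \<epsilon>] by simp
  qed
  show ?thesis
  proof (cases "\<alpha> = 0")
    case False
    then show ?thesis using ne \<alpha> by (simp add: chi_def)
  next
    case True
    have lim: "((\<lambda>a::real. g (of_real a)) \<longlongrightarrow> g (of_real 0)) (at 0)" if "g holomorphic_on ball 0 \<alpha>\<^sub>0" for g :: "complex \<Rightarrow> complex"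
    proof -
      have "isCont g (of_real 0)"
        using holomorphic_on_imp_continuous_on[OF that] a0 by (simp add: continuous_on_eq_continuous_at)
      then show ?thesis by (rule isCont_tendsto_compose) (auto intro: tendsto_eq_intros)
    qed
    have "((\<lambda>a. re_vec (cx_chi \<epsilon> (of_real r) (of_real s) (of_real a))) \<longlongrightarrow> re_vec (cx_chi \<epsilon> (of_real r) (of_real s) (of_real 0))) (at 0)"
      by (intro re_vec_tendsto cx_chi_holomorphic_alpha[THEN lim])
    moreover have "eventually (\<lambda>a. re_vec (cx_chi \<epsilon> (of_real r) (of_real s) (of_real a)) = chi_formula \<epsilon> a r s) (at 0)"
      unfolding eventually_at
    proof (intro exI[of _ \<alpha>\<^sub>0] conjI ballI impI a0(1))
      fix a :: real assume "a \<noteq> 0 \<and> dist a 0 < \<alpha>\<^sub>0"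
      then show "re_vec (cx_chi \<epsilon> (of_real r) (of_real s) (of_real a)) = chi_formula \<epsilon> a r s"
        by (intro ne[symmetric]) (simp_all add: dist_norm)
    qed
    ultimately have "((\<lambda>a. chi_formula \<epsilon> a r s) \<longlongrightarrow> re_vec (cx_chi \<epsilon> (of_real r) (of_real s) (of_real 0))) (at 0)"
      by (rule Lim_transform_eventually)
    then show ?thesis by (simp add: chi_def True tendsto_Lim)
  qed
qed

text \<open>A holomorphic function equals its Taylor series on the whole disc of holomorphy, which
  is the same for all \<open>r\<close> and \<open>s\<close>.\<close>

lemma chi_sums:
  assumes \<alpha>: "\<bar>\<alpha>\<bar> < \<alpha>\<^sub>0"
  shows "(\<lambda>l. \<alpha> ^ l *\<^sub>R chi_coeff \<epsilon> l s r) sums chi \<epsilon> \<alpha> r s"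
proof -
  have "(of_real \<alpha> :: complex) \<in> ball 0 \<alpha>\<^sub>0" using \<alpha> by simp
  note ser = cx_chi_holomorphic_alpha[THEN holomorphic_power_series, OF this, THEN sums_Re, THEN sums_scaleR_left]
  have eq: "\<alpha> ^ l *\<^sub>R chi_coeff \<epsilon> l s r =
     Re ((deriv ^^ l) (\<lambda>a. fst (cx_chi \<epsilon> (of_real r) (of_real s) a)) 0 / fact l * (of_real \<alpha> - 0) ^ l) *\<^sub>R axis 1 1
     + Re ((deriv ^^ l) (\<lambda>a. fst (snd (cx_chi \<epsilon> (of_real r) (of_real s) a))) 0 / fact l * (of_real \<alpha> - 0) ^ l) *\<^sub>R axis 2 1
     + Re ((deriv ^^ l) (\<lambda>a. snd (snd (cx_chi \<epsilon> (of_real r) (of_real s) a))) 0 / fact l * (of_real \<alpha> - 0) ^ l) *\<^sub>R axis 3 1" for l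
    unfolding Re_mult_of_real_power chi_coeff_def Let_def re_vec_def prod.case by (simp only: scaleR_add_right scaleR_scaleR)
  show ?thesis unfolding chi_eq_cx_chi[OF \<alpha>] eq unfolding re_vec_def case_prod_unfold
    by (intro sums_add ser)
qed

lemma chi_mseries_at:
  assumes \<alpha>: "\<bar>\<alpha>\<bar> < \<alpha>\<^sub>0"
  shows "mseries_at (\<lambda>(r, s, \<alpha>). chi \<epsilon> \<alpha> r s) (r, s, \<alpha>)"
proof (rule mseries_at_cong)
  have lin: "linear (fst :: real \<times> real \<times> real \<Rightarrow> real)" "linear (\<lambda>x :: real \<times> real \<times> real. fst (snd x))"
    "linear (\<lambda>x :: real \<times> real \<times> real. snd (snd x))" by (auto intro!: linearI)
  show "mseries_at (\<lambda>x. re_vec (cx_chi \<epsilon> (of_real (fst x)) (of_real (fst (snd x))) (of_real (snd (snd x))))) (r, s, \<alpha>)"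
    by (intro mseries_at_re_vec mseries_at_cx_chi mseries_at_of_real_linear lin)
       (use cx_domain_real[OF radius] \<alpha> in auto)
  have "open {x :: real \<times> real \<times> real. \<bar>snd (snd x)\<bar> < \<alpha>\<^sub>0}"
    by (intro open_Collect_less continuous_intros)
  then have "\<forall>\<^sub>F y in nhds (r, s, \<alpha>). \<bar>snd (snd y)\<bar> < \<alpha>\<^sub>0"
    using \<alpha> unfolding eventually_nhds by (intro exI[of _ "{x. \<bar>snd (snd x)\<bar> < \<alpha>\<^sub>0}"]) auto
  then show "\<forall>\<^sub>F y in nhds (r, s, \<alpha>). re_vec (cx_chi \<epsilon> (of_real (fst y)) (of_real (fst (snd y))) (of_real (snd (snd y)))) =
     (case y of (r, s, \<alpha>) \<Rightarrow> chi \<epsilon> \<alpha> r s)"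
    by eventually_elim (auto simp: chi_eq_cx_chi)
qed

lemma chi_coeff_mseries_at: "mseries_at (\<lambda>(s, r). chi_coeff \<epsilon> l s r) (s0, r0)"
proof -
  have lin: "linear (\<lambda>x :: (real \<times> real) \<times> real. fst (fst x))" "linear (\<lambda>x :: (real \<times> real) \<times> real. snd (fst x))"
    "linear (\<lambda>x :: (real \<times> real) \<times> real. snd x)" by (auto intro!: linearI)
  have a0: "\<alpha>\<^sub>0 > 0" using radius by (simp add: alpha_radius_def)
  have coeff: "mseries_at (\<lambda>x. Re ((deriv ^^ l) (\<lambda>a. pr (cx_chi \<epsilon> (of_real (snd x)) (of_real (fst x)) a)) 0 / fact l) *\<^sub>R v) (s0, r0)"
    if hol: "\<And>r s. (\<lambda>a. pr (cx_chi \<epsilon> (of_real r) (of_real s) a)) holomorphic_on ball 0 \<alpha>\<^sub>0"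
      and ms: "mseries_at (\<lambda>x :: (real \<times> real) \<times> real. pr (cx_chi \<epsilon> (of_real (snd (fst x))) (of_real (fst (fst x))) (of_real (snd x)))) ((s0, r0), 0)"
    for pr :: "cvec3 \<Rightarrow> complex" and v :: "real^3"
  proof -
    have "mseries_at (\<lambda>x. Re ((deriv ^^ l) (\<lambda>a. pr (cx_chi \<epsilon> (of_real (snd x)) (of_real (fst x)) a)) 0 / fact l)) (s0, r0)"
    proof (rule mseries_at_coefficient[OF mseries_at_bounded_linear[OF ms bounded_linear_Re] a0])
      fix x :: "real \<times> real" and \<alpha> :: real assume \<alpha>: "\<bar>\<alpha>\<bar> < \<alpha>\<^sub>0"
      then have "(of_real \<alpha> :: complex) \<in> ball 0 \<alpha>\<^sub>0" by simp
      from sums_Re[OF holomorphic_power_series[OF hol[of "snd x" "fst x"] this]]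
      show "(\<lambda>l. \<alpha> ^ l * Re ((deriv ^^ l) (\<lambda>a. pr (cx_chi \<epsilon> (of_real (snd x)) (of_real (fst x)) a)) 0 / fact l)) sums
        Re (pr (cx_chi \<epsilon> (of_real (snd (fst (x, \<alpha>)))) (of_real (fst (fst (x, \<alpha>)))) (of_real (snd (x, \<alpha>)))))"
        unfolding Re_mult_of_real_power fst_conv snd_conv .
    qed
    from mseries_at_bounded_linear[OF this bounded_linear_scaleR_left] show ?thesis .
  qed
  have ms: "mseries_at (\<lambda>x :: (real \<times> real) \<times> real. fst (cx_chi \<epsilon> (of_real (snd (fst x))) (of_real (fst (fst x))) (of_real (snd x)))) ((s0, r0), 0)"
    "mseries_at (\<lambda>x :: (real \<times> real) \<times> real. fst (snd (cx_chi \<epsilon> (of_real (snd (fst x))) (of_real (fst (fst x))) (of_real (snd x))))) ((s0, r0), 0)"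
    "mseries_at (\<lambda>x :: (real \<times> real) \<times> real. snd (snd (cx_chi \<epsilon> (of_real (snd (fst x))) (of_real (fst (fst x))) (of_real (snd x))))) ((s0, r0), 0)"
    by (intro mseries_at_cx_chi mseries_at_of_real_linear lin; use cx_domain_real[OF radius] a0 in auto)+
  show ?thesis
    unfolding chi_coeff_def Let_def re_vec_def case_prod_unfold fst_conv snd_conv
    by (intro mseries_at_add)
       (rule coeff[where pr=fst, OF cx_chi_holomorphic_alpha(1) ms(1)]
             coeff[where pr="\<lambda>z. fst (snd z)", OF cx_chi_holomorphic_alpha(2) ms(2)]
             coeff[where pr="\<lambda>z. snd (snd z)", OF cx_chi_holomorphic_alpha(3) ms(3)])+
qed

lemma chi_coeff_bounded: "bounded ((\<lambda>(s, r). chi_coeff \<epsilon> l s r) ` (UNIV \<times> {0..1}))"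
proof (rule bounded_subset)
  let ?f = "\<lambda>(s, r). chi_coeff \<epsilon> l s r"
  have "continuous_on ({0..2 * pi} \<times> {0..1}) ?f"
    by (intro continuous_at_imp_continuous_on ballI) (use mseries_at_isCont[OF chi_coeff_mseries_at] in auto)
  then show "bounded (?f ` ({0..2 * pi} \<times> {0..1}))"
    by (intro compact_imp_bounded compact_continuous_image compact_Times) auto
  show "?f ` (UNIV \<times> {0..1}) \<subseteq> ?f ` ({0..2 * pi} \<times> {0..1})"
  proof
    fix y assume "y \<in> ?f ` (UNIV \<times> {0..1})"
    then obtain s r where y: "y = chi_coeff \<epsilon> l s r" "r \<in> {0..1}" by auto
    define n where "n = \<lfloor>s / (2 * pi)\<rfloor>"
    \<comment> \<open>The multiple of the period moving \<open>s\<close> into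
      \<open>[0, 2 * pi]\<close>, so that compactness bounds the values.\<close>
    define c where "c = 2 * pi * of_int (- n)"
    have c: "sin c = 0" "cos c = 1" unfolding c_def by (simp_all only: sin_int_2pin cos_int_2pin)
    have "of_int n \<le> s / (2 * pi)" "s / (2 * pi) \<le> of_int n + 1"
      unfolding n_def by linarith+
    then have "s + c \<in> {0..2 * pi}" by (simp add: c_def field_simps)
    then show "y \<in> ?f ` ({0..2 * pi} \<times> {0..1})"
      unfolding y(1) chi_coeff_shift[OF c, symmetric, where l=l and s=s and r=r] using y(2)
      by (intro image_eqI[of _ _ "(s + c, r)"]) auto
  qed
qed

end

text \<open>Along the real line complex and real derivatives agree. Openness of \<open>W\<close>
  lets the induction differentiate an identity known only on \<open>W\<close>.\<close>

lemma iterated_vector_derivative_re_vec: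
  assumes U: "open U" and g: "g1 holomorphic_on U" "g2 holomorphic_on U" "g3 holomorphic_on U" and W: "open W"
    and \<phi>: "\<And>t. t \<in> W \<Longrightarrow> of_real t \<in> U \<and> \<phi> t = re_vec (g1 (of_real t), g2 (of_real t), g3 (of_real t))"
    and t: "t \<in> W"
  shows "((\<lambda>g u. vector_derivative g (at u)) ^^ n) \<phi> t =
    re_vec ((deriv ^^ n) g1 (of_real t), (deriv ^^ n) g2 (of_real t), (deriv ^^ n) g3 (of_real t))"
  using t
proof (induction n arbitrary: t)
  case 0
  then show ?case using \<phi> by simp
next
  case (Suc n)
  have U': "of_real t \<in> U" using \<phi> Suc.prems by simp
  have d: "((\<lambda>t. Re ((deriv ^^ n) g (of_real t)) *\<^sub>R v) has_vector_derivative Re ((deriv ^^ Suc n) g (of_real t)) *\<^sub>R v) (at t)"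
    if "g holomorphic_on U" for g and v :: "real^3"
  proof -
    have "((deriv ^^ n) g has_field_derivative (deriv ^^ Suc n) g (of_real t)) (at (of_real t))"
      using holomorphic_derivI[OF holomorphic_higher_deriv[OF that U] U U'] by simp
    then have "((\<lambda>x. (deriv ^^ n) g (of_real x)) has_vector_derivative (deriv ^^ Suc n) g (of_real t)) (at t)"
      by (rule has_vector_derivative_real_field)
    from bounded_linear.has_vector_derivative[OF bounded_linear_compose[OF bounded_linear_scaleR_left[of v] bounded_linear_Re] this]
    show ?thesis .
  qed
  have "((\<lambda>t. re_vec ((deriv ^^ n) g1 (of_real t), (deriv ^^ n) g2 (of_real t), (deriv ^^ n) g3 (of_real t)))
    has_vector_derivative re_vec ((deriv ^^ Suc n) g1 (of_real t), (deriv ^^ Suc n) g2 (of_real t), (deriv ^^ Suc n) g3 (of_real t))) (at t)"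
    unfolding re_vec_def prod.case by (intro has_vector_derivative_add d g)
  then have "(((\<lambda>g u. vector_derivative g (at u)) ^^ n) \<phi> has_vector_derivative re_vec ((deriv ^^ Suc n) g1 (of_real t), (deriv ^^ Suc n) g2 (of_real t), (deriv ^^ Suc n) g3 (of_real t))) (at t)"
    by (rule has_vector_derivative_transform_within_open[OF _ W Suc.prems]) (simp add: Suc.IH)
  then show ?case by (simp add: vector_derivative_at)
qed

lemma iterated_vector_derivative_isCont:
  assumes U: "open U" and g: "g1 holomorphic_on U" "g2 holomorphic_on U" "g3 holomorphic_on U" and W: "open W"
    and \<phi>: "\<And>t. t \<in> W \<Longrightarrow> of_real t \<in> U \<and> \<phi> t = re_vec (g1 (of_real t), g2 (of_real t), g3 (of_real t))"
    and t: "t \<in> W"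
  shows "isCont (((\<lambda>g u. vector_derivative g (at u)) ^^ n) \<phi>) t"
proof -
  have c: "isCont (\<lambda>t. Re ((deriv ^^ n) g (of_real t)) *\<^sub>R v) t" if "g holomorphic_on U" for g and v :: "real^3"
  proof -
    have "isCont ((deriv ^^ n) g) (of_real t)"
      using holomorphic_on_imp_continuous_on[OF holomorphic_higher_deriv[OF that U]] \<phi>[OF t] U
      by (simp add: continuous_on_eq_continuous_at)
    then have "isCont (\<lambda>t. (deriv ^^ n) g (of_real t)) t"
      by (intro isCont_o2[where g="(deriv ^^ n) g" and f=of_real] continuous_intros)
    then show ?thesis by (intro continuous_scaleR continuous_Re continuous_const)
  qed
  have "isCont (\<lambda>t. re_vec ((deriv ^^ n) g1 (of_real t), (deriv ^^ n) g2 (of_real t), (deriv ^^ n) g3 (of_real t))) t"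
    unfolding re_vec_def prod.case by (intro continuous_add c g)
  moreover have "\<forall>\<^sub>F t in nhds t. re_vec ((deriv ^^ n) g1 (of_real t), (deriv ^^ n) g2 (of_real t), (deriv ^^ n) g3 (of_real t)) = ((\<lambda>g u. vector_derivative g (at u)) ^^ n) \<phi> t"
    unfolding eventually_nhds
    using iterated_vector_derivative_re_vec[OF U g W \<phi>] W t by (intro exI[of _ W]) auto
  ultimately show ?thesis by (simp add: isCont_cong)
qed

section \<open>The front as a curve\<close>

text \<open>Defined for every real \<open>t\<close>, it continues an arc analytically across its end
  points, as piecewise analyticity on closed intervals requires. The shift \<open>c\<close> is the
  place of the arc on the joint curve.\<close>

definition arc_ext :: "real \<Rightarrow> real \<Rightarrow> real \<Rightarrow> real \<Rightarrow> real^3" where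
  "arc_ext \<epsilon> \<alpha> c t = re_vec (cx_chi \<epsilon> (of_real (r_M \<alpha>)) (of_real t - of_real c) (of_real \<alpha>))"

context
  fixes \<alpha>\<^sub>0 \<alpha> :: real
  assumes radius: "alpha_radius \<alpha>\<^sub>0" and \<alpha>: "0 < \<alpha>" "\<alpha> < \<alpha>\<^sub>0"
begin

lemma arc_ext_mseries_at: "mseries_at (arc_ext \<epsilon> \<alpha> c) t"
proof -
  have "mseries_at (\<lambda>t. complex_of_real t + - of_real c) t"
    by (intro mseries_at_add mseries_at_of_real_linear mseries_at_const linear_ident)
  then have s: "mseries_at (\<lambda>t. complex_of_real t - of_real c) t" by simp
  have "cx_domain (complex_of_real t - of_real c) (of_real \<alpha>)"
    using cx_domain_real[OF radius, of "of_real \<alpha>" "t - c"] \<alpha> by simp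
  then show ?thesis unfolding arc_ext_def
    by (intro mseries_at_re_vec mseries_at_cx_chi mseries_at_const s)
qed

lemma arc_ext_derivative_isCont:
  assumes W: "open W" "t \<in> W" and eq: "\<And>t. t \<in> W \<Longrightarrow> \<phi> t = arc_ext \<epsilon> \<alpha> c t"
  shows "isCont (((\<lambda>g u. vector_derivative g (at u)) ^^ n) \<phi>) t"
proof -
  \<comment> \<open>An open complex neighbourhood of the entire real line on which the shifted
    parameter stays in \<open>cx_domain\<close>.\<close>
  define U where "U = {z::complex. norm (sin (z - of_real c)) < 2 \<and> norm (cos (z - of_real c)) < 2}"
  have U: "open U" unfolding U_def by (intro open_Collect_conj open_Collect_less continuous_intros)
  have dom: "cx_domain (z - of_real c) (of_real \<alpha>)" if "z \<in> U" for z
    using that radius \<alpha> unfolding U_def cx_domain_def alpha_radius_def by auto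
  have real: "of_real t \<in> U" for t
    using cx_domain_real[OF radius, of "of_real \<alpha>" "t - c"] \<alpha> by (simp add: U_def cx_domain_def)
  let ?f = "\<lambda>z. cx_chi \<epsilon> (of_real (r_M \<alpha>)) (z - of_real c) (of_real \<alpha>)"
  have hol: "(\<lambda>z. fst (?f z)) holomorphic_on U" "(\<lambda>z. fst (snd (?f z))) holomorphic_on U"
    "(\<lambda>z. snd (snd (?f z))) holomorphic_on U"
    by (intro holomorphic_cx_chi U holomorphic_intros dom; assumption)+
  show ?thesis
    by (rule iterated_vector_derivative_isCont[OF U hol W(1) _ W(2)]) (simp add: real eq arc_ext_def)
qed

lemma front_arc_eq: "\<epsilon> \<in> {1, -1} \<Longrightarrow> front_arc \<epsilon> \<alpha> (t - c) = arc_ext \<epsilon> \<alpha> c t"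
  using \<alpha> by (auto simp: front_arc_def arc_ext_def chi_eq_cx_chi[OF radius])

context
  assumes k: "odd (k_M \<alpha>)"
begin

lemma alpha_small: "\<alpha> < 1 / 4" "\<alpha> < pi / 4"
  using radius \<alpha> pi_gt3 by (auto simp: alpha_radius_def)

lemma front_arc_junction: "\<epsilon> \<in> {1, -1} \<Longrightarrow> front_arc \<epsilon> \<alpha> 0 = front_arc (- \<epsilon>) \<alpha> pi"
  using chi_formula_junction[OF \<alpha>(1) alpha_small(2) _ k, of \<epsilon>] \<alpha> by (simp add: front_arc_def chi_def)

lemma front_curve_first: "t \<le> pi \<Longrightarrow> front_curve \<alpha> t = arc_ext 1 \<alpha> 0 t"
  using front_arc_eq[of 1 t 0] by (simp add: front_curve_def)

lemma front_curve_second: "pi \<le> t \<Longrightarrow> front_curve \<alpha> t = arc_ext (-1) \<alpha> pi t"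
proof (cases "t = pi")
  case True
  have "front_curve \<alpha> pi = front_arc 1 \<alpha> pi" by (simp add: front_curve_def)
  \<comment> \<open>At \<open>t = pi\<close> the curve is defined by the first arc, so the second
    description needs the junction identity.\<close>
  also have "\<dots> = front_arc (-1) \<alpha> (pi - pi)" using front_arc_junction[of "-1"] by simp
  finally show ?thesis unfolding True by (simp only: front_arc_eq insert_iff simp_thms)
next
  case False
  then show "pi \<le> t \<Longrightarrow> ?thesis" using front_arc_eq[of "-1" t pi] by (simp add: front_curve_def)
qed

lemma front_curve_image: "front_curve \<alpha> ` {0..2 * pi} = (\<Union>\<epsilon>\<in>{1, -1}. front_arc \<epsilon> \<alpha> ` {0<..pi})"
proof (intro equalityI subsetI)
  fix y assume "y \<in> front_curve \<alpha> ` {0..2 * pi}"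
  then obtain t where t: "y = front_curve \<alpha> t" "0 \<le> t" "t \<le> 2 * pi" by auto
  consider "t = 0" | "0 < t" "t \<le> pi" | "pi < t" using t by linarith
  then show "y \<in> (\<Union>\<epsilon>\<in>{1, -1}. front_arc \<epsilon> \<alpha> ` {0<..pi})"
  proof cases
    case 1
    then have "y = front_arc (-1) \<alpha> pi" using t front_arc_junction[of 1] by (simp add: front_curve_def)
    then show ?thesis by (intro UN_I[of "-1"] image_eqI[of _ _ pi]) simp_all
  next
    case 2
    then show ?thesis using t by (intro UN_I[of 1] image_eqI[of _ _ t]) (simp_all add: front_curve_def)
  next
    case 3
    then show ?thesis using t by (intro UN_I[of "-1"] image_eqI[of _ _ "t - pi"]) (simp_all add: front_curve_def)
  qed
next
  fix y assume "y \<in> (\<Union>\<epsilon>\<in>{1, -1}. front_arc \<epsilon> \<alpha> ` {0<..pi})"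
  then obtain \<epsilon> where e: "\<epsilon> \<in> {1, -1}" "y \<in> front_arc \<epsilon> \<alpha> ` {0<..pi}" by (rule UN_E)
  from e(2) obtain s where s: "y = front_arc \<epsilon> \<alpha> s" "s \<in> {0<..pi}" by (rule imageE)
  show "y \<in> front_curve \<alpha> ` {0..2 * pi}"
  proof (cases "\<epsilon> = 1")
    case True
    then show ?thesis using s by (intro image_eqI[of _ _ s]) (simp_all add: front_curve_def)
  next
    case False
    then show ?thesis using s e(1) by (intro image_eqI[of _ _ "s + pi"]) (simp_all add: front_curve_def)
  qed
qed

lemma front_curve_continuous: "continuous_on {0..2 * pi} (front_curve \<alpha>)"
proof -
  have c: "continuous_on S (arc_ext \<epsilon> \<alpha> c)" for S \<epsilon> c
    by (intro continuous_at_imp_continuous_on ballI mseries_at_isCont arc_ext_mseries_at)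
  have "continuous_on ({0..pi} \<union> {pi..2 * pi}) (front_curve \<alpha>)"
  proof (rule continuous_on_closed_Un)
    show "continuous_on {0..pi} (front_curve \<alpha>)"
      by (rule continuous_on_eq[OF c[of _ 1 0]]) (simp add: front_curve_first)
    show "continuous_on {pi..2 * pi} (front_curve \<alpha>)"
      by (rule continuous_on_eq[OF c[of _ "-1" pi]]) (simp add: front_curve_second)
  qed simp_all
  moreover have "{0..pi} \<union> {pi..2 * pi} = {0..2 * pi}" by auto
  ultimately show ?thesis by simp
qed

lemma front_curve_piecewise: "piecewise_analytic_on (front_curve \<alpha>) 0 (2 * pi) {0, pi, 2 * pi}"
  unfolding piecewise_analytic_on_def
proof (intro conjI allI impI front_curve_continuous)
  fix c d :: real assume cd: "0 \<le> c \<and> c < d \<and> d \<le> 2 * pi \<and> {c<..<d} \<inter> {0, pi, 2 * pi} = {}"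
  then have "pi \<notin> {c<..<d}" by blast
  then consider "d \<le> pi" | "pi \<le> c" by force
  then show "\<exists>g. g real_analytic_on {c..d} \<and> (\<forall>t\<in>{c..d}. front_curve \<alpha> t = g t)"
  proof cases
    case 1
    then show ?thesis
      by (intro exI[of _ "arc_ext 1 \<alpha> 0"] conjI real_analytic_onI arc_ext_mseries_at) (simp add: front_curve_first)
  next
    case 2
    then show ?thesis
      by (intro exI[of _ "arc_ext (-1) \<alpha> pi"] conjI real_analytic_onI arc_ext_mseries_at) (simp add: front_curve_second)
  qed
qed simp

lemma front_curve_derivatives:
  assumes "t \<in> {0<..<2 * pi} - {pi}"
  shows "isCont (((\<lambda>g u. vector_derivative g (at u)) ^^ n) (front_curve \<alpha>)) t"
proof (cases "t < pi")
  case True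
  then show ?thesis by (intro arc_ext_derivative_isCont[of "{..<pi}" _ _ 1 0]) (simp_all add: front_curve_first)
next
  case False
  then show ?thesis using assms
    by (intro arc_ext_derivative_isCont[of "{pi<..}" _ _ "-1" pi]) (simp_all add: front_curve_second)
qed

lemma front_eq_curve: "extremal_front \<alpha> (of_int (k_M \<alpha>) * pi) = front_curve \<alpha> ` {0..2 * pi}"
proof -
  have "front_arc \<epsilon> \<alpha> = chi_formula \<epsilon> \<alpha> (r_M \<alpha>)" for \<epsilon>
    using \<alpha> by (intro ext) (simp add: front_arc_def chi_def)
  then show ?thesis unfolding front_curve_image extremal_front_eq[OF \<alpha>(1) alpha_small(1) k] by simp
qed

lemma front_curve_closed: "front_curve \<alpha> (2 * pi) = front_curve \<alpha> 0"
  using front_arc_junction[of 1] by (simp add: front_curve_def)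

end

end

theorem lemma2:
  shows "\<exists>\<alpha>\<^sub>0>0.
    (\<forall>\<epsilon>\<in>{1, -1::real}.
       (\<lambda>(r, s, \<alpha>). chi \<epsilon> \<alpha> r s) real_analytic_on (UNIV \<times> UNIV \<times> {-\<alpha>\<^sub>0<..<\<alpha>\<^sub>0}) \<and>
       (\<exists>f :: nat \<Rightarrow> real \<Rightarrow> real \<Rightarrow> real^3.
          (\<forall>l. (\<lambda>(s, r). f l s r) real_analytic_on UNIV \<and>
               (\<forall>s r. f l (s + 2 * pi) r = f l s r) \<and>
               bounded ((\<lambda>(s, r). f l s r) ` (UNIV \<times> {0..1}))) \<and>
          (\<forall>\<alpha> r s. \<bar>\<alpha>\<bar> < \<alpha>\<^sub>0 \<longrightarrow> (\<lambda>l. \<alpha> ^ l *\<^sub>R f l s r) sums chi \<epsilon> \<alpha> r s))) \<and>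
    (\<forall>\<alpha>. 0 < \<alpha> \<and> \<alpha> < \<alpha>\<^sub>0 \<and> odd (k_M \<alpha>) \<longrightarrow>
       extremal_front \<alpha> (of_int (k_M \<alpha>) * pi) = front_curve \<alpha> ` {0..2 * pi} \<and>
       continuous_on {0..2 * pi} (front_curve \<alpha>) \<and>
       front_curve \<alpha> (2 * pi) = front_curve \<alpha> 0 \<and>
       piecewise_analytic_on (front_curve \<alpha>) 0 (2 * pi) {0, pi, 2 * pi} \<and>
       (\<forall>n\<ge>1. \<forall>t\<in>{0<..<2 * pi} - {pi}.
          isCont (((\<lambda>g u. vector_derivative g (at u)) ^^ n) (front_curve \<alpha>)) t))"
proof -
  obtain \<alpha>\<^sub>0 where radius: "alpha_radius \<alpha>\<^sub>0" using alpha_radius_exists by blast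
  show ?thesis
  proof (intro exI[of _ \<alpha>\<^sub>0] conjI ballI)
    show "\<alpha>\<^sub>0 > 0" using radius by (simp add: alpha_radius_def)
    fix \<epsilon> :: real assume "\<epsilon> \<in> {1, -1}"
    then have \<epsilon>: "\<bar>\<epsilon>\<bar> = 1" by auto
    show "(\<lambda>(r, s, \<alpha>). chi \<epsilon> \<alpha> r s) real_analytic_on (UNIV \<times> UNIV \<times> {-\<alpha>\<^sub>0<..<\<alpha>\<^sub>0})"
    proof (rule real_analytic_onI)
      fix x :: "real \<times> real \<times> real" assume "x \<in> UNIV \<times> UNIV \<times> {-\<alpha>\<^sub>0<..<\<alpha>\<^sub>0}"
      then obtain r s \<alpha> where x: "x = (r, s, \<alpha>)" and "\<bar>\<alpha>\<bar> < \<alpha>\<^sub>0" by (cases x) auto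
      then show "mseries_at (\<lambda>(r, s, \<alpha>). chi \<epsilon> \<alpha> r s) x"
        unfolding x by (intro chi_mseries_at[OF radius \<epsilon>])
    qed
    show "\<exists>f :: nat \<Rightarrow> real \<Rightarrow> real \<Rightarrow> real^3.
          (\<forall>l. (\<lambda>(s, r). f l s r) real_analytic_on UNIV \<and>
               (\<forall>s r. f l (s + 2 * pi) r = f l s r) \<and>
               bounded ((\<lambda>(s, r). f l s r) ` (UNIV \<times> {0..1}))) \<and>
          (\<forall>\<alpha> r s. \<bar>\<alpha>\<bar> < \<alpha>\<^sub>0 \<longrightarrow> (\<lambda>l. \<alpha> ^ l *\<^sub>R f l s r) sums chi \<epsilon> \<alpha> r s)"
    proof (intro exI[of _ "chi_coeff \<epsilon>"] conjI allI impI)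
      fix l :: nat and s r :: real
      show "(\<lambda>(s, r). chi_coeff \<epsilon> l s r) real_analytic_on UNIV"
      proof (rule real_analytic_onI)
        fix x :: "real \<times> real"
        show "mseries_at (\<lambda>(s, r). chi_coeff \<epsilon> l s r) x"
          using chi_coeff_mseries_at[OF radius \<epsilon>, of l "fst x" "snd x"] by simp
      qed
      show "chi_coeff \<epsilon> l (s + 2 * pi) r = chi_coeff \<epsilon> l s r"
        by (rule chi_coeff_shift) simp_all
      show "bounded ((\<lambda>(s, r). chi_coeff \<epsilon> l s r) ` (UNIV \<times> {0..1}))"
        by (rule chi_coeff_bounded[OF radius \<epsilon>])
    next
      fix \<alpha> r s :: real assume "\<bar>\<alpha>\<bar> < \<alpha>\<^sub>0"
      then show "(\<lambda>l. \<alpha> ^ l *\<^sub>R chi_coeff \<epsilon> l s r) sums chi \<epsilon> \<alpha> r s" by (rule chi_sums[OF radius \<epsilon>])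
    qed
  next
    show "\<forall>\<alpha>. 0 < \<alpha> \<and> \<alpha> < \<alpha>\<^sub>0 \<and> odd (k_M \<alpha>) \<longrightarrow>
       extremal_front \<alpha> (of_int (k_M \<alpha>) * pi) = front_curve \<alpha> ` {0..2 * pi} \<and>
       continuous_on {0..2 * pi} (front_curve \<alpha>) \<and>
       front_curve \<alpha> (2 * pi) = front_curve \<alpha> 0 \<and>
       piecewise_analytic_on (front_curve \<alpha>) 0 (2 * pi) {0, pi, 2 * pi} \<and>
       (\<forall>n\<ge>1. \<forall>t\<in>{0<..<2 * pi} - {pi}.
          isCont (((\<lambda>g u. vector_derivative g (at u)) ^^ n) (front_curve \<alpha>)) t)"
      by (intro allI impI ballI conjI; (elim conjE)?)
         (rule front_eq_curve[OF radius] front_curve_continuous[OF radius] front_curve_closed[OF radius]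
           front_curve_piecewise[OF radius] front_curve_derivatives[OF radius]; assumption)+
  qed
qed

end
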